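(* Let $d\ge 2$ and consider the two-type competition model with conversion on $\mathbb{Z}^d$ with parameters $\lambda,\rho>0$. (i) There exists $\rho_\ell=\rho_\ell(d)>0$ such that if $\rho<\rho_\ell$ and $\lambda$ is sufficiently small, then type 1 survives with positive probability. (ii) There exists $\rho_u=\rho_u(d)<\infty$ such that if $\rho>\rho_u$, then type 1 dies out almost surely for all $\lambda>0$.
   Context: The two-type competition model with conversion on an infinite connected graph $G$ with parameters $\lambda,\rho>0$ is defined as follows. Each site (vertex) is at each time vacant, occupied by type 1, or occupied by type 2. At time $0$ a single distinguished site (the origin, when $G=\mathbb{Z}^d$ with nearest-neighbour edges) is occupied by type 1 and all other sites are vacant. A site occupied by type 1 attempts to occupy each neighbouring site at rate $1$ (through each edge, after an independent exponential time of rate $1$); the attempt succeeds only if the neighbouring site is vacant. To each site $x$ is assigned a conversion time $\mathcal{I}_x$, where $\{\mathcal{I}_x\}_x$ are i.i.d. exponential random variables of rate $\rho$, independent of everything else; once $x$ is occupied by type 1, after a further time $\mathcal{I}_x$ it converts to type 2 (if it is not already type 2). A site occupied by type 2 spreads type 2 through each incident edge at rate $\lambda$ to neighbouring sites that are vacant or occupied by type 1. A site occupied by type 2 stays type 2 forever. Equivalently, it is the continuous-time Markov process in which a vacant site becomes type 1 at rate (number of type 1 neighbours), a vacant site becomes type 2 at rate $\lambda\cdot$(number of type 2 neighbours), and a type 1 site becomes type 2 at rate $\rho+\lambda\cdot$(number of type 2 neighbours). Type 1 survives if the set of sites occupied by type 1 is non-empty at all times; otherwise type 1 dies out. *)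

theory Defs
  imports "HOL-Probability.Probability"
begin

text \<open>
  The randomness is carried by independent exponential clocks. For neighbours \<open>x\<close>, \<open>y\<close>,
  \<open>Spread1 x y\<close> is the delay between \<open>x\<close> becoming type 1 and its first attempt to occupy \<open>y\<close>,
  \<open>Spread2 x y\<close> is the delay between \<open>x\<close> becoming type 2 and its first attempt on \<open>y\<close>, and
  \<open>Convert x\<close> is the conversion time of \<open>x\<close>.
  One delay per type and directed edge suffices: a site never becomes vacant again and a type 2
  site stays type 2, so every later attempt through the same directed edge is without effect.
  Clocks of pairs that are not adjacent are never read.
\<close>

datatype 'v clock = Spread1 'v 'v | Spread2 'v 'v | Convert 'v

fun clock_rate :: "real \<Rightarrow> real \<Rightarrow> 'v clock \<Rightarrow> real" where
  "clock_rate lam rho (Spread1 x y) = 1"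
| "clock_rate lam rho (Spread2 x y) = lam"
| "clock_rate lam rho (Convert x) = rho"

definition clock_measure :: "real \<Rightarrow> real \<Rightarrow> ('v clock \<Rightarrow> real) measure" where
  "clock_measure lam rho =
     (\<Pi>\<^sub>M c\<in>UNIV. density lborel (\<lambda>t. ennreal (exponential_density (clock_rate lam rho c) t)))"

lemma prob_space_clock_measure:
  assumes "lam > 0" "rho > 0"
  shows "prob_space (clock_measure lam rho :: ('v clock \<Rightarrow> real) measure)"
proof -
  have "clock_rate lam rho c > 0" for c :: "'v clock"
    using assms by (cases c) auto
  then show ?thesis
    unfolding clock_measure_def by (intro prob_space_PiM prob_space_exponential_density)
qed

text \<open>
  The evolution is built event by event. A history \<open>(a, b)\<close> records the times \<open>a x\<close> and \<open>b x\<close> at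
  which \<open>x\<close> became type 1 and type 2, as far as already determined; the value \<open>\<infinity>\<close> means that
  this has not happened so far. Thus \<open>x\<close> is currently vacant if \<open>a x = b x = \<infinity>\<close>, type 1 if
  \<open>a x < \<infinity> = b x\<close>, and type 2 if \<open>b x < \<infinity>\<close> (with \<open>a x = \<infinity>\<close> if \<open>x\<close> was
  never type 1). The infimum of the empty set is \<open>\<infinity>\<close>.
  The coercion from reals to \<open>ennreal\<close> sends negative numbers, which the clocks take with
  probability 0, to 0.
\<close>

type_synonym 'v history = "('v \<Rightarrow> ennreal) \<times> ('v \<Rightarrow> ennreal)"

text \<open>The time at which \<open>y\<close> is due to become type 1, respectively type 2, given the history;
  \<open>\<infinity>\<close> if there is no such pending event.\<close>

definition due1 :: "('v \<Rightarrow> 'v \<Rightarrow> bool) \<Rightarrow> ('v clock \<Rightarrow> real) \<Rightarrow> 'v history \<Rightarrow> 'v \<Rightarrow> ennreal" where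
  "due1 adj w = (\<lambda>(a, b) y.
     if a y = \<infinity> \<and> b y = \<infinity>
     then (INF x\<in>{x. adj x y \<and> a x < \<infinity> \<and> b x = \<infinity>}. a x + ennreal (w (Spread1 x y)))
     else \<infinity>)"

definition due2 :: "('v \<Rightarrow> 'v \<Rightarrow> bool) \<Rightarrow> ('v clock \<Rightarrow> real) \<Rightarrow> 'v history \<Rightarrow> 'v \<Rightarrow> ennreal" where
  "due2 adj w = (\<lambda>(a, b) y.
     if b y = \<infinity>
     then min (a y + ennreal (w (Convert y)))
              (INF x\<in>{x. adj x y \<and> b x < \<infinity>}. b x + ennreal (w (Spread2 x y)))
     else \<infinity>)"

definition next_time :: "('v \<Rightarrow> 'v \<Rightarrow> bool) \<Rightarrow> ('v clock \<Rightarrow> real) \<Rightarrow> 'v history \<Rightarrow> ennreal" where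
  "next_time adj w h = (INF y. min (due1 adj w h y) (due2 adj w h y))"

text \<open>All events due at the next event time take place. Almost surely there is just one; the
  rule that type 2 wins a tie at a single site is therefore immaterial.\<close>

definition step :: "('v \<Rightarrow> 'v \<Rightarrow> bool) \<Rightarrow> ('v clock \<Rightarrow> real) \<Rightarrow> 'v history \<Rightarrow> 'v history" where
  "step adj w h = (let s = next_time adj w h in
     (\<lambda>y. if s < \<infinity> \<and> due1 adj w h y = s \<and> due2 adj w h y \<noteq> s then s else fst h y,
      \<lambda>y. if s < \<infinity> \<and> due2 adj w h y = s then s else snd h y))"

definition history :: "('v \<Rightarrow> 'v \<Rightarrow> bool) \<Rightarrow> 'v \<Rightarrow> ('v clock \<Rightarrow> real) \<Rightarrow> nat \<Rightarrow> 'v history" where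
  "history adj orig w n = (step adj w ^^ n) (\<lambda>x. if x = orig then 0 else \<infinity>, \<lambda>x. \<infinity>)"

text \<open>On a graph of bounded degree the event times almost surely tend to infinity, so that
  every event that takes place at a finite time is reached after finitely many steps.\<close>

definition time1 :: "('v \<Rightarrow> 'v \<Rightarrow> bool) \<Rightarrow> 'v \<Rightarrow> ('v clock \<Rightarrow> real) \<Rightarrow> 'v \<Rightarrow> ennreal" where
  "time1 adj orig w x = (INF n. fst (history adj orig w n) x)"

definition time2 :: "('v \<Rightarrow> 'v \<Rightarrow> bool) \<Rightarrow> 'v \<Rightarrow> ('v clock \<Rightarrow> real) \<Rightarrow> 'v \<Rightarrow> ennreal" where
  "time2 adj orig w x = (INF n. snd (history adj orig w n) x)"

datatype site_state = Vacant | Type1 | Type2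

definition state_at ::
  "('v \<Rightarrow> 'v \<Rightarrow> bool) \<Rightarrow> 'v \<Rightarrow> ('v clock \<Rightarrow> real) \<Rightarrow> real \<Rightarrow> 'v \<Rightarrow> site_state" where
  "state_at adj orig w t x =
     (if time2 adj orig w x \<le> ennreal t then Type2
      else if time1 adj orig w x \<le> ennreal t then Type1
      else Vacant)"

definition type1_survives :: "('v \<Rightarrow> 'v \<Rightarrow> bool) \<Rightarrow> 'v \<Rightarrow> ('v clock \<Rightarrow> real) \<Rightarrow> bool" where
  "type1_survives adj orig w \<longleftrightarrow> (\<forall>t\<ge>0. {x. state_at adj orig w t x = Type1} \<noteq> {})"

abbreviation type1_dies_out :: "('v \<Rightarrow> 'v \<Rightarrow> bool) \<Rightarrow> 'v \<Rightarrow> ('v clock \<Rightarrow> real) \<Rightarrow> bool" where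
  "type1_dies_out adj orig w \<equiv> \<not> type1_survives adj orig w"

definition lattice_adj :: "int ^ 'd \<Rightarrow> int ^ 'd \<Rightarrow> bool" where
  "lattice_adj x y \<longleftrightarrow> (\<Sum>i\<in>UNIV. \<bar>x $ i - y $ i\<bar>) = 1"

end

theory Submission imports Defs begin

text \<open>
  All three parts of the argument - the event times do not accumulate, type 1 dies out for large
  \<open>rho\<close>, type 1 survives for small \<open>rho\<close> and \<open>lam\<close> - compare the process with a set of rare
  ``bad'' sites, chosen so that badness of a site depends only on the clocks attached to it. A rare
  independent set is sparse: it splits into islands of ranks 0, 1, 2, ..., where an island of rank
  \<open>k\<close> has diameter at most \<open>al k\<close> and is separated by \<open>be k\<close>, much larger than
  \<open>al k\<close>, from everything that is not of smaller rank. A site that belongs to no island of rank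
  below \<open>k\<close> sees \<open>2 ^ k\<close> bad sites in one of not too many configurations, which is
  unlikely. Distances hardly change when the neighbourhoods of the islands are contracted, and
  detours around islands hardly lengthen a path.

  If a site is bad when one of its spreading clocks is very short, the first property bounds the
  growth of the occupied set. If it is bad when its conversion is slow or it spreads type 1 fast,
  all ancestors of a type 1 site are bad, so only finitely many sites are ever of type 1.

  For survival, good sites pass on type 1 within time \<open>M\<close>, and convert or pass on type 2 only
  after a much longer time \<open>K\<close>. A site is tainted if it becomes type 2 before it had time \<open>M\<close>
  as type 1. By induction over the events, every tainted site lies in the territory of some island
  and inside the cone that type 2 can have swept from that island by then. When the cone would leave
  the territory, type 1 has already gone around the island. So sites outside all territories become
  type 1, and there are infinitely many of them.
\<close>

text \<open>Two demands fix the scales. Contracting the islands of rank \<open>k\<close>, or going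
  around them, distorts lengths by a relative error of order \<open>al k / be k\<close>; these
  errors must be summable for all ranks together to cost only factors 1/2 and 2, whence the powers
  \<open>2 ^ k\<close> in \<open>sparse\<close>. On the other hand each rank squares the number of
  configurations in the union bound and multiplies it by a power of \<open>be k\<close>; while log
  (\<open>be k\<close>) is only quadratic in \<open>k\<close>, the count stays below C^(2^k) for a
  constant C, and a small probability of badness beats it.

  Distances are contracted because type 2 may cross a smaller island at once; only steps elsewhere
  surely take time. The argument for survival looks circular: going around an island needs a ring
  undisturbed by the other islands, so their cones must be confined as well. Taking the sites in the
  order of their times \<open>b\<close> breaks the circle. The cone of a larger island may still
  cover the ring; but contracted distance is constant on the ball around a smaller island, so this
  cone has then swept the exit site too, and the claim holds there.\<close>

section \<open>Two distances on the integer lattice\<close>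

definition dinf :: "int ^ 'd::finite \<Rightarrow> int ^ 'd \<Rightarrow> int" where
  "dinf x y = Max (range (\<lambda>i. \<bar>x $ i - y $ i\<bar>))"

definition d1 :: "int ^ 'd::finite \<Rightarrow> int ^ 'd \<Rightarrow> int" where
  "d1 x y = (\<Sum>i\<in>UNIV. \<bar>x $ i - y $ i\<bar>)"

lemma dinf_le_iff: "dinf x y \<le> r \<longleftrightarrow> (\<forall>i. \<bar>x $ i - y $ i\<bar> \<le> r)"
  unfolding dinf_def by (subst Max_le_iff) auto



lemma dinf_ge_iff: "r \<le> dinf x y \<longleftrightarrow> (\<exists>i. r \<le> \<bar>x $ i - y $ i\<bar>)"
  unfolding dinf_def by (subst Max_ge_iff) auto

lemma dinf_gt_iff: "r < dinf x y \<longleftrightarrow> (\<exists>i. r < \<bar>x $ i - y $ i\<bar>)"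
  unfolding dinf_def by (subst Max_gr_iff) auto

lemma dinf_component: "\<bar>x $ i - y $ i\<bar> \<le> dinf x y"
  unfolding dinf_def by (rule Max_ge) auto

lemma dinf_nonneg [simp]: "0 \<le> dinf x y"
  by (rule order_trans[OF abs_ge_zero dinf_component])

lemma dinf_refl [simp]: "dinf x x = 0"
  by (rule antisym) (auto simp: dinf_le_iff)

lemma dinf_commute: "dinf x y = dinf y x"
  unfolding dinf_def by (simp add: abs_minus_commute)

lemma dinf_triangle: "dinf x z \<le> dinf x y + dinf y z"
proof -
  have "\<bar>x $ i - z $ i\<bar> \<le> dinf x y + dinf y z" for i
    using dinf_component[of x i y] dinf_component[of y i z] by linarith
  then show ?thesis by (simp add: dinf_le_iff)
qed

lemma d1_nonneg [simp]: "0 \<le> d1 x y"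
  unfolding d1_def by (simp add: sum_nonneg)

lemma d1_refl [simp]: "d1 x x = 0"
  by (simp add: d1_def)

lemma d1_commute: "d1 x y = d1 y x"
  unfolding d1_def by (simp add: abs_minus_commute)

lemma d1_triangle: "d1 x z \<le> d1 x y + d1 y z"
  unfolding d1_def sum.distrib[symmetric] by (rule sum_mono) linarith

lemma dinf_le_d1: "dinf x y \<le> d1 x y"
proof -
  have "\<bar>x $ i - y $ i\<bar> \<le> d1 x y" for i
    unfolding d1_def by (rule member_le_sum) auto
  then show ?thesis by (simp add: dinf_le_iff)
qed

lemma d1_le_dinf: "d1 (x :: int ^ 'd::finite) y \<le> int CARD('d) * dinf x y"
  unfolding d1_def by (rule sum_bounded_above) (rule dinf_component)

lemma lattice_adj_d1: "lattice_adj x y \<longleftrightarrow> d1 x y = 1"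
  unfolding lattice_adj_def d1_def ..

lemma lattice_adj_commute: "lattice_adj x y \<longleftrightarrow> lattice_adj y x"
  by (simp add: lattice_adj_d1 d1_commute)

lemma lattice_adj_dinf: "lattice_adj x y \<Longrightarrow> dinf x y \<le> 1"
  using dinf_le_d1[of x y] by (simp add: lattice_adj_d1)

lemma card_dinf_ball:
  fixes p :: "int ^ 'd::finite"
  assumes "0 \<le> r"
  shows "finite {x. dinf p x \<le> r}" "card {x. dinf p x \<le> r} = nat (2 * r + 1) ^ CARD('d)"
proof -
  let ?P = "PiE (UNIV :: 'd set) (\<lambda>i. {p $ i - r .. p $ i + r})"
  have bij: "bij_betw (\<lambda>f. (\<chi> i. f i) :: int ^ 'd) ?P {x. dinf p x \<le> r}"
  proof (rule bij_betwI[where g = "\<lambda>x i. x $ i"])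
    show "(\<lambda>f. (\<chi> i. f i) :: int ^ 'd) \<in> ?P \<rightarrow> {x. dinf p x \<le> r}"
      by (auto simp: dinf_le_iff abs_le_iff PiE_iff algebra_simps)
    show "(\<lambda>x i. x $ i) \<in> {x. dinf p x \<le> r} \<rightarrow> ?P"
      unfolding dinf_le_iff by (auto simp: PiE_iff) (smt (verit))+
  qed (auto simp: vec_eq_iff)
  have "finite ?P" by (intro finite_PiE) auto
  then show "finite {x. dinf p x \<le> r}"
    using bij bij_betw_finite by blast
  have "card ?P = (\<Prod>i\<in>(UNIV :: 'd set). card {p $ i - r .. p $ i + r})"
    by (rule card_PiE) auto
  also have "\<dots> = (\<Prod>i\<in>(UNIV :: 'd set). nat (2 * r + 1))"
    by (rule prod.cong) (auto simp: algebra_simps)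
  finally show "card {x. dinf p x \<le> r} = nat (2 * r + 1) ^ CARD('d)"
    using bij_betw_same_card[OF bij] by simp
qed

lemma finite_neighbours: "finite {x :: int ^ 'd::finite. lattice_adj x y}"
  by (rule finite_subset[OF _ card_dinf_ball(1)[of 1 y]])
    (auto dest: lattice_adj_dinf simp: dinf_commute)

section \<open>Paths confined to a set of sites, with a length budget\<close>

text \<open>The budget is real and may be weakened by a rule, so that bounds such as
  \<open>(1 + \<eta>) * d1 u v\<close> add up along concatenations without rounding.\<close>

inductive conn :: "(int ^ 'd::finite) set \<Rightarrow> int ^ 'd \<Rightarrow> real \<Rightarrow> int ^ 'd \<Rightarrow> bool"
  for S x where
  conn_refl: "x \<in> S \<Longrightarrow> conn S x 0 x"
| conn_step: "conn S x r y \<Longrightarrow> lattice_adj y z \<Longrightarrow> z \<in> S \<Longrightarrow> conn S x (r + 1) z"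
| conn_weaken: "conn S x r y \<Longrightarrow> r \<le> r' \<Longrightarrow> conn S x r' y"



lemma conn_end: "conn S x r y \<Longrightarrow> y \<in> S"
  by (induction rule: conn.induct) auto

lemma conn_nonneg: "conn S x r y \<Longrightarrow> 0 \<le> r"
  by (induction rule: conn.induct) auto

lemma conn_d1: "conn S x r y \<Longrightarrow> real_of_int (d1 x y) \<le> r"
proof (induction rule: conn.induct)
  case (conn_step r y z)
  then show ?case using d1_triangle[of x z y] by (simp add: lattice_adj_d1)
qed auto

text \<open>A walk of length \<open>r\<close> stays within \<open>d1\<close>-distance
  \<open>r\<close> of its start, so only that part of \<open>S\<close> matters. This is what
  confines paths to the surroundings of an island.\<close>

lemma conn_localised:
  "conn S x r y \<Longrightarrow> (\<And>v. v \<in> S \<Longrightarrow> real_of_int (d1 x v) \<le> r \<Longrightarrow> v \<in> S') \<Longrightarrow> conn S' x r y"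
proof (induction rule: conn.induct)
  case (conn_step r y z)
  have "d1 x z \<le> r + 1"
    using conn_d1[OF conn_step.hyps(1)] d1_triangle[of x z y] conn_step.hyps(2)
    by (simp add: lattice_adj_d1)
  then show ?case using conn_step by (auto intro!: conn.conn_step)
next
  case (conn_weaken r y r')
  then show ?case by (meson conn.conn_weaken order_trans)
qed (auto intro: conn_refl)

lemma conn_mono: "conn S x r y \<Longrightarrow> S \<subseteq> S' \<Longrightarrow> conn S' x r y"
  by (erule conn_localised) auto

lemma conn_trans_aux: "conn S y r z \<Longrightarrow> conn S x q y \<Longrightarrow> conn S x (q + r) z"
proof (induction rule: conn.induct)
  case (conn_step r y' z)
  then show ?case using conn.conn_step[of S x "q + r" y' z] by (simp add: add.assoc)
next
  case (conn_weaken r y' r')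
  then show ?case by (meson conn.conn_weaken add_left_mono)
qed simp

lemma conn_trans: "conn S x q y \<Longrightarrow> conn S y r z \<Longrightarrow> q + r \<le> t \<Longrightarrow> conn S x t z"
  using conn_trans_aux conn_weaken by metis

lemma conn_one: "lattice_adj x y \<Longrightarrow> x \<in> S \<Longrightarrow> y \<in> S \<Longrightarrow> conn S x 1 y"
  using conn_step[OF conn_refl] by fastforce

lemma conn_sym: "conn S x r y \<Longrightarrow> conn S y r x"
proof (induction rule: conn.induct)
  case (conn_step r y z)
  then have "conn S z 1 y"
    by (auto intro!: conn_one conn_end[OF conn_step(1)] simp: lattice_adj_commute)
  then show ?case using conn_step.IH by (rule conn_trans) simp
qed (auto intro: conn_refl conn_weaken)

definition chull :: "int ^ 'd::finite \<Rightarrow> int ^ 'd \<Rightarrow> (int ^ 'd) set" where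
  "chull x y = {v. \<forall>i. min (x $ i) (y $ i) \<le> v $ i \<and> v $ i \<le> max (x $ i) (y $ i)}"

lemma conn_hull:
  assumes "chull x y \<subseteq> S"
  shows "conn S x (d1 x y) y"
  using assms
proof (induction "nat (d1 x y)" arbitrary: y)
  case 0
  then have "d1 x y = 0" by (simp add: antisym)
  then have "x = y" by (simp add: d1_def sum_nonneg_eq_0_iff vec_eq_iff)
  moreover have "y \<in> S" using 0(2) by (auto simp: chull_def)
  ultimately show ?case by (simp add: conn_refl)
next
  case (Suc n)
  then have "x \<noteq> y" by auto
  then obtain i where i: "x $ i \<noteq> y $ i" by (auto simp: vec_eq_iff)
  \<comment> \<open>One unit back from \<open>y\<close> towards \<open>x\<close> in a coordinate
    where they differ: this stays in the box and shortens the distance by 1.\<close>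
  define y' where "y' = (\<chi> j. if j = i then y $ i + sgn (x $ i - y $ i) else y $ j)"
  have *: "d1 x y = \<bar>x $ i - y $ i\<bar> + (\<Sum>j\<in>UNIV - {i}. \<bar>x $ j - y $ j\<bar>)"
    unfolding d1_def by (rule sum.remove) auto
  have "d1 x y' = \<bar>x $ i - y' $ i\<bar> + (\<Sum>j\<in>UNIV - {i}. \<bar>x $ j - y' $ j\<bar>)"
    unfolding d1_def by (rule sum.remove) auto
  also have "\<dots> = \<bar>x $ i - y $ i\<bar> - 1 + (\<Sum>j\<in>UNIV - {i}. \<bar>x $ j - y $ j\<bar>)"
    using i by (auto simp: y'_def sgn_if)
  finally have d: "d1 x y' = d1 x y - 1" using * by simp
  have "d1 y' y = \<bar>y' $ i - y $ i\<bar> + (\<Sum>j\<in>UNIV - {i}. \<bar>y' $ j - y $ j\<bar>)"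
    unfolding d1_def by (rule sum.remove) auto
  then have a: "lattice_adj y' y" using i by (auto simp: lattice_adj_d1 y'_def sgn_if)
  have h: "chull x y' \<subseteq> chull x y"
    unfolding chull_def
  proof safe
    fix v j
    assume "\<forall>k. min (x $ k) (y' $ k) \<le> v $ k \<and> v $ k \<le> max (x $ k) (y' $ k)"
    then have "min (x $ j) (y' $ j) \<le> v $ j \<and> v $ j \<le> max (x $ j) (y' $ j)" by blast
    moreover have "min (x $ j) (y $ j) \<le> min (x $ j) (y' $ j)" "max (x $ j) (y' $ j) \<le> max (x $ j) (y $ j)"
      using i by (cases "j = i"; cases "x $ i < y $ i"; simp add: y'_def sgn_if)+
    ultimately show "min (x $ j) (y $ j) \<le> v $ j" "v $ j \<le> max (x $ j) (y $ j)"
      by linarith+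
  qed
  have "conn S x (d1 x y') y'"
    using Suc h d by (intro Suc(1)) auto
  moreover have "y \<in> S" using Suc(3) by (auto simp: chull_def)
  ultimately show ?case using conn_step[OF _ a] d by fastforce
qed

text \<open>A coordinate that is far from the obstacle can be kept fixed while all the others move;
  in dimension at least two this leads around the obstacle in three such moves.\<close>

lemma conn_ring:
  fixes x y :: "int ^ 'd::finite" and far :: "'d \<Rightarrow> int \<Rightarrow> bool" and W :: int
  assumes card: "CARD('d) \<ge> 2"
    and S: "\<And>v. (\<And>i. lo i \<le> v $ i \<and> v $ i \<le> hi i) \<Longrightarrow> (\<exists>i. far i (v $ i)) \<Longrightarrow> v \<in> S"
    and t: "\<And>i. far i (t i) \<and> lo i \<le> t i \<and> t i \<le> hi i"
    and W: "\<And>i. hi i - lo i \<le> W"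
    and x: "\<And>i. lo i \<le> x $ i \<and> x $ i \<le> hi i" "\<exists>i. far i (x $ i)"
    and y: "\<And>i. lo i \<le> y $ i \<and> y $ i \<le> hi i" "\<exists>i. far i (y $ i)"
  shows "conn S x (3 * CARD('d) * W) y"
proof -
  have move: "conn S u (CARD('d) * W) v"
    if "\<And>i. lo i \<le> u $ i \<and> u $ i \<le> hi i" "\<And>i. lo i \<le> v $ i \<and> v $ i \<le> hi i"
      "u $ k = v $ k" "far k (u $ k)" for u v :: "int ^ 'd" and k
  proof -
    have "chull u v \<subseteq> S"
    proof
      fix w assume w: "w \<in> chull u v"
      have "lo i \<le> w $ i \<and> w $ i \<le> hi i" for i
        using w that(1)[of i] that(2)[of i] by (auto simp: chull_def min_def max_def dest!: spec[of _ i] split: if_splits)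
      moreover have "w $ k = u $ k"
        using w that(3) by (auto simp: chull_def dest!: spec[of _ k])
      ultimately show "w \<in> S" using that(4) by (intro S exI[of _ k]) auto
    qed
    then have "conn S u (d1 u v) v" by (rule conn_hull)
    moreover have "d1 u v \<le> CARD('d) * W"
    proof -
      have "\<bar>u $ i - v $ i\<bar> \<le> W" for i
        using that(1)[of i] that(2)[of i] W[of i] by linarith
      then have "dinf u v \<le> W" by (simp add: dinf_le_iff)
      then have "int CARD('d) * dinf u v \<le> int CARD('d) * W" by (intro mult_left_mono) auto
      then show ?thesis using d1_le_dinf[of u v] by linarith
    qed
    ultimately show ?thesis by (elim conn_weaken) linarith
  qed
  obtain i where i: "far i (x $ i)" using x(2) by blast
  obtain j where j: "far j (y $ j)" using y(2) by blast
  have W0: "0 \<le> W" using W[of i] x(1)[of i] by linarith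
  define upd where "upd v k s = (\<chi> l. if l = k then s else v $ l)" for v :: "int ^ 'd" and k s
  have upd: "lo l \<le> upd v k s $ l \<and> upd v k s $ l \<le> hi l"
    if "\<And>l. lo l \<le> v $ l \<and> v $ l \<le> hi l" "lo k \<le> s \<and> s \<le> hi k" for v k s l
    using that by (simp add: upd_def)
  show ?thesis
  proof (cases "i = j")
    case False
    let ?z = "upd x j (y $ j)"
    have "conn S x (CARD('d) * W) ?z"
      by (rule move[where k = i]) (use x y upd False i in \<open>auto simp: upd_def\<close>)
    moreover have "conn S ?z (CARD('d) * W) y"
      by (rule move[where k = j]) (use x y upd j in \<open>auto simp: upd_def\<close>)
    ultimately show ?thesis
      by (rule conn_trans) (use W0 in simp)
  next
    case True
    \<comment> \<open>The far coordinates agree, but \<open>x\<close> and \<open>y\<close> may lie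
      on opposite sides of the obstacle. A second coordinate \<open>l\<close> is parked at the far
      value \<open>t l\<close> while coordinate \<open>i\<close> changes.\<close>
    have "\<exists>l. l \<noteq> i"
    proof (rule ccontr)
      assume "\<not> ?thesis"
      then have "CARD('d) = card {i}" by (intro arg_cong[where f = card]) auto
      then show False using card by simp
    qed
    then obtain l where l: "l \<noteq> i" by blast
    let ?z = "upd x l (t l)" and ?w = "upd y l (t l)"
    have t': "far l (t l)" "lo l \<le> t l \<and> t l \<le> hi l" using t[of l] by auto
    have z: "lo m \<le> ?z $ m \<and> ?z $ m \<le> hi m" and w: "lo m \<le> ?w $ m \<and> ?w $ m \<le> hi m" for m
      using upd[of x l "t l" m] upd[of y l "t l" m] x(1) y(1) t' by blast+
    have "conn S x (CARD('d) * W) ?z"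
      by (rule move[where k = i, OF x(1) z]) (use l i in \<open>simp_all add: upd_def\<close>)
    moreover have "conn S ?z (CARD('d) * W) ?w"
      by (rule move[where k = l, OF z w]) (use t' in \<open>simp_all add: upd_def\<close>)
    ultimately have "conn S x (CARD('d) * W + CARD('d) * W) ?w"
      by (rule conn_trans) simp
    moreover have "conn S ?w (CARD('d) * W) y"
      by (rule move[where k = j, OF w y(1)]) (use l True j in \<open>simp_all add: upd_def\<close>)
    ultimately show ?thesis by (rule conn_trans) simp
  qed
qed

section \<open>Coarse lattices and detours around separated obstacles\<close>

definition scale :: "int \<Rightarrow> int ^ 'd \<Rightarrow> int ^ 'd::finite" where
  "scale s g = (\<chi> i. s * g $ i)"

lemma scale_component [simp]: "scale s g $ i = s * g $ i"
  by (simp add: scale_def)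

lemma d1_scale: "0 \<le> s \<Longrightarrow> d1 (scale s g) (scale s h) = s * d1 g h"
proof -
  assume "0 \<le> s"
  then have "\<bar>s * a - s * b\<bar> = s * \<bar>a - b\<bar>" for a b
    by (metis abs_mult abs_of_nonneg right_diff_distrib)
  then show ?thesis by (simp add: d1_def sum_distrib_left)
qed

lemma dinf_scale_adj: "0 \<le> s \<Longrightarrow> lattice_adj g h \<Longrightarrow> dinf (scale s g) (scale s h) \<le> s"
  using dinf_le_d1[of "scale s g" "scale s h"] by (simp add: d1_scale lattice_adj_d1)

lemma scale_near:
  assumes "0 < s"
  obtains g where "dinf (scale s g) x \<le> s"
proof
  show "dinf (scale s (\<chi> i. x $ i div s)) x \<le> s"
    unfolding dinf_le_iff
  proof
    fix i
    have "s * (x $ i div s) = x $ i - x $ i mod s" by (simp add: minus_mod_eq_mult_div)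
    moreover have "0 \<le> x $ i mod s" "x $ i mod s < s" using assms by auto
    ultimately show "\<bar>scale s (\<chi> i. x $ i div s) $ i - x $ i\<bar> \<le> s" by simp
  qed
qed

text \<open>\<open>W\<close> is the diameter \<open>2 * R\<close> in units of \<open>s\<close>,
  rounded up; the rounding adds at most \<open>s\<close>, hence at most another
  \<open>R\<close>.\<close>

lemma ring_width:
  fixes s R :: int
  assumes "0 < s" "s \<le> R"
  obtains W where "2 * R \<le> s * W" "s * W \<le> 3 * R" "0 \<le> W"
proof
  have "s * (2 * R div s + 1) = 2 * R - 2 * R mod s + s"
    by (simp add: distrib_left minus_mod_eq_mult_div)
  moreover have "0 \<le> 2 * R mod s" "2 * R mod s < s" using assms by auto
  ultimately show "2 * R \<le> s * (2 * R div s + 1)" "s * (2 * R div s + 1) \<le> 3 * R"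
    using assms by linarith+
  have "0 \<le> 2 * R div s" using assms by (simp add: pos_imp_zdiv_nonneg_iff)
  then show "0 \<le> 2 * R div s + 1" by simp
qed

text \<open>\<open>conn_ring\<close> on the lattice of mesh \<open>s\<close>, around a centre
  \<open>p\<close> that need not be a grid point. The shell between \<open>\<rho>\<close> and
  \<open>R\<close> is at least \<open>s\<close> thick, so every coordinate has a grid value in
  it.\<close>

lemma conn_ring_scale:
  fixes p :: "int ^ 'd::finite" and s \<rho> R W :: int
  assumes card: "CARD('d) \<ge> 2" and s: "0 < s" and \<rho>: "0 \<le> \<rho>" "\<rho> + s \<le> R" and W: "2 * R \<le> s * W"
    and S: "\<And>g. \<rho> < dinf (scale s g) p \<Longrightarrow> dinf (scale s g) p \<le> R \<Longrightarrow> g \<in> S"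
    and x: "\<rho> < dinf (scale s x) p" "dinf (scale s x) p \<le> R"
    and y: "\<rho> < dinf (scale s y) p" "dinf (scale s y) p \<le> R"
  shows "conn S x (3 * CARD('d) * W) y"
proof -
  define lo where "lo i = - ((R - p $ i) div s)" for i
  define hi where "hi i = (R + p $ i) div s" for i
  have le_div: "t \<le> a div s \<longleftrightarrow> t * s \<le> a" for t a
  proof
    assume "t \<le> a div s"
    then have "t * s \<le> (a div s) * s" using s by simp
    then show "t * s \<le> a" using s pos_mod_sign[OF s, of a] div_mult_mod_eq[of a s] by linarith
  next
    assume "t * s \<le> a"
    then have "(t * s) div s \<le> a div s" using s by (rule zdiv_mono1)
    then show "t \<le> a div s" using s by simp
  qed
  have lo: "lo i \<le> t \<longleftrightarrow> p $ i - s * t \<le> R" for i t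
  proof -
    have "lo i \<le> t \<longleftrightarrow> - t \<le> (R - p $ i) div s" by (auto simp: lo_def)
    also have "\<dots> \<longleftrightarrow> - t * s \<le> R - p $ i" using s by (simp add: le_div)
    finally show ?thesis by (auto simp: algebra_simps)
  qed
  have hi: "t \<le> hi i \<longleftrightarrow> s * t - p $ i \<le> R" for i t
    using s by (auto simp: hi_def le_div algebra_simps)
  have lohi: "(lo i \<le> t \<and> t \<le> hi i) \<longleftrightarrow> \<bar>s * t - p $ i\<bar> \<le> R" for i t
    unfolding lo hi by auto
  show ?thesis
  proof (rule conn_ring[OF card, where far = "\<lambda>i t. \<rho> < \<bar>s * t - p $ i\<bar>" and lo = lo and hi = hi
        and t = "\<lambda>i. (\<rho> + p $ i) div s + 1"])
    show "\<rho> < \<bar>s * ((\<rho> + p $ i) div s + 1) - p $ i\<bar> \<and>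
      lo i \<le> (\<rho> + p $ i) div s + 1 \<and> (\<rho> + p $ i) div s + 1 \<le> hi i" for i
    proof -
      have "s * ((\<rho> + p $ i) div s) = \<rho> + p $ i - (\<rho> + p $ i) mod s"
        by (simp add: minus_mod_eq_mult_div)
      moreover have "0 \<le> (\<rho> + p $ i) mod s" "(\<rho> + p $ i) mod s < s" using s by auto
      ultimately show ?thesis unfolding lohi using \<rho> by (auto simp: distrib_left)
    qed
    show "hi i - lo i \<le> W" for i
    proof -
      have *: "s * (a div s) \<le> a" for a using s by (simp add: minus_mod_eq_mult_div[symmetric])
      have "s * (hi i - lo i) \<le> 2 * R"
        using *[of "R - p $ i"] *[of "R + p $ i"] by (simp add: hi_def lo_def distrib_left)
      also have "\<dots> \<le> s * W" by (rule W)
      finally show ?thesis using s by simp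
    qed
  qed (use S x y in \<open>auto simp: lohi dinf_gt_iff dinf_le_iff\<close>)
qed

text \<open>A step of the path that enters an obstacle is rerouted along the surrounding ring. Distinct
  obstacles are far apart, so the cost of a ring is paid for, at rate \<open>\<eta>\<close>, by the way travelled
  since the previous one; only the first ring remains as an additive constant.\<close>

lemma conn_avoiding_obstacles:
  fixes u v :: "int ^ 'd::finite" and s \<rho> R W b :: int and \<eta> :: real
  assumes card: "CARD('d) \<ge> 2" and s: "0 < s" and \<rho>: "0 \<le> \<rho>" "\<rho> + s \<le> R" and W: "2 * R \<le> s * W"
    and sep: "\<And>p q. p \<in> P \<Longrightarrow> q \<in> P \<Longrightarrow> p \<noteq> q \<Longrightarrow> b < dinf p q" and b: "2 * R + s \<le> b"
    and \<eta>: "0 \<le> \<eta>" "3 * CARD('d) * W * s \<le> \<eta> * (b - 2 * R)"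
    and G: "G = {g. \<forall>p\<in>P. \<rho> < dinf (scale s g) p}"
    and uv: "u \<in> G" "v \<in> G"
  shows "conn G u ((1 + \<eta>) * d1 u v + 3 * CARD('d) * W) v"
proof -
  let ?N = "real_of_int (3 * CARD('d) * W)"
  define ring where "ring p = {g. \<rho> < dinf (scale s g) p \<and> dinf (scale s g) p \<le> R}"
    for p :: "int ^ 'd"
  have W0: "0 \<le> W"
  proof -
    have "0 \<le> s * W" using W \<rho> s by linarith
    then show ?thesis using s by (simp add: zero_le_mult_iff)
  qed
  then have N0: "0 \<le> ?N" by simp
  have ring_G: "g \<in> G" if "g \<in> ring p" "p \<in> P" for g p
    unfolding G
  proof safe
    fix q assume "q \<in> P"
    then show "\<rho> < dinf (scale s g) q"
      using that sep[of p q] dinf_triangle[of p q "scale s g"] b \<rho> s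
      by (cases "q = p") (auto simp: ring_def dinf_commute)
  qed
  have ring_conn: "conn G g ?N h" if "g \<in> ring p" "h \<in> ring p" "p \<in> P" for g h p
    using conn_ring_scale[OF card s \<rho> W, where p = p and S = G and x = g and y = h] that ring_G
    by (auto simp: ring_def)
  have enter: "\<exists>p\<in>P. y \<in> ring p \<and> dinf (scale s z) p \<le> R"
    if yz: "y \<in> G" "z \<notin> G" "lattice_adj y z" for y z
  proof -
    obtain p where p: "p \<in> P" "dinf (scale s z) p \<le> \<rho>" using yz(2) by (auto simp: G not_less)
    have "dinf (scale s y) p \<le> \<rho> + s"
      using dinf_triangle[of "scale s y" p "scale s z"] dinf_scale_adj[of s y z] yz(3) p s by auto
    then show ?thesis using p yz(1) \<rho> s by (auto simp: ring_def G intro!: bexI[of _ p])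
  qed
  \<comment> \<open>\<open>n\<close> is the length of the original walk. The last ring met is that
    around \<open>p\<close>, after \<open>n1\<close> steps; all of it is within budget. Since then
    the walk is either still inside the ball of radius \<open>R\<close>, or it has left the ring at
    \<open>g\<close> and run through \<open>G\<close>.\<close>
  define Inv where "Inv n y \<longleftrightarrow> conn G u n y \<or> (\<exists>p\<in>P. \<exists>n1\<le>n. 0 \<le> n1 \<and>
      (\<forall>g\<in>ring p. conn G u ((1 + \<eta>) * n1 + ?N) g) \<and>
      (dinf (scale s y) p \<le> R \<or> (\<exists>g\<in>ring p. conn G g (n - n1) y)))" for n y
  have Inv: "Inv r y" if "conn UNIV u r y" for r y
    using that
  proof (induction rule: conn.induct)
    case conn_refl
    then show ?case using uv(1) by (auto simp: Inv_def intro: conn.conn_refl)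
  next
    case (conn_weaken r y r')
    from conn_weaken.IH consider (a) "conn G u r y"
      | (b) p n1 where "p \<in> P" "n1 \<le> r" "0 \<le> n1" "\<forall>g\<in>ring p. conn G u ((1 + \<eta>) * n1 + ?N) g"
          "dinf (scale s y) p \<le> R"
      | (c) p n1 g where "p \<in> P" "n1 \<le> r" "0 \<le> n1" "\<forall>g\<in>ring p. conn G u ((1 + \<eta>) * n1 + ?N) g"
          "g \<in> ring p" "conn G g (r - n1) y"
      unfolding Inv_def by blast
    then show ?case
    proof cases
      case a
      then have "conn G u r' y" using conn_weaken.hyps(2) by (rule conn.conn_weaken)
      then show ?thesis by (simp add: Inv_def)
    next
      case b
      then show ?thesis using conn_weaken.hyps(2) unfolding Inv_def
        by (intro disjI2 bexI[of _ p] exI[of _ n1]) auto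
    next
      case c
      have "conn G g (r' - n1) y" using c(6) by (rule conn.conn_weaken) (use conn_weaken.hyps in simp)
      then show ?thesis using c conn_weaken.hyps(2) unfolding Inv_def
        by (intro disjI2 bexI[of _ p] exI[of _ n1]) auto
    qed
  next
    case (conn_step r y z)
    have r0: "0 \<le> r" using conn_step.hyps(1) by (rule conn_nonneg)
    from conn_step.IH consider (a) "conn G u r y"
      | (b) p n1 where "p \<in> P" "n1 \<le> r" "0 \<le> n1" "\<forall>g\<in>ring p. conn G u ((1 + \<eta>) * n1 + ?N) g"
          "dinf (scale s y) p \<le> R"
      | (c) p n1 g where "p \<in> P" "n1 \<le> r" "0 \<le> n1" "\<forall>g\<in>ring p. conn G u ((1 + \<eta>) * n1 + ?N) g"
          "g \<in> ring p" "conn G g (r - n1) y"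
      unfolding Inv_def by blast
    then show ?case
    proof cases
      case a
      show ?thesis
      proof (cases "z \<in> G")
        case True
        then show ?thesis using conn.conn_step[OF a conn_step.hyps(2)] by (simp add: Inv_def)
      next
        case False
        then obtain p where p: "p \<in> P" "y \<in> ring p" "dinf (scale s z) p \<le> R"
          using enter conn_end[OF a] conn_step.hyps(2) by blast
        have "conn G u ((1 + \<eta>) * r + ?N) g" if "g \<in> ring p" for g
          by (rule conn_trans[OF a ring_conn[OF p(2) that p(1)]]) (use \<eta> r0 in \<open>simp add: algebra_simps\<close>)
        then show ?thesis
          using p r0 unfolding Inv_def by (intro disjI2 bexI[of _ p] exI[of _ r]) auto
      qed
    next
      case b
      show ?thesis
      proof (cases "dinf (scale s z) p \<le> R")
        case True
        then show ?thesis using b unfolding Inv_def by (intro disjI2 bexI[of _ p] exI[of _ n1]) auto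
      next
        case False
        have *: "dinf (scale s z) p \<le> dinf (scale s y) p + s"
          using dinf_triangle[of "scale s z" p "scale s y"] dinf_scale_adj[of s y z] conn_step.hyps(2) s
          by (auto simp: dinf_commute)
        then have y: "y \<in> ring p" using b(5) False \<rho> s by (auto simp: ring_def)
        have "z \<in> G" unfolding G
        proof safe
          fix q assume q: "q \<in> P"
          show "\<rho> < dinf (scale s z) q"
            using q False b(1) sep[of p q] dinf_triangle[of p q "scale s z"] * b(5) \<rho> s \<open>2 * R + s \<le> b\<close>
            by (cases "q = p") (auto simp: dinf_commute)
        qed
        then have "conn G y 1 z" using ring_G[OF y b(1)] conn_step.hyps(2) by (intro conn_one)
        then have "conn G y (r + 1 - n1) z" by (rule conn.conn_weaken) (use b in simp)
        then show ?thesis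
          using b y unfolding Inv_def by (intro disjI2 bexI[of _ p] exI[of _ n1]) auto
      qed
    next
      case c
      show ?thesis
      proof (cases "z \<in> G")
        case True
        have "conn G g (r - n1 + 1) z" by (rule conn.conn_step[OF c(6) conn_step.hyps(2) True])
        then show ?thesis
          using c unfolding Inv_def
          by (intro disjI2 bexI[of _ p] exI[of _ n1]) (auto simp: algebra_simps)
      next
        case False
        then obtain q where q: "q \<in> P" "y \<in> ring q" "dinf (scale s z) q \<le> R"
          using enter conn_end[OF c(6)] conn_step.hyps(2) by blast
        show ?thesis
        proof (cases "q = p")
          case True
          then show ?thesis using c q unfolding Inv_def
            by (intro disjI2 bexI[of _ p] exI[of _ n1]) auto
        next
          case False
          \<comment> \<open>Distinct rings are at least \<open>b - 2 * R\<close> apart. Crossing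
            this gap takes \<open>(b - 2 * R) / s\<close> coarse steps, which at rate
            \<open>\<eta>\<close> pay for the new ring.\<close>
          have "b \<le> dinf (scale s g) (scale s y) + 2 * R"
            using sep[of p q] c(1,5) q False dinf_triangle[of p q "scale s g"]
              dinf_triangle[of "scale s g" q "scale s y"]
            by (auto simp: ring_def dinf_commute)
          also have "dinf (scale s g) (scale s y) \<le> s * d1 g y"
            using dinf_le_d1[of "scale s g" "scale s y"] s by (simp add: d1_scale)
          finally have "b - 2 * R \<le> s * d1 g y" by simp
          then have "real_of_int (b - 2 * R) \<le> s * real_of_int (d1 g y)"
            by (simp only: of_int_mult[symmetric] of_int_le_iff)
          also have "\<dots> \<le> s * (r - n1)" using conn_d1[OF c(6)] s by (intro mult_left_mono) auto
          finally have "\<eta> * (b - 2 * R) \<le> \<eta> * (s * (r - n1))"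
            using \<eta>(1) by (intro mult_left_mono)
          moreover have "?N * s \<le> \<eta> * (b - 2 * R)" using \<eta>(2) by simp
          ultimately have "?N * s \<le> \<eta> * (s * (r - n1))" by (rule order_trans[rotated])
          also have "\<dots> = \<eta> * (r - n1) * s" by (rule mult.left_commute[THEN trans, OF mult.commute])
          finally have N: "?N \<le> \<eta> * (r - n1)" by (rule mult_right_le_imp_le) (use s in simp)
          have 1: "conn G u ((1 + \<eta>) * n1 + ?N + (r - n1)) y"
            using c(4,5) by (intro conn_trans[OF _ c(6) order_refl]) auto
          have "conn G u ((1 + \<eta>) * r + ?N) h" if "h \<in> ring q" for h
            by (rule conn_trans[OF 1 ring_conn[OF q(2) that q(1)]]) (use N in \<open>simp add: algebra_simps\<close>)
          then show ?thesis
            using q r0 unfolding Inv_def by (intro disjI2 bexI[of _ q] exI[of _ r]) auto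
        qed
      qed
    qed
  qed
  have "conn UNIV u (d1 u v) v" by (rule conn_hull) simp
  then have "Inv (d1 u v) v" by (rule Inv)
  then consider "conn G u (d1 u v) v"
    | p and n1 :: real where "p \<in> P" "n1 \<le> d1 u v" "0 \<le> n1" "\<forall>g\<in>ring p. conn G u ((1 + \<eta>) * n1 + ?N) g"
          "dinf (scale s v) p \<le> R"
    | p g and n1 :: real where "p \<in> P" "n1 \<le> d1 u v" "0 \<le> n1" "\<forall>g\<in>ring p. conn G u ((1 + \<eta>) * n1 + ?N) g"
          "g \<in> ring p" "conn G g (d1 u v - n1) v"
    unfolding Inv_def by blast
  then show ?thesis
  proof cases
    case 1
    have "0 \<le> \<eta> * d1 u v" using \<eta>(1) by simp
    then have "d1 u v \<le> (1 + \<eta>) * d1 u v + ?N" using N0 by (simp add: distrib_right)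
    with 1 show ?thesis by (rule conn_weaken)
  next
    case 2
    have "\<rho> < dinf (scale s v) p" using uv(2) 2(1) unfolding G by simp
    then have "v \<in> ring p" using 2(5) by (simp add: ring_def)
    then have "conn G u ((1 + \<eta>) * n1 + ?N) v" using 2(4) by simp
    moreover have "(1 + \<eta>) * n1 \<le> (1 + \<eta>) * d1 u v" using 2(2) \<eta>(1) by (intro mult_left_mono) auto
    then have "(1 + \<eta>) * n1 + ?N \<le> (1 + \<eta>) * d1 u v + ?N" by (rule add_right_mono)
    ultimately show ?thesis by (rule conn_weaken)
  next
    case 3
    define N D where "N = ?N" and "D = real_of_int (d1 u v)"
    have "conn G u ((1 + \<eta>) * n1 + N) g" unfolding N_def by (rule bspec[OF 3(4,5)])
    moreover have "conn G g (D - n1) v" unfolding D_def by (rule 3(6))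
    moreover have "\<eta> * n1 \<le> \<eta> * D" using 3(2) \<eta>(1) unfolding D_def by (rule mult_left_mono)
    then have "(1 + \<eta>) * n1 + N + (D - n1) \<le> (1 + \<eta>) * D + N" by (simp add: distrib_right)
    ultimately have "conn G u ((1 + \<eta>) * D + N) v" by (rule conn_trans)
    then show ?thesis by (simp only: N_def D_def)
  qed
qed

lemma conn_lift:
  assumes "conn G u r v" and t: "0 \<le> t"
    and st: "\<And>g. g \<in> G \<Longrightarrow> st g \<in> S"
    and step: "\<And>g h. g \<in> G \<Longrightarrow> h \<in> G \<Longrightarrow> lattice_adj g h \<Longrightarrow> conn S (st g) t (st h)"
  shows "conn S (st u) (t * r) (st v)"
  using assms(1)
proof (induction rule: conn.induct)
  case conn_refl
  then show ?case by (auto intro: conn.conn_refl st)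
next
  case (conn_step r y z)
  show ?case
    by (rule conn_trans[OF conn_step.IH step[OF conn_end[OF conn_step.hyps(1)] conn_step.hyps(3,2)]])
      (simp add: algebra_simps)
next
  case (conn_weaken r y r')
  have "t * r \<le> t * r'" using t conn_weaken.hyps(2) by (simp add: mult_left_mono)
  with conn_weaken.IH show ?case by (rule conn.conn_weaken)
qed

section \<open>Distances with free steps\<close>

text \<open>Whether a step is free depends on the site it leaves, because the spreading clocks
  belong to the site that they start from. Paying is always allowed, so \<open>n\<close> is an upper
  bound for the number of steps that must be paid.\<close>

inductive reach :: "(int ^ 'd::finite) set \<Rightarrow> int ^ 'd \<Rightarrow> nat \<Rightarrow> int ^ 'd \<Rightarrow> bool"
  for U x where
  reach_refl: "reach U x 0 x"
| reach_free: "reach U x n y \<Longrightarrow> lattice_adj y z \<Longrightarrow> y \<in> U \<Longrightarrow> reach U x n z"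
| reach_paid: "reach U x n y \<Longrightarrow> lattice_adj y z \<Longrightarrow> reach U x (Suc n) z"



lemma reach_d1: "\<exists>n. reach U x n y \<and> int n \<le> d1 x y"
proof -
  have "\<exists>n. reach U x n y \<and> n \<le> r" if "conn UNIV x r y" for r
    using that
  proof (induction rule: conn.induct)
    case conn_refl
    show ?case by (auto intro!: exI[of _ 0] reach_refl)
  next
    case (conn_step r y z)
    then obtain n where n: "reach U x n y" "n \<le> r" by blast
    then have "reach U x (Suc n) z" using conn_step.hyps(2) by (intro reach_paid)
    then show ?case using n(2) by (intro exI[of _ "Suc n"]) auto
  next
    case (conn_weaken r y r')
    then show ?case by (meson order_trans)
  qed
  from this[OF conn_hull[of x y UNIV]] show ?thesis by auto
qed

text \<open>Inside the ball every step is free, and the box spanned by \<open>y\<close> and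
  \<open>z\<close> does not leave the ball.\<close>

lemma reach_in_ball:
  assumes "dinf p y \<le> r" "dinf p z \<le> r" "{v. dinf p v \<le> r} \<subseteq> U" "reach U x n y"
  shows "reach U x n z"
proof -
  let ?B = "{v. dinf p v \<le> r}"
  have "chull y z \<subseteq> ?B"
  proof
    fix v assume v: "v \<in> chull y z"
    have "\<bar>p $ i - v $ i\<bar> \<le> r" for i
    proof -
      have "min (y $ i) (z $ i) \<le> v $ i" "v $ i \<le> max (y $ i) (z $ i)"
        using v by (auto simp: chull_def)
      moreover have "\<bar>p $ i - y $ i\<bar> \<le> r" "\<bar>p $ i - z $ i\<bar> \<le> r"
        using assms(1,2) by (auto simp: dinf_le_iff)
      ultimately show ?thesis by linarith
    qed
    then show "v \<in> ?B" by (simp add: dinf_le_iff)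
  qed
  then have "conn ?B y (d1 y z) z" by (rule conn_hull)
  moreover have "reach U x n z" if "conn ?B y r z" for r z
    using that
  proof (induction rule: conn.induct)
    case (conn_step r y' z)
    then show ?case using conn_end[OF conn_step.hyps(1)] assms(3)
      by (intro reach_free[of U x n y' z]) auto
  qed (use assms(4) in auto)
  ultimately show ?thesis by blast
qed

lemma reach_dinf: "reach {} x n y \<Longrightarrow> dinf x y \<le> int n"
proof (induction rule: reach.induct)
  case (reach_paid n y z)
  then show ?case using dinf_triangle[of x z y] lattice_adj_dinf[of y z] by linarith
qed auto

section \<open>Multiscale geometry of separated islands\<close>

text \<open>\<open>Q\<close> dominates the constants below, which are at most quadratic in the
  dimension. The factors \<open>2 ^ k\<close> make the relative losses at successive ranks summable.
  Only centres of equal rank are kept apart; smaller islands may lie anywhere near larger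
  ones.\<close>

locale sparse =
  fixes al be :: "nat \<Rightarrow> int" and Q :: int and P :: "nat \<Rightarrow> (int ^ 'd::finite) set"
  assumes card_d: "CARD('d) \<ge> 2"
    and Q: "Q \<ge> 20000 * (int CARD('d) * int CARD('d))"
    and al_0: "al 0 \<ge> Q"
    and be_al: "be k \<ge> Q * 2 ^ k * al k"
    and al_Suc: "al (Suc k) \<ge> Q * 2 ^ k * be k"
    and sep: "p \<in> P k \<Longrightarrow> q \<in> P k \<Longrightarrow> p \<noteq> q \<Longrightarrow> be k < dinf p q"
begin

text \<open>Territories of rank \<open>k\<close> have radius at most \<open>r2 * al k\<close> and are contained in balls of radius
  \<open>rf * al k\<close>, which are contracted when distances are measured. The constants \<open>ke\<close> and \<open>kc\<close> bound the
  displacement of a grid point to a site clear of these balls and the additive cost of a path,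
  in terms of the next smaller scale.\<close>

definition nd :: int where "nd = int CARD('d)"
definition r2 :: int where "r2 = 20 * nd + 4"
definition rf :: int where "rf = 20 * nd + 14"
definition ke :: int where "ke = 2 * rf + 1"
definition kc :: int where "kc = 27 * nd * (r2 + 2) + 1"
text \<open>Mesh of the coarse lattice on which rank \<open>k\<close> is treated: far above the size
  \<open>prev k\<close> of the smaller islands, far below \<open>al k\<close>. At rank 0 there are
  no smaller islands and the lattice itself serves.\<close>

definition sc :: "nat \<Rightarrow> int" where "sc k = (case k of 0 \<Rightarrow> 1 | Suc j \<Rightarrow> be j)"
definition prev :: "nat \<Rightarrow> int" where "prev k = (case k of 0 \<Rightarrow> 0 | Suc j \<Rightarrow> al j)"
definition fat :: "nat \<Rightarrow> int" where "fat k = rf * al k"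

text \<open>\<open>U k\<close> is the part of space near the islands of rank below \<open>k\<close> that counts for nothing when
  distances are measured, and \<open>V k\<close> is the smaller part that paths have to avoid.\<close>

definition U :: "nat \<Rightarrow> (int ^ 'd) set" where
  "U k = (\<Union>j<k. \<Union>p\<in>P j. {x. dinf p x \<le> fat j})"
definition V :: "nat \<Rightarrow> (int ^ 'd) set" where
  "V k = (\<Union>j<k. \<Union>p\<in>P j. {x. dinf p x \<le> r2 * al j})"
definition clear :: "nat \<Rightarrow> int ^ 'd \<Rightarrow> bool" where
  "clear k x \<longleftrightarrow> (\<forall>j<k. \<forall>p\<in>P j. fat j \<le> dinf p x)"

lemma nd: "nd \<ge> 2" "nd \<le> nd * nd" "2 * nd \<le> nd * nd" "1 \<le> nd * nd" "4 \<le> nd * nd"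
proof -
  show *: "nd \<ge> 2" using card_d by (simp add: nd_def)
  then show "2 * nd \<le> nd * nd" by (intro mult_right_mono) auto
  with * show "nd \<le> nd * nd" "1 \<le> nd * nd" "4 \<le> nd * nd" by linarith+
qed

lemma Q': "10000 * (nd * nd) + 4000 * nd + 1000 \<le> Q"
  using Q nd by (simp only: nd_def[symmetric])

lemma d1_le: "d1 x y \<le> nd * dinf x y" for x y :: "int ^ 'd"
  unfolding nd_def by (rule d1_le_dinf)

lemma Q_pos: "Q > 0" using Q' nd by linarith

lemma pow_ge: "x \<le> x * 2 ^ k" if "0 \<le> x" for x :: int
  using mult_left_mono[OF one_le_power[of 2 k] that] by simp

lemma scales_pos: "0 < al k" "0 < be k"
proof -
  have "0 < al k \<and> 0 < be k"
  proof (induction k)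
    case 0
    have "0 < al 0" using al_0 Q_pos by linarith
    then show ?case using be_al[of 0] Q_pos by (auto intro: less_le_trans[rotated])
  next
    case (Suc k)
    then have "0 < Q * 2 ^ k * be k" using Q_pos by simp
    then have *: "0 < al (Suc k)" using al_Suc[of k] by linarith
    then have "0 < Q * 2 ^ Suc k * al (Suc k)" using Q_pos by simp
    then show ?case using * be_al[of "Suc k"] by linarith
  qed
  then show "0 < al k" "0 < be k" by auto
qed

lemma sc_pos: "0 < sc k" by (cases k) (auto simp: sc_def scales_pos)

lemma prev_nonneg: "0 \<le> prev k" by (cases k) (auto simp: prev_def scales_pos less_imp_le)

text \<open>A factor 2 is lost because \<open>be_al\<close> at the previous rank \<open>j\<close>
  offers only \<open>2 ^ j\<close>.\<close>

lemma sc_prev: "Q * 2 ^ k * prev k \<le> 2 * sc k"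
proof (cases k)
  case (Suc j)
  then show ?thesis using be_al[of j] by (simp add: sc_def prev_def mult_ac)
qed (simp add: sc_def prev_def)

lemma Q_sc_le: "Q * sc k \<le> al k"
proof (cases k)
  case 0
  then show ?thesis using al_0 by (simp add: sc_def)
next
  case (Suc j)
  have "Q * be j \<le> Q * be j * 2 ^ j" using Q_pos scales_pos(2)[of j] by (intro pow_ge) auto
  then show ?thesis using Suc al_Suc[of j] by (simp add: sc_def mult_ac)
qed

lemma le_al: "c * sc k \<le> al k" if "c \<le> Q"
  using mult_right_mono[OF that, of "sc k"] Q_sc_le[of k] sc_pos[of k] by linarith

lemma le_be: "c * al k \<le> be k" if "c \<le> Q"
proof -
  have "c * al k \<le> Q * al k" using that scales_pos(1)[of k] by (intro mult_right_mono) auto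
  also have "\<dots> \<le> Q * al k * 2 ^ k" using Q_pos scales_pos(1)[of k] by (intro pow_ge) auto
  finally show ?thesis using be_al[of k] by (simp add: mult_ac)
qed

lemma le_sc: "c * prev k \<le> 2 * sc k" if "c \<le> Q"
proof -
  have "c * prev k \<le> Q * prev k" using that prev_nonneg[of k] by (intro mult_right_mono) auto
  also have "\<dots> \<le> Q * prev k * 2 ^ k" using Q_pos prev_nonneg[of k] by (intro pow_ge) auto
  finally show ?thesis using sc_prev[of k] by (simp add: mult_ac)
qed

lemma prev_le_al: "c * prev k \<le> al k" if "c \<le> Q"
  using le_sc[OF that, of k] le_al[of 2 k] Q' nd by linarith

lemma al_mono: "j \<le> k \<Longrightarrow> al j \<le> al k"
proof (induction rule: dec_induct)
  case (step k)
  have "al k \<le> al (Suc k)"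
    using prev_le_al[of 1 "Suc k"] Q' nd by (simp add: prev_def)
  then show ?case using step by linarith
qed simp

lemma ge_Suc_al: "al k \<ge> int k + 1"
proof (induction k)
  case 0
  show ?case using scales_pos(1)[of 0] by simp
next
  case (Suc k)
  have "2 * al k \<le> al (Suc k)" using prev_le_al[of 2 "Suc k"] Q' nd by (simp add: prev_def)
  then show ?case using Suc by simp
qed

lemma U_Suc: "U (Suc k) = U k \<union> (\<Union>p\<in>P k. {x. dinf p x \<le> fat k})"
  by (simp add: U_def lessThan_Suc Un_commute)



lemma ball_subset_U: "p \<in> P j \<Longrightarrow> j < k \<Longrightarrow> {x. dinf p x \<le> fat j} \<subseteq> U k"
  by (auto simp: U_def)

lemma clear_if_notin_U: "x \<notin> U k \<Longrightarrow> clear k x"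
  by (force simp: U_def clear_def not_le)

subsection \<open>Distances modulo the islands\<close>

text \<open>Contracting the balls of rank \<open>k\<close> saves about one diameter per ball
  visited, but consecutive balls are about \<open>be k\<close> apart. Lowering the slope to its next
  value releases about \<open>be k / 2 ^ (k + 2)\<close> between two balls, which exceeds the
  diameter; the saving at one ball remains as additive constant.\<close>

lemma reach_dist:
  assumes "reach (U k) x n y"
  shows "(1/2 + 1 / 2 ^ (k + 1)) * dinf x y \<le> real n + (2 * rf + 3) * prev k"
  using assms
proof (induction k arbitrary: n x y)
  case 0
  then have "dinf x y \<le> int n" using reach_dinf by (simp add: U_def)
  then have "real_of_int (dinf x y) \<le> real n" by linarith
  then show ?case by (simp add: prev_def)
next
  case (Suc k)
  define th where "th j = 1/2 + (1 :: real) / 2 ^ (j + 1)" for j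
  define C where "C = (2 * rf + 3) * prev k"
  define C' where "C' = C + 2 * fat k + 2"
  \<comment> \<open>One more than the radius, since a free step may end just outside the
    ball.\<close>
  define A where "A = fat k + 1"
  have th: "0 < th k" "th (Suc k) \<le> 1" "0 < th (Suc k)" "th (Suc k) \<le> th k"
    using one_le_power[of "2 :: real" "Suc k"] by (auto simp: th_def divide_simps add_pos_pos)
  have fat: "0 \<le> fat k" using scales_pos(1)[of k] nd by (simp add: fat_def rf_def)
  have C0: "0 \<le> C" using prev_nonneg[of k] nd by (simp add: C_def rf_def)
  have IH: "th k * dinf x y \<le> real n + C" if "reach (U k) x n y" for n x y
    using Suc.IH[OF that] by (simp add: th_def C_def)
  have gap: "real_of_int C' \<le> (th k - th (Suc k)) * (be k - 2 * A)"
  proof -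
    have C: "C \<le> al k" unfolding C_def
      by (rule prev_le_al) (use Q' nd in \<open>simp add: rf_def\<close>)
    have "4 * C' + 2 * A \<le> (10 * rf + 14) * al k"
      using C scales_pos(1)[of k] by (simp add: C'_def A_def fat_def algebra_simps)
    also have "\<dots> \<le> Q * al k" using scales_pos(1)[of k] Q' nd
      by (intro mult_right_mono) (auto simp: rf_def)
    finally have 1: "4 * C' + 2 * A \<le> Q * al k" .
    have "(4 * C' + 2 * A) * 2 ^ k \<le> Q * al k * 2 ^ k"
      by (rule mult_right_mono[OF 1]) simp
    also have "\<dots> \<le> be k" using be_al[of k] by (simp add: mult_ac)
    finally have 2: "4 * C' * 2 ^ k + 2 * A * 2 ^ k \<le> be k" by (simp add: algebra_simps)
    have "2 * A \<le> 2 * A * 2 ^ k" using fat by (intro pow_ge) (simp add: A_def)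
    then have "4 * C' * 2 ^ k \<le> be k - 2 * A" using 2 by linarith
    then have "real_of_int (4 * C' * 2 ^ k) \<le> real_of_int (be k - 2 * A)"
      by (simp only: of_int_le_iff)
    then show ?thesis by (simp add: th_def field_simps)
  qed
  \<comment> \<open>The last ball of rank \<open>k\<close> used has centre \<open>p\<close>. At cost
    \<open>n1\<close> the distance bound holds on its whole \<open>A\<close>-neighbourhood; since
    then, from some \<open>w\<close> in it, \<open>n2\<close> has been paid with only the smaller
    balls free.\<close>
  define Inv where "Inv n y \<longleftrightarrow> reach (U k) x n y \<or>
     (\<exists>p\<in>P k. \<exists>n1 n2 w. n1 + n2 \<le> n \<and> dinf p w \<le> A \<and> reach (U k) w n2 y \<and>
       (\<forall>w'. dinf p w' \<le> A \<longrightarrow> th (Suc k) * dinf x w' \<le> real n1 + C'))" for n y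
  have InvI: "Inv n y" if "p \<in> P k" "n1 + n2 \<le> n" "dinf p w \<le> A" "reach (U k) w n2 y"
      "\<forall>w'. dinf p w' \<le> A \<longrightarrow> th (Suc k) * dinf x w' \<le> real n1 + C'" for p n1 n2 w n y
    unfolding Inv_def using that by metis
  have "Inv n y"
    using Suc.prems
  proof (induction rule: reach.induct)
    case reach_refl
    then show ?case by (simp add: Inv_def reach.reach_refl)
  next
    case (reach_paid n y z)
    from reach_paid.IH consider "reach (U k) x n y"
      | p n1 n2 w where "p \<in> P k" "n1 + n2 \<le> n" "dinf p w \<le> A" "reach (U k) w n2 y"
          "\<forall>w'. dinf p w' \<le> A \<longrightarrow> th (Suc k) * dinf x w' \<le> real n1 + C'"
      unfolding Inv_def by blast
    then show ?case
    proof cases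
      case 1
      then have "reach (U k) x (Suc n) z" using reach_paid.hyps(2) by (rule reach.reach_paid)
      then show ?thesis by (simp add: Inv_def)
    next
      case 2
      have "reach (U k) w (Suc n2) z" using 2(4) reach_paid.hyps(2) by (rule reach.reach_paid)
      then show ?thesis using 2(2) by (intro InvI[OF 2(1) _ 2(3) _ 2(5)]) auto
    qed
  next
    case (reach_free n y z)
    have adj: "dinf y z \<le> 1" using reach_free.hyps(2) by (rule lattice_adj_dinf)
    from reach_free.IH consider (a) "reach (U k) x n y"
      | (b) p n1 n2 w where "p \<in> P k" "n1 + n2 \<le> n" "dinf p w \<le> A" "reach (U k) w n2 y"
          "\<forall>w'. dinf p w' \<le> A \<longrightarrow> th (Suc k) * dinf x w' \<le> real n1 + C'"
      unfolding Inv_def by blast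
    then show ?case
    proof cases
      case a
      show ?thesis
      proof (cases "y \<in> U k")
        case True
        then have "reach (U k) x n z" by (rule reach.reach_free[OF a reach_free.hyps(2)])
        then show ?thesis by (simp add: Inv_def)
      next
        case False
        then obtain q where q: "q \<in> P k" "dinf q y \<le> fat k"
          using reach_free.hyps(3) by (auto simp: U_Suc)
        have "th (Suc k) * dinf x w' \<le> real n + C'" if "dinf q w' \<le> A" for w'
        proof -
          have "dinf x w' \<le> dinf x y + (2 * fat k + 1)"
            using dinf_triangle[of x w' y] dinf_triangle[of y w' q] q that
            by (simp add: dinf_commute A_def)
          then have "th (Suc k) * dinf x w' \<le> th (Suc k) * real_of_int (dinf x y + (2 * fat k + 1))"
            using th(3) by (intro mult_left_mono) (linarith, simp)
          also have "\<dots> = th (Suc k) * dinf x y + th (Suc k) * real_of_int (2 * fat k + 1)"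
            by (simp only: of_int_add distrib_left)
          also have "th (Suc k) * dinf x y \<le> th k * dinf x y"
            using th(4) by (intro mult_right_mono) auto
          also have "th (Suc k) * real_of_int (2 * fat k + 1) \<le> 1 * real_of_int (2 * fat k + 1)"
            using th(2) fat by (intro mult_right_mono) auto
          finally show ?thesis using IH[OF a] by (simp add: C'_def)
        qed
        moreover have "dinf q z \<le> A" using q(2) adj dinf_triangle[of q z y] by (simp add: A_def)
        ultimately show ?thesis by (intro InvI[OF q(1), of n 0 n z z]) (auto intro: reach.reach_refl)
      qed
    next
      case b
      show ?thesis
      proof (cases "y \<in> U k")
        case True
        have "reach (U k) w n2 z" by (rule reach.reach_free[OF b(4) reach_free.hyps(2) True])
        then show ?thesis by (rule InvI[OF b(1-3) _ b(5)])
      next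
        case False
        then obtain q where q: "q \<in> P k" "dinf q y \<le> fat k"
          using reach_free.hyps(3) by (auto simp: U_Suc)
        have qz: "dinf q z \<le> A" using q(2) adj dinf_triangle[of q z y] by (simp add: A_def)
        show ?thesis
        proof (cases "q = p")
          case True
          then show ?thesis using b(2) qz
            by (intro InvI[OF b(1) _ _ reach.reach_refl b(5)]) auto
        next
          case False
          have "be k < dinf p q" using sep b(1) q(1) False by auto
          then have d: "be k - 2 * A \<le> dinf w y"
            using dinf_triangle[of p q w] dinf_triangle[of w q y] b(3) q(2)
            by (simp add: A_def dinf_commute)
          have "th (Suc k) * dinf x w' \<le> real (n1 + n2) + C'" if "dinf q w' \<le> A" for w'
          proof -
            have "dinf x w' \<le> dinf x w + (dinf w y + (2 * fat k + 1))"
              using dinf_triangle[of x w' w] dinf_triangle[of w w' y] dinf_triangle[of y w' q] q that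
              by (simp add: dinf_commute A_def)
            then have "th (Suc k) * dinf x w' \<le>
              th (Suc k) * real_of_int (dinf x w + (dinf w y + (2 * fat k + 1)))"
              using th(3) by (intro mult_left_mono) (linarith, simp)
            also have "\<dots> = th (Suc k) * dinf x w + th (Suc k) * dinf w y +
               th (Suc k) * real_of_int (2 * fat k + 1)"
              by (simp only: of_int_add distrib_left add.assoc)
            finally have 1: "th (Suc k) * dinf x w' \<le> th (Suc k) * dinf x w +
               th (Suc k) * dinf w y + th (Suc k) * real_of_int (2 * fat k + 1)" .
            have 2: "th (Suc k) * dinf x w \<le> real n1 + real_of_int C'"
              by (rule b(5)[rule_format, OF b(3)])
            have 3: "th (Suc k) * dinf w y = th k * dinf w y - (th k - th (Suc k)) * dinf w y"
              by (simp add: algebra_simps)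
            have 4: "th k * dinf w y \<le> real n2 + real_of_int C" by (rule IH[OF b(4)])
            have 5: "(th k - th (Suc k)) * (be k - 2 * A) \<le> (th k - th (Suc k)) * dinf w y"
              using d th(4) by (intro mult_left_mono) auto
            have 6: "th (Suc k) * real_of_int (2 * fat k + 1) \<le> 1 * real_of_int (2 * fat k + 1)"
              using th(2) fat by (intro mult_right_mono) auto
            have 7: "real_of_int C' = real_of_int C + real_of_int (2 * fat k + 1) + 1"
              by (simp add: C'_def)
            have 8: "th (Suc k) * dinf w y \<le> real n2 + real_of_int C - real_of_int C'"
              unfolding 3 using 4 order_trans[OF gap 5] by (rule diff_mono)
            have 9: "th (Suc k) * real_of_int (2 * fat k + 1) \<le> real_of_int (2 * fat k + 1)"
              using 6 by (simp only: mult_1)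
            have "th (Suc k) * dinf x w' \<le> (real n1 + real_of_int C') +
               (real n2 + real_of_int C - real_of_int C') + real_of_int (2 * fat k + 1)"
              by (rule order_trans[OF 1 add_mono[OF add_mono[OF 2 8] 9]])
            then show ?thesis using 7 by simp
          qed
          then show ?thesis using b(2)
            by (intro InvI[OF q(1) _ qz reach.reach_refl, of "n1 + n2"]) auto
        qed
      qed
    qed
  qed
  moreover have "C' + C \<le> (2 * rf + 3) * al k"
  proof -
    have "(2 * (2 * rf + 3)) * prev k \<le> al k" by (rule prev_le_al) (use Q' nd in \<open>simp add: rf_def\<close>)
    moreover have "2 \<le> al k" using le_al[of 2 k] Q' nd sc_pos[of k] by simp
    ultimately show ?thesis by (simp add: C'_def C_def fat_def algebra_simps)
  qed
  ultimately have "th (Suc k) * dinf x y \<le> real n + (2 * rf + 3) * al k"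
  proof -
    assume C: "C' + C \<le> (2 * rf + 3) * al k"
    assume "Inv n y"
    then consider (a) "reach (U k) x n y"
      | (b) p n1 n2 w where "p \<in> P k" "n1 + n2 \<le> n" "dinf p w \<le> A" "reach (U k) w n2 y"
          "\<forall>w'. dinf p w' \<le> A \<longrightarrow> th (Suc k) * dinf x w' \<le> real n1 + C'"
      unfolding Inv_def by blast
    then have "th (Suc k) * dinf x y \<le> real n + real_of_int (C' + C)"
    proof cases
      case a
      have "th (Suc k) * dinf x y \<le> th k * dinf x y" using th(4) by (intro mult_right_mono) auto
      moreover have "real_of_int C \<le> real_of_int (C' + C)"
        using C0 fat by (simp only: of_int_le_iff C'_def)
      ultimately show ?thesis using IH[OF a] by linarith
    next
      case b
      have "th (Suc k) * dinf x y \<le> th (Suc k) * real_of_int (dinf x w + dinf w y)"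
        using dinf_triangle[of x y w] th(3) by (intro mult_left_mono) (linarith, simp)
      also have "\<dots> = th (Suc k) * dinf x w + th (Suc k) * dinf w y"
        by (simp only: of_int_add distrib_left)
      also have "th (Suc k) * dinf x w \<le> real n1 + real_of_int C'" by (rule b(5)[rule_format, OF b(3)])
      also have "th (Suc k) * dinf w y \<le> th k * dinf w y" using th(4) by (intro mult_right_mono) auto
      also have "\<dots> \<le> real n2 + real_of_int C" by (rule IH[OF b(4)])
      finally show ?thesis using b(2) by simp
    qed
    moreover have "real_of_int (C' + C) \<le> real_of_int ((2 * rf + 3) * al k)"
      using C by (simp only: of_int_le_iff)
    ultimately show ?thesis by linarith
  qed
  then show ?case by (simp add: th_def prev_def)
qed

lemma reach_dist_half:
  assumes "reach (U k) x n y"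
  shows "dinf x y \<le> 2 * int n + al k"
proof -
  have "1/2 * real_of_int (dinf x y) \<le> (1/2 + 1 / 2 ^ (k + 1)) * dinf x y"
    by (intro mult_right_mono) auto
  also have "\<dots> \<le> real n + (2 * rf + 3) * prev k" by (rule reach_dist[OF assms])
  finally have "real_of_int (dinf x y) \<le> real_of_int (2 * int n + 2 * ((2 * rf + 3) * prev k))"
    by simp
  then have "dinf x y \<le> 2 * int n + (2 * (2 * rf + 3)) * prev k" by (simp only: of_int_le_iff mult.assoc)
  moreover have "(2 * (2 * rf + 3)) * prev k \<le> al k"
    by (rule prev_le_al) (use Q' nd in \<open>simp add: rf_def\<close>)
  ultimately show ?thesis by linarith
qed

subsection \<open>Paths around the islands\<close>

text \<open>If a ball of rank \<open>k\<close> is too close, shifting all coordinates by the same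
  amount escapes from it, and separation keeps the others of rank \<open>k\<close> away. The margin
  \<open>ke * prev k\<close> is reserved for the displacement at smaller ranks.\<close>

lemma clear_near: "\<exists>x. dinf c x \<le> ke * prev k \<and> clear k x"
proof (induction k arbitrary: c)
  case 0
  then show ?case by (auto simp: clear_def prev_def intro!: exI[of _ c])
next
  case (Suc k)
  let ?e = "ke * prev k" and ?f = "fat k"
  have e0: "0 \<le> ?e" using prev_nonneg[of k] nd by (simp add: ke_def rf_def)
  have f0: "0 \<le> ?f" using scales_pos(1)[of k] nd by (simp add: fat_def rf_def)
  have 3: "3 * ?e \<le> al k"
  proof -
    have "3 * ke \<le> Q" using Q' nd by (simp add: ke_def rf_def)
    from prev_le_al[OF this, of k] show ?thesis by simp
  qed
  have "(4 * rf + 2) * al k \<le> be k" by (rule le_be) (use Q' nd in \<open>simp add: rf_def\<close>)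
  then have be: "4 * ?f + 4 * ?e < be k" using 3 scales_pos(1)[of k] by (simp add: fat_def algebra_simps)
  have "\<exists>c'. dinf c c' \<le> 2 * ?f + 2 * ?e \<and> (\<forall>p\<in>P k. ?f + ?e \<le> dinf p c')"
  proof (cases "\<forall>p\<in>P k. ?f + ?e \<le> dinf p c")
    case True
    then show ?thesis using e0 f0 by (intro exI[of _ c]) auto
  next
    case False
    then obtain p where p: "p \<in> P k" "dinf p c < ?f + ?e" by force
    let ?D = "2 * ?f + 2 * ?e"
    define c' where "c' = (\<chi> i. c $ i + ?D)"
    have c': "dinf c c' = ?D"
      using e0 f0 by (intro antisym) (auto simp: dinf_le_iff dinf_ge_iff c'_def)
    have "?f + ?e \<le> dinf q c'" if "q \<in> P k" for q
    proof (cases "q = p")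
      case True
      then show ?thesis using dinf_triangle[of c c' p] p c' by (simp add: dinf_commute)
    next
      case False
      then have "be k < dinf p q" using sep p(1) that by auto
      then show ?thesis using dinf_triangle[of p q c] dinf_triangle[of c q c'] p(2) c' be
        by (simp add: dinf_commute)
    qed
    then show ?thesis using c' by (intro exI[of _ c']) auto
  qed
  then obtain c' where c': "dinf c c' \<le> 2 * ?f + 2 * ?e" "\<And>p. p \<in> P k \<Longrightarrow> ?f + ?e \<le> dinf p c'"
    by blast
  obtain x where x: "dinf c' x \<le> ?e" "clear k x" using Suc.IH by blast
  have "fat j \<le> dinf p x" if "j < Suc k" "p \<in> P j" for j p
  proof (cases "j = k")
    case True
    then show ?thesis using c'(2)[of p] that(2) dinf_triangle[of p c' x] x(1)
      by (simp add: dinf_commute)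
  next
    case False
    then show ?thesis using x(2) that by (auto simp: clear_def)
  qed
  moreover have "dinf c x \<le> ke * prev (Suc k)"
    using dinf_triangle[of c x c'] c'(1) x(1) 3 by (simp add: prev_def fat_def ke_def algebra_simps)
  ultimately show ?case by (auto simp: clear_def)
qed

definition station :: "nat \<Rightarrow> int ^ 'd \<Rightarrow> int ^ 'd" where
  "station k g = (SOME x. dinf (scale (sc k) g) x \<le> ke * prev k \<and> clear k x)"

lemma station: "dinf (scale (sc k) g) (station k g) \<le> ke * prev k" "clear k (station k g)"
  using someI_ex[OF clear_near, of "scale (sc k) g" k] by (auto simp: station_def)

lemma ke_prev_le: "ke * prev k \<le> sc k"
proof -
  have "2 * ke \<le> Q" using Q' nd by (simp add: ke_def rf_def)
  from le_sc[OF this, of k] show ?thesis by simp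
qed

lemma kc_prev_le: "kc * prev k \<le> sc k"
proof -
  have "2 * kc \<le> Q" using Q' nd by (simp add: kc_def r2_def algebra_simps)
  from le_sc[OF this, of k] show ?thesis by simp
qed

lemma clear_notin_V: "clear k x \<Longrightarrow> x \<notin> V k"
proof
  assume "clear k x" "x \<in> V k"
  then obtain j p where j: "j < k" "p \<in> P j" "dinf p x \<le> r2 * al j" "fat j \<le> dinf p x"
    by (force simp: V_def clear_def)
  then have "rf * al j \<le> r2 * al j" by (simp add: fat_def)
  then show False using scales_pos(1)[of j] by (simp add: rf_def r2_def)
qed

lemma pow_bounds: "(0::real) \<le> 2 - 1 / 2 ^ k" "2 - 1 / 2 ^ k \<le> (2::real)"
proof -
  have "1 / 2 ^ k \<le> (1::real)" by (simp add: one_le_power)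
  then show "(0::real) \<le> 2 - 1 / 2 ^ k" by linarith
qed simp

text \<open>The stretch factor rises with \<open>k\<close> but stays below 2; the increment
  \<open>1 / 2 ^ (k + 1)\<close> is what rank \<open>k\<close> may spend.\<close>

definition paths :: "nat \<Rightarrow> bool" where
  "paths k \<longleftrightarrow> (\<forall>x y. clear k x \<longrightarrow> clear k y \<longrightarrow>
     conn (- V k) x ((2 - 1 / 2 ^ k) * d1 x y + kc * prev k) y)"

text \<open>Length bound between the stations of adjacent grid points, which are \<open>sc k\<close>
  apart before each station is displaced by at most \<open>nd * (ke * prev k)\<close> in
  \<open>d1\<close>.\<close>

definition hop :: "nat \<Rightarrow> real" where
  "hop k = (2 - 1 / 2 ^ k) * (sc k + 2 * (nd * (ke * prev k))) + kc * prev k"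

lemma hop_le: "hop k \<le> 3 * sc k" "0 \<le> hop k"
proof -
  have *: "(0::real) \<le> 2 - 1 / 2 ^ k" "2 - 1 / 2 ^ k \<le> (2::real)"
    using pow_bounds[of k] by linarith+
  have e: "0 \<le> sc k + 2 * (nd * (ke * prev k))" "0 \<le> kc * prev k"
    using sc_pos[of k] prev_nonneg[of k] nd by (auto simp: ke_def rf_def kc_def r2_def)
  have e': "(0 :: real) \<le> real_of_int (sc k + 2 * (nd * (ke * prev k)))" "(0::real) \<le> real_of_int (kc * prev k)"
    using e by (simp_all only: of_int_0_le_iff)
  have "hop k \<le> 2 * real_of_int (sc k + 2 * (nd * (ke * prev k))) + kc * prev k"
    unfolding hop_def using * e'(1) by (intro add_right_mono mult_right_mono)
  also have "\<dots> = real_of_int (2 * sc k + (4 * (nd * ke) + kc) * prev k)"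
    by (simp add: algebra_simps)
  also have "(4 * (nd * ke) + kc) * prev k \<le> sc k"
  proof -
    have "2 * (4 * (nd * ke) + kc) \<le> Q" using Q' nd
      by (simp add: kc_def r2_def ke_def rf_def algebra_simps)
    from le_sc[OF this, of k] have "2 * ((4 * (nd * ke) + kc) * prev k) \<le> 2 * sc k"
      by (simp only: mult.assoc)
    then show ?thesis by linarith
  qed
  then have "real_of_int (2 * sc k + (4 * (nd * ke) + kc) * prev k) \<le> real_of_int (3 * sc k)"
    by (simp only: of_int_le_iff)
  finally show "hop k \<le> 3 * sc k" by simp
  show "0 \<le> hop k" unfolding hop_def using *(1) e'
    by (intro add_nonneg_nonneg mult_nonneg_nonneg)
qed

lemma conn_station:
  assumes "paths k" "lattice_adj g h"
  shows "conn (- V k) (station k g) (hop k) (station k h)"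
proof -
  let ?e = "ke * prev k"
  have "conn (- V k) (station k g)
     ((2 - 1 / 2 ^ k) * d1 (station k g) (station k h) + kc * prev k) (station k h)"
    using assms(1) station(2) by (auto simp: paths_def)
  moreover have "d1 (station k g) (station k h) \<le> sc k + 2 * (nd * ?e)"
  proof -
    have "d1 (station k g) (station k h) \<le> d1 (scale (sc k) g) (station k g) +
      (d1 (scale (sc k) g) (scale (sc k) h) + d1 (scale (sc k) h) (station k h))"
      using d1_triangle[of "station k g" "station k h" "scale (sc k) g"]
        d1_triangle[of "scale (sc k) g" "station k h" "scale (sc k) h"] by (simp add: d1_commute)
    moreover have "d1 (scale (sc k) g) (scale (sc k) h) = sc k"
      using assms(2) sc_pos[of k] by (simp add: d1_scale lattice_adj_d1)
    moreover have "d1 (scale (sc k) g) (station k g) \<le> nd * ?e" for g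
    proof -
      have "nd * dinf (scale (sc k) g) (station k g) \<le> nd * ?e"
        using station(1) nd by (intro mult_left_mono) auto
      then show ?thesis using d1_le[of "scale (sc k) g" "station k g"] by linarith
    qed
    from this[of g] this[of h] show ?thesis using calculation by linarith
  qed
  then have "(2 - 1 / 2 ^ k) * real_of_int (d1 (station k g) (station k h)) \<le>
     (2 - 1 / 2 ^ k) * real_of_int (sc k + 2 * (nd * ?e))"
    using pow_bounds[of k] by (intro mult_left_mono) linarith+
  ultimately show ?thesis
    unfolding hop_def by (elim conn_weaken) simp
qed

text \<open>Distance at most \<open>nd * (2 * sc k)\<close>, stretch at most 2, and
  \<open>kc * prev k \<le> sc k\<close>. The total is at most \<open>al k\<close>, so the path
  cannot stray further than that from \<open>x\<close>.\<close>

lemma conn_to_station: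
  assumes "paths k" "clear k x" "dinf (scale (sc k) u) x \<le> sc k"
  shows "conn (- V k \<inter> {v. dinf x v \<le> al k}) x ((4 * nd + 1) * sc k) (station k u)"
proof (rule conn_localised)
  have "dinf x (station k u) \<le> 2 * sc k"
    using dinf_triangle[of x "station k u" "scale (sc k) u"] assms(3) station(1)[of k u]
      ke_prev_le[of k] by (simp add: dinf_commute)
  then have "nd * dinf x (station k u) \<le> nd * (2 * sc k)" using nd by (intro mult_left_mono) auto
  then have "d1 x (station k u) \<le> nd * (2 * sc k)"
    using d1_le[of x "station k u"] by linarith
  then have d: "real_of_int (d1 x (station k u)) \<le> real_of_int (nd * (2 * sc k))" by (simp only: of_int_le_iff)
  have "(2 - 1 / 2 ^ k) * real_of_int (d1 x (station k u)) \<le> 2 * real_of_int (d1 x (station k u))"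
    by (intro mult_right_mono) auto
  also have "\<dots> \<le> real_of_int (4 * nd * sc k)" using d by simp
  finally have "(2 - 1 / 2 ^ k) * real_of_int (d1 x (station k u)) \<le> real_of_int (4 * nd * sc k)" .
  moreover have "real_of_int (kc * prev k) \<le> real_of_int (sc k)"
    using kc_prev_le[of k] by (simp only: of_int_le_iff)
  ultimately have "(2 - 1 / 2 ^ k) * real_of_int (d1 x (station k u)) + real_of_int (kc * prev k) \<le>
     real_of_int ((4 * nd + 1) * sc k)"
    by (simp add: distrib_right)
  moreover have "conn (- V k) x
     ((2 - 1 / 2 ^ k) * d1 x (station k u) + kc * prev k) (station k u)"
    using assms station(2) by (auto simp: paths_def)
  ultimately show "conn (- V k) x ((4 * nd + 1) * sc k) (station k u)" by (elim conn_weaken) simp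
  fix v assume v: "v \<in> - V k" "real_of_int (d1 x v) \<le> (4 * nd + 1) * sc k"
  then have "d1 x v \<le> (4 * nd + 1) * sc k" by (simp only: of_int_le_iff)
  moreover have "(4 * nd + 1) * sc k \<le> al k" by (rule le_al) (use Q' nd in simp)
  ultimately show "v \<in> - V k \<inter> {v. dinf x v \<le> al k}" using v(1) dinf_le_d1[of x v] by simp
qed



text \<open>The radius \<open>4 * sc k\<close> consists of \<open>sc k\<close> for the displacement
  of a station and \<open>3 * sc k\<close> for the length of a hop.\<close>

lemma conn_lift_stations:
  assumes "paths k" "conn G u r v"
    and S: "\<And>g x. g \<in> G \<Longrightarrow> dinf (scale (sc k) g) x \<le> 4 * sc k \<Longrightarrow> x \<notin> V k \<Longrightarrow> x \<in> S"
  shows "conn S (station k u) (hop k * r) (station k v)"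
proof (rule conn_lift[OF assms(2)])
  have S': "x \<in> S" if "g \<in> G" "x \<notin> V k" "real_of_int (d1 (station k g) x) \<le> hop k" for g x
  proof (rule S[OF that(1)])
    have "real_of_int (d1 (station k g) x) \<le> real_of_int (3 * sc k)"
      using that(3) hop_le(1)[of k] by simp
    then have "d1 (station k g) x \<le> 3 * sc k" by (simp only: of_int_le_iff)
    then show "dinf (scale (sc k) g) x \<le> 4 * sc k"
      using dinf_le_d1[of "station k g" x] dinf_triangle[of "scale (sc k) g" x "station k g"]
        station(1)[of k g] ke_prev_le[of k] by linarith
  qed (rule that)
  show "0 \<le> hop k" by (rule hop_le)
  show "station k g \<in> S" if "g \<in> G" for g
    by (rule S'[OF that]) (use clear_notin_V station(2) hop_le in auto)
  show "conn S (station k g) (hop k) (station k h)"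
    if "g \<in> G" "h \<in> G" "lattice_adj g h" for g h
    by (rule conn_localised[OF conn_station[OF assms(1) that(3)]]) (use S' that(1) in auto)
qed

text \<open>Balls of rank \<open>k\<close> are avoided on the lattice of mesh \<open>sc k\<close> by
  \<open>conn_avoiding_obstacles\<close>; each coarse step is then realised between stations by the
  induction hypothesis, which takes care of the smaller ranks.\<close>

lemma paths: "paths k"
proof (induction k)
  case 0
  have "conn UNIV x (d1 x y) y" for x y :: "int ^ 'd" by (rule conn_hull) simp
  then show ?case by (simp add: paths_def V_def prev_def)
next
  case (Suc k)
  define s where "s = sc k"
  \<comment> \<open>The extra \<open>4 * s\<close> keeps lifted paths out of the balls of radius
    \<open>r2 * al k\<close>.\<close>
  define \<rho> where "\<rho> = r2 * al k + 4 * s"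
  define R where "R = (r2 + 1) * al k"
  \<comment> \<open>A detour of \<open>3 * nd * W\<close> coarse steps, of length at most
    \<open>9 * nd * R\<close>, is charged to a stretch of length at least
    \<open>be k / 2\<close>.\<close>
  define \<eta> :: real where "\<eta> = 18 * nd * R / be k"
  define G where "G = {g. \<forall>p\<in>P k. \<rho> < dinf (scale s g) p}"
  define a :: real where "a = 2 - 1 / 2 ^ k"
  have s: "0 < s" using sc_pos by (simp add: s_def)
  have al: "0 < al k" by (rule scales_pos)
  have s_al: "5 * s \<le> al k" unfolding s_def by (rule le_al) (use Q' nd in simp)
  have \<rho>: "0 \<le> \<rho>" "\<rho> + s \<le> R"
    using s s_al al nd by (auto simp: \<rho>_def R_def r2_def algebra_simps)
  have R: "0 \<le> R" "s \<le> R" using \<rho> s by auto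
  obtain W where W: "2 * R \<le> s * W" "s * W \<le> 3 * R" "0 \<le> W" using ring_width[OF s R(2)] .
  have be: "(6 * (r2 + 2)) * al k \<le> be k" by (rule le_be) (use Q' nd in \<open>simp add: r2_def\<close>)
  have bR: "2 * R + s \<le> be k" "4 * R \<le> be k"
  proof -
    have "0 \<le> r2 * al k" using al nd by (simp add: r2_def)
    then show "2 * R + s \<le> be k" "4 * R \<le> be k" using be s_al s al by (auto simp: R_def algebra_simps)
  qed
  have \<eta>: "0 \<le> \<eta>" "3 * CARD('d) * W * s \<le> \<eta> * (be k - 2 * R)"
  proof -
    show "0 \<le> \<eta>" using R nd scales_pos(2)[of k] by (simp add: \<eta>_def)
    have "3 * nd * (s * W) \<le> 3 * nd * (3 * R)" using W nd by (intro mult_left_mono) auto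
    then have "real_of_int (3 * nd * (s * W)) \<le> real_of_int (9 * nd * R)"
      unfolding of_int_le_iff by simp
    also have "\<dots> = \<eta> * (be k / 2)" using scales_pos(2)[of k] by (simp add: \<eta>_def)
    also have "real_of_int (be k) / 2 \<le> be k - 2 * R" using bR by simp
    then have "\<eta> * (be k / 2) \<le> \<eta> * (be k - 2 * R)" using \<open>0 \<le> \<eta>\<close> by (intro mult_left_mono)
    finally show "3 * CARD('d) * W * s \<le> \<eta> * (be k - 2 * R)" by (simp add: nd_def mult_ac)
  qed
  have \<eta>_small: "\<eta> * 2 ^ k \<le> 1 / 16"
  proof -
    have "288 * nd * (r2 + 1) \<le> Q" using Q' nd by (simp add: r2_def algebra_simps)
    then have "288 * nd * (r2 + 1) * (al k * 2 ^ k) \<le> Q * (al k * 2 ^ k)"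
      using al by (intro mult_right_mono) auto
    then have "288 * nd * R * 2 ^ k \<le> be k" using be_al[of k] by (simp add: R_def mult_ac)
    then have "real_of_int (288 * nd * R * 2 ^ k) \<le> real_of_int (be k)" by (simp only: of_int_le_iff)
    then show ?thesis using scales_pos(2)[of k] by (simp add: \<eta>_def field_simps)
  qed
  have hop: "hop k \<le> (a + 1 / 2 ^ (k + 2)) * s"
  proof -
    have "8 * (4 * (nd * ke) + kc) \<le> Q" using Q' nd
      by (simp add: kc_def r2_def ke_def rf_def algebra_simps)
    then have "8 * (4 * (nd * ke) + kc) * (prev k * 2 ^ k) \<le> Q * (prev k * 2 ^ k)"
      using prev_nonneg[of k] by (intro mult_right_mono) auto
    also have "\<dots> \<le> 2 * s" using sc_prev[of k] by (simp add: s_def mult_ac)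
    finally have "real_of_int (8 * (4 * (nd * ke) + kc) * (prev k * 2 ^ k)) \<le> real_of_int (2 * s)"
      by (simp only: of_int_le_iff)
    then have 1: "(4 * (nd * ke) + kc) * prev k \<le> 1 / 2 ^ (k + 2) * real_of_int s"
      by (simp add: field_simps)
    have "a * (2 * (nd * (ke * prev k))) \<le> 2 * real_of_int (2 * (nd * (ke * prev k)))"
      using prev_nonneg[of k] nd by (intro mult_right_mono) (auto simp: a_def ke_def rf_def)
    then have "hop k \<le> a * s + (4 * (nd * ke) + kc) * prev k"
      by (simp add: hop_def a_def[symmetric] s_def algebra_simps)
    then show ?thesis using 1 by (simp add: algebra_simps)
  qed
  have a: "0 \<le> a" "a \<le> 2" using pow_bounds[of k] by (auto simp: a_def)
  have notV: "x \<in> - V (Suc k)" if "x \<notin> V k" "\<And>p. p \<in> P k \<Longrightarrow> r2 * al k < dinf p x" for x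
    using that by (force simp: V_def less_Suc_eq)
  have lift: "x \<in> - V (Suc k)" if "g \<in> G" "dinf (scale s g) x \<le> 4 * s" "x \<notin> V k" for g x
  proof (rule notV[OF that(3)])
    fix p assume "p \<in> P k"
    then have "\<rho> < dinf (scale s g) p" using that(1) by (auto simp: G_def)
    then show "r2 * al k < dinf p x"
      using dinf_triangle[of "scale s g" p x] that(2) by (simp add: \<rho>_def dinf_commute)
  qed
  have ends: "\<exists>u\<in>G. dinf (scale s u) x \<le> s \<and> conn (- V (Suc k)) x ((4 * nd + 1) * s) (station k u)"
    if x: "clear (Suc k) x" for x
  proof -
    obtain u where u: "dinf (scale s u) x \<le> s" using scale_near[OF s] .
    have xp: "rf * al k \<le> dinf p x" if "p \<in> P k" for p
      using x that by (auto simp: clear_def fat_def)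
    have "\<rho> < dinf (scale s u) p" if "p \<in> P k" for p
      using xp[OF that] u dinf_triangle[of x p "scale s u"] s_al s
      by (simp add: dinf_commute \<rho>_def rf_def r2_def algebra_simps)
    then have "u \<in> G" by (auto simp: G_def)
    have ck: "clear k x" using x by (auto simp: clear_def)
    have "conn (- V k \<inter> {v. dinf x v \<le> al k}) x ((4 * nd + 1) * s) (station k u)"
      unfolding s_def by (rule conn_to_station[OF Suc.IH ck]) (use u s_def in simp)
    then have "conn (- V (Suc k)) x ((4 * nd + 1) * s) (station k u)"
    proof (rule conn_mono, intro subsetI)
      fix v assume v: "v \<in> - V k \<inter> {v. dinf x v \<le> al k}"
      show "v \<in> - V (Suc k)"
      proof (rule notV)
        fix p assume "p \<in> P k"
        from xp[OF this] have "20 * (nd * al k) + 14 * al k \<le> dinf p x"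
          by (simp add: rf_def algebra_simps)
        then show "r2 * al k < dinf p v"
          using dinf_triangle[of p x v] v al by (simp add: r2_def dinf_commute algebra_simps)
      qed (use v in simp)
    qed
    then show ?thesis using \<open>u \<in> G\<close> u by blast
  qed
  show ?case
    unfolding paths_def
  proof (intro allI impI)
    fix x y assume xy: "clear (Suc k) x" "clear (Suc k) y"
    obtain u where u: "u \<in> G" "dinf (scale s u) x \<le> s"
      "conn (- V (Suc k)) x ((4 * nd + 1) * s) (station k u)" using ends[OF xy(1)] by blast
    obtain v where v: "v \<in> G" "dinf (scale s v) y \<le> s"
      "conn (- V (Suc k)) y ((4 * nd + 1) * s) (station k v)" using ends[OF xy(2)] by blast
    have "conn G u ((1 + \<eta>) * d1 u v + 3 * CARD('d) * W) v"
      by (rule conn_avoiding_obstacles[OF card_d s \<rho> W(1) sep bR(1) \<eta> G_def u(1) v(1)])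
    then have "conn (- V (Suc k)) (station k u)
        (hop k * ((1 + \<eta>) * d1 u v + 3 * CARD('d) * W)) (station k v)"
      by (rule conn_lift_stations[OF Suc.IH]) (use lift s_def in auto)
    from conn_trans[OF u(3) conn_trans[OF this conn_sym[OF v(3)] order_refl] order_refl]
    have "conn (- V (Suc k)) x (real_of_int ((4 * nd + 1) * s) +
       (hop k * ((1 + \<eta>) * d1 u v + 3 * CARD('d) * W) + real_of_int ((4 * nd + 1) * s))) y" by simp
    moreover have "real_of_int ((4 * nd + 1) * s) +
       (hop k * ((1 + \<eta>) * d1 u v + 3 * CARD('d) * W) + real_of_int ((4 * nd + 1) * s)) \<le>
       (2 - 1 / 2 ^ Suc k) * d1 x y + kc * prev (Suc k)"
    proof -
      define D where "D = real_of_int (d1 u v)"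
      define b :: real where "b = 2 - 1 / 2 ^ Suc k"
      have b: "0 \<le> b" "b \<le> 2" unfolding b_def by (rule pow_bounds)+
      have D0: "0 \<le> D" by (simp add: D_def)
      have "s * d1 u v \<le> d1 x y + 2 * (nd * s)"
      proof -
        have "s * d1 u v = d1 (scale s u) (scale s v)" using s by (simp add: d1_scale)
        also have "\<dots> \<le> d1 (scale s u) x + (d1 x y + d1 (scale s v) y)"
          using d1_triangle[of "scale s u" "scale s v" x] d1_triangle[of x "scale s v" y]
          by (simp add: d1_commute)
        also have "d1 (scale s u) x \<le> nd * s"
          using d1_le[of "scale s u" x] mult_left_mono[OF u(2), of nd] nd(1) by linarith
        also have "d1 (scale s v) y \<le> nd * s"
          using d1_le[of "scale s v" y] mult_left_mono[OF v(2), of nd] nd(1) by linarith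
        finally show ?thesis by linarith
      qed
      then have "real_of_int (s * d1 u v) \<le> real_of_int (d1 x y + 2 * (nd * s))"
        by (simp only: of_int_le_iff)
      then have sD: "s * D \<le> d1 x y + 2 * (nd * s)" by (simp add: D_def)
      have "hop k * (1 + \<eta>) \<le> ((a + 1 / 2 ^ (k + 2)) * s) * (1 + \<eta>)"
        using hop \<eta>(1) by (intro mult_right_mono) auto
      also have "\<dots> = ((a + 1 / 2 ^ (k + 2)) * (1 + \<eta>)) * s" by simp
      \<comment> \<open>The increment \<open>1 / 2 ^ (k + 1)\<close> is split in halves: one for the
        displaced stations in \<open>hop\<close>, the other for the detours, through
        \<open>3 * \<eta>\<close>.\<close>
      also have "(a + 1 / 2 ^ (k + 2)) * (1 + \<eta>) \<le> b"
      proof -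
        have "(a + 1 / 2 ^ (k + 2)) * (1 + \<eta>) = a + 1 / 2 ^ (k + 2) + (a + 1 / 2 ^ (k + 2)) * \<eta>"
          by (simp only: distrib_left mult_1_right)
        also have "(a + 1 / 2 ^ (k + 2)) * \<eta> \<le> 3 * \<eta>"
        proof (rule mult_right_mono[OF _ \<eta>(1)])
          have "1 / 2 ^ (k + 2) \<le> (1::real)" using one_le_power[of "2::real" "k + 2"] by simp
          then show "a + 1 / 2 ^ (k + 2) \<le> 3" using a(2) by linarith
        qed
        also have "3 * \<eta> \<le> 1 / 2 ^ (k + 2)" using \<eta>_small by (simp add: field_simps)
        finally show ?thesis by (simp add: a_def b_def field_simps)
      qed
      finally have "hop k * (1 + \<eta>) \<le> b * s" using s by (simp add: mult_right_mono)
      then have "hop k * (1 + \<eta>) * D \<le> b * s * D" using D0 by (intro mult_right_mono)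
      also have "\<dots> = b * (s * D)" by simp
      also have "\<dots> \<le> b * (d1 x y + 2 * (nd * s))" using sD b by (intro mult_left_mono) auto
      also have "\<dots> = b * d1 x y + b * (2 * (nd * s))" by (simp add: algebra_simps)
      also have "b * (2 * (nd * s)) \<le> 2 * real_of_int (2 * (nd * s))"
        using b s nd by (intro mult_right_mono) auto
      finally have 1: "hop k * ((1 + \<eta>) * D) \<le> b * d1 x y + 4 * (nd * s)" by (simp add: mult_ac)
      have "hop k * real_of_int (3 * nd * W) \<le> real_of_int (3 * s) * real_of_int (3 * nd * W)"
        using hop_le(1)[of k] W(3) nd by (intro mult_right_mono) (auto simp: s_def)
      also have "\<dots> = real_of_int (9 * nd * (s * W))" by simp
      also have "\<dots> \<le> real_of_int (9 * nd * (3 * R))"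
        unfolding of_int_le_iff using W(2) nd by (intro mult_left_mono) auto
      finally have 2: "hop k * (3 * nd * W) \<le> real_of_int (27 * nd * R)" by simp
      have "(4 * nd + 1) * s + (4 * nd + 1) * s + 4 * (nd * s) + 27 * nd * R \<le> kc * al k"
      proof -
        have "(12 * nd + 2) * s \<le> al k" unfolding s_def by (rule le_al) (use Q' nd in simp)
        moreover have "0 \<le> nd * al k" using nd al by simp
        ultimately show ?thesis by (simp add: kc_def R_def algebra_simps)
      qed
      then have 3: "real_of_int ((4 * nd + 1) * s) + real_of_int ((4 * nd + 1) * s) +
          real_of_int (4 * (nd * s)) + real_of_int (27 * nd * R) \<le> real_of_int (kc * al k)"
        by (simp only: of_int_le_iff of_int_add[symmetric])
      have 4: "hop k * ((1 + \<eta>) * D + 3 * CARD('d) * W) =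
          hop k * ((1 + \<eta>) * D) + hop k * real_of_int (3 * nd * W)"
        by (simp add: nd_def distrib_left)
      have 5: "prev (Suc k) = al k" by (simp add: prev_def)
      have 6: "hop k * ((1 + \<eta>) * D) \<le> b * d1 x y + real_of_int (4 * (nd * s))" using 1 by simp
      show ?thesis using 2 3 4 6 unfolding 5 D_def[symmetric] b_def[symmetric] by linarith
    qed
    ultimately show "conn (- V (Suc k)) x ((2 - 1 / 2 ^ Suc k) * d1 x y + kc * prev (Suc k)) y"
      by (rule conn_weaken)
  qed
qed

text \<open>\<open>27 * nd * (r2 + 5)\<close> pays for the ring, 1 for joining its two ends to the
  coarse lattice.\<close>

definition lap :: int where "lap = 27 * nd * (r2 + 5) + 1"

text \<open>The ring is walked on the coarse lattice and lifted through stations, which avoids the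
  smaller islands as well. Grid points between \<open>8 * al k\<close> and
  \<open>(r2 + 5) * al k\<close> leave margins on both sides that absorb the lifting. The length is
  a multiple of \<open>al k\<close> depending only on the dimension.\<close>

lemma conn_around_island:
  assumes "clear k x" "10 * al k \<le> dinf p x" "dinf p x \<le> (r2 + 4) * al k"
    and "clear k y" "10 * al k \<le> dinf p y" "dinf p y \<le> (r2 + 4) * al k"
  shows "conn (- V k \<inter> {v. 6 * al k < dinf p v \<and> dinf p v \<le> fat k}) x (lap * al k) y"
    (is "conn ?S _ _ _")
proof -
  define s where "s = sc k"
  define \<rho> where "\<rho> = 8 * al k"
  define R where "R = (r2 + 5) * al k"
  define G where "G = {g. \<rho> < dinf (scale s g) p \<and> dinf (scale s g) p \<le> R}"
  have s: "0 < s" using sc_pos by (simp add: s_def)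
  have al: "0 < al k" by (rule scales_pos)
  have s_al: "5 * s \<le> al k" unfolding s_def by (rule le_al) (use Q' nd in simp)
  have "R = 20 * (nd * al k) + 9 * al k" by (simp add: R_def r2_def algebra_simps)
  moreover have "0 \<le> nd * al k" using nd al by simp
  ultimately have \<rho>: "0 \<le> \<rho>" "\<rho> + s \<le> R"
    using s s_al al unfolding \<rho>_def by linarith+
  have R: "s \<le> R" using \<rho> s by auto
  obtain W where W: "2 * R \<le> s * W" "s * W \<le> 3 * R" "0 \<le> W" using ring_width[OF s R] .
  have lift: "x \<in> ?S" if "g \<in> G" "dinf (scale s g) x \<le> 4 * s" "x \<notin> V k" for g x
    using that dinf_triangle[of "scale s g" p x] dinf_triangle[of p x "scale s g"] s_al al
    by (auto simp: G_def \<rho>_def R_def fat_def rf_def r2_def dinf_commute algebra_simps)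
  have ends: "\<exists>u\<in>G. conn ?S x ((4 * nd + 1) * s) (station k u)"
    if x: "clear k x" "10 * al k \<le> dinf p x" "dinf p x \<le> (r2 + 4) * al k" for x
  proof -
    obtain u where u: "dinf (scale s u) x \<le> s" using scale_near[OF s] .
    have "u \<in> G" using x(2,3) u dinf_triangle[of x p "scale s u"] dinf_triangle[of "scale s u" p x] s_al s
      by (auto simp: G_def dinf_commute \<rho>_def R_def algebra_simps)
    have "conn (- V k \<inter> {v. dinf x v \<le> al k}) x ((4 * nd + 1) * s) (station k u)"
      unfolding s_def by (rule conn_to_station[OF paths x(1)]) (use u s_def in simp)
    then have "conn ?S x ((4 * nd + 1) * s) (station k u)"
    proof (rule conn_mono, intro subsetI)
      fix v assume "v \<in> - V k \<inter> {v. dinf x v \<le> al k}"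
      then show "v \<in> ?S" using x(2,3) dinf_triangle[of p x v] dinf_triangle[of p v x] al
        by (auto simp: rf_def fat_def r2_def dinf_commute algebra_simps)
    qed
    then show ?thesis using \<open>u \<in> G\<close> u by blast
  qed
  obtain u where u: "u \<in> G" "conn ?S x ((4 * nd + 1) * s) (station k u)" using ends assms by blast
  obtain v where v: "v \<in> G" "conn ?S y ((4 * nd + 1) * s) (station k v)" using ends assms by blast
  have "conn G u (3 * CARD('d) * W) v"
    by (rule conn_ring_scale[OF card_d s \<rho> W(1), where p = p]) (use u v in \<open>auto simp: G_def\<close>)
  then have "conn ?S (station k u) (hop k * (3 * CARD('d) * W)) (station k v)"
    by (rule conn_lift_stations[OF paths]) (use lift s_def in auto)
  from conn_trans[OF u(2) conn_trans[OF this conn_sym[OF v(2)] order_refl] order_refl]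
  have "conn ?S x (real_of_int ((4 * nd + 1) * s) +
     (hop k * (3 * CARD('d) * W) + real_of_int ((4 * nd + 1) * s))) y" by simp
  moreover have "real_of_int ((4 * nd + 1) * s) +
     (hop k * (3 * CARD('d) * W) + real_of_int ((4 * nd + 1) * s)) \<le> lap * al k"
  proof -
    have "hop k * real_of_int (3 * nd * W) \<le> real_of_int (3 * s) * real_of_int (3 * nd * W)"
      using hop_le(1)[of k] W nd by (intro mult_right_mono) (auto simp: s_def)
    also have "\<dots> = real_of_int (9 * nd * (s * W))" by simp
    also have "\<dots> \<le> real_of_int (9 * nd * (3 * R))"
      unfolding of_int_le_iff using W(2) nd by (intro mult_left_mono) auto
    finally have 2: "hop k * (3 * nd * W) \<le> real_of_int (27 * nd * R)" by simp
    have "(4 * nd + 1) * s + (4 * nd + 1) * s + 27 * nd * R \<le> lap * al k"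
    proof -
      have "(8 * nd + 2) * s \<le> al k" unfolding s_def by (rule le_al) (use Q' nd in simp)
      then show ?thesis by (simp add: lap_def R_def algebra_simps)
    qed
    then have "real_of_int ((4 * nd + 1) * s) + real_of_int ((4 * nd + 1) * s) +
        real_of_int (27 * nd * R) \<le> real_of_int (lap * al k)"
      by (simp only: of_int_le_iff of_int_add[symmetric])
    moreover have "hop k * (3 * CARD('d) * W) = hop k * real_of_int (3 * nd * W)"
      by (simp add: nd_def)
    ultimately show ?thesis using 2 by linarith
  qed
  ultimately show ?thesis by (rule conn_weaken)
qed

end

section \<open>The evolution for a fixed realisation of the clocks\<close>

lemma INF_attained_finite:
  fixes f :: "'a \<Rightarrow> 'b::{complete_linorder}"
  assumes "finite S" "(INF x\<in>S. f x) < top"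
  shows "\<exists>x\<in>S. f x = (INF x\<in>S. f x)"
proof -
  have "S \<noteq> {}" using assms(2) by auto
  then have "Inf (f ` S) = Min (f ` S)" using assms(1) by (simp add: cInf_eq_Min)
  then have "Inf (f ` S) \<in> f ` S" using assms(1) \<open>S \<noteq> {}\<close> by auto
  then show ?thesis by auto
qed

lemma not_less_top_iff: "\<not> x < top \<longleftrightarrow> x = (top :: ennreal)"
  using top.not_eq_extremum by blast

lemma add_less_infinity: "x < \<infinity> \<Longrightarrow> x + ennreal r < \<infinity>"
  by (simp add: ennreal_add_less_top)

locale evolution =
  fixes adj :: "'v \<Rightarrow> 'v \<Rightarrow> bool" and orig :: 'v and w :: "'v clock \<Rightarrow> real"
  assumes finite_in: "finite {x. adj x y}" and finite_out: "finite {x. adj y x}"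
begin

definition A :: "nat \<Rightarrow> 'v \<Rightarrow> ennreal" where "A n = fst (history adj orig w n)"
definition B :: "nat \<Rightarrow> 'v \<Rightarrow> ennreal" where "B n = snd (history adj orig w n)"
definition D1 :: "nat \<Rightarrow> 'v \<Rightarrow> ennreal" where "D1 n = due1 adj w (history adj orig w n)"
definition D2 :: "nat \<Rightarrow> 'v \<Rightarrow> ennreal" where "D2 n = due2 adj w (history adj orig w n)"
definition s :: "nat \<Rightarrow> ennreal" where "s n = next_time adj w (history adj orig w n)"
abbreviation a :: "'v \<Rightarrow> ennreal" where "a \<equiv> time1 adj orig w"
abbreviation b :: "'v \<Rightarrow> ennreal" where "b \<equiv> time2 adj orig w"

lemma history_0: "A 0 x = (if x = orig then 0 else \<infinity>)" "B 0 x = \<infinity>"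
  by (simp_all add: A_def B_def history_def)

lemma history_Suc: "history adj orig w (Suc n) = step adj w (history adj orig w n)"
  by (simp add: history_def)

lemma A_Suc: "A (Suc n) y = (if s n < \<infinity> \<and> D1 n y = s n \<and> D2 n y \<noteq> s n then s n else A n y)"
  unfolding A_def history_Suc by (simp add: step_def Let_def D1_def D2_def s_def)

lemma B_Suc: "B (Suc n) y = (if s n < \<infinity> \<and> D2 n y = s n then s n else B n y)"
  unfolding B_def history_Suc by (simp add: step_def Let_def D2_def s_def)

lemma D1_eq: "D1 n y = (if A n y = \<infinity> \<and> B n y = \<infinity>
  then (INF x\<in>{x. adj x y \<and> A n x < \<infinity> \<and> B n x = \<infinity>}. A n x + ennreal (w (Spread1 x y))) else \<infinity>)"
  unfolding D1_def due1_def A_def B_def by (simp add: case_prod_beta)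

lemma D2_eq: "D2 n y = (if B n y = \<infinity>
  then min (A n y + ennreal (w (Convert y)))
    (INF x\<in>{x. adj x y \<and> B n x < \<infinity>}. B n x + ennreal (w (Spread2 x y))) else \<infinity>)"
  unfolding D2_def due2_def A_def B_def by (simp add: case_prod_beta)

lemma s_eq: "s n = (INF y. min (D1 n y) (D2 n y))"
  by (simp add: s_def next_time_def D1_def D2_def)

lemma s_le: "s n \<le> D1 n y" "s n \<le> D2 n y"
  using INF_lower[of y UNIV "\<lambda>y. min (D1 n y) (D2 n y)"] by (auto simp: s_eq)

lemma D1_le: "A n y = \<infinity> \<Longrightarrow> B n y = \<infinity> \<Longrightarrow> adj x y \<Longrightarrow> A n x < \<infinity> \<Longrightarrow> B n x = \<infinity> \<Longrightarrow>
    D1 n y \<le> A n x + ennreal (w (Spread1 x y))"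
  by (auto simp: D1_eq intro!: INF_lower)

lemma D2_le_convert: "B n y = \<infinity> \<Longrightarrow> D2 n y \<le> A n y + ennreal (w (Convert y))"
  by (simp add: D2_eq)

lemma D2_le_spread: "B n y = \<infinity> \<Longrightarrow> adj x y \<Longrightarrow> B n x < \<infinity> \<Longrightarrow> D2 n y \<le> B n x + ennreal (w (Spread2 x y))"
  by (auto simp: D2_eq intro!: min.coboundedI2 INF_lower)

lemma A_Suc_cases:
  obtains "A (Suc n) y = A n y"
  | "A n y = \<infinity>" "B n y = \<infinity>" "A (Suc n) y = s n" "s n < \<infinity>" "D1 n y = s n"
proof (cases "s n < \<infinity> \<and> D1 n y = s n \<and> D2 n y \<noteq> s n")
  case True
  then have "A n y = \<infinity> \<and> B n y = \<infinity>" by (auto simp: D1_eq split: if_splits)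
  then show ?thesis using that(2) True by (simp add: A_Suc)
next
  case False
  then have "A (Suc n) y = A n y" by (simp only: A_Suc if_False)
  then show ?thesis by (rule that(1))
qed

lemma B_Suc_cases:
  obtains "B (Suc n) y = B n y"
  | "B n y = \<infinity>" "B (Suc n) y = s n" "s n < \<infinity>" "D2 n y = s n"
proof (cases "s n < \<infinity> \<and> D2 n y = s n")
  case True
  then have "B n y = \<infinity>" by (auto simp: D2_eq split: if_splits)
  then show ?thesis using that(2) True by (simp add: B_Suc)
next
  case False
  then have "B (Suc n) y = B n y" by (simp only: B_Suc if_False)
  then show ?thesis by (rule that(1))
qed

lemma A_stays: "A m y = A n y" if "A n y < \<infinity>" "n \<le> m"
  using that(2)
proof (induction rule: dec_induct)
  case (step m)
  show ?case by (rule A_Suc_cases[of m y]) (use step that(1) in auto)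
qed simp

lemma B_stays: "B m y = B n y" if "B n y < \<infinity>" "n \<le> m"
  using that(2)
proof (induction rule: dec_induct)
  case (step m)
  show ?case by (rule B_Suc_cases[of m y]) (use step that(1) in auto)
qed simp

lemma A_Suc_infinity: "A (Suc n) y = \<infinity> \<Longrightarrow> A n y = \<infinity>"
  using A_stays[of n y "Suc n"] by (cases "A n y = \<infinity>") (auto simp: less_top not_less_top_iff)

lemma B_Suc_infinity: "B (Suc n) y = \<infinity> \<Longrightarrow> B n y = \<infinity>"
  using B_stays[of n y "Suc n"] by (cases "B n y = \<infinity>") (auto simp: less_top not_less_top_iff)

text \<open>An event pending after the step either was pending before, so is not due before
  \<open>s n\<close>, or stems from a site that changed at time \<open>s n\<close>.\<close>

lemma s_Suc: "s n \<le> s (Suc n)"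
proof -
  have 1: "s n \<le> D1 (Suc n) y" for y
  proof (cases "A (Suc n) y = \<infinity> \<and> B (Suc n) y = \<infinity>")
    case True
    then have y: "A n y = \<infinity>" "B n y = \<infinity>" using A_Suc_infinity B_Suc_infinity by auto
    have "s n \<le> A (Suc n) x + ennreal (w (Spread1 x y))"
      if x: "adj x y" "A (Suc n) x < \<infinity>" "B (Suc n) x = \<infinity>" for x
    proof (rule A_Suc_cases[of n x])
      assume "A (Suc n) x = A n x"
      then show ?thesis
        using D1_le[OF y x(1)] x B_Suc_infinity s_le(1)[of n y] by (metis order_trans)
    next
      assume "A (Suc n) x = s n"
      then show ?thesis by simp
    qed
    then show ?thesis using True by (auto simp: D1_eq intro!: INF_greatest)
  next
    case False
    then show ?thesis by (simp only: D1_eq if_False) simp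
  qed
  have 2: "s n \<le> D2 (Suc n) y" for y
  proof (cases "B (Suc n) y = \<infinity>")
    case True
    then have y: "B n y = \<infinity>" using B_Suc_infinity by auto
    have "s n \<le> B (Suc n) x + ennreal (w (Spread2 x y))"
      if x: "adj x y" "B (Suc n) x < \<infinity>" for x
    proof (rule B_Suc_cases[of n x])
      assume "B (Suc n) x = B n x"
      then show ?thesis using D2_le_spread[OF y x(1)] x s_le(2)[of n y] by (metis order_trans)
    next
      assume "B (Suc n) x = s n"
      then show ?thesis by simp
    qed
    moreover have "s n \<le> A (Suc n) y + ennreal (w (Convert y))"
    proof (rule A_Suc_cases[of n y])
      assume "A (Suc n) y = A n y"
      then show ?thesis using D2_le_convert[OF y] s_le(2)[of n y] by (metis order_trans)
    next
      assume "A (Suc n) y = s n"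
      then show ?thesis by simp
    qed
    ultimately show ?thesis using True by (auto simp: D2_eq intro!: INF_greatest)
  qed (simp add: D2_eq)
  show ?thesis
    unfolding s_eq[of "Suc n"] by (rule INF_greatest) (simp add: 1 2)
qed

lemma s_mono: "n \<le> m \<Longrightarrow> s n \<le> s m"
  using s_Suc lift_Suc_mono_le[of s] by blast

lemma A_le_s: "A n y < \<infinity> \<Longrightarrow> A n y \<le> s n"
proof (induction n)
  case 0
  then show ?case by (auto simp: history_0 split: if_splits)
next
  case (Suc n)
  show ?case
    by (rule A_Suc_cases[of n y]) (use Suc s_Suc[of n] in \<open>auto intro: order_trans\<close>)
qed

lemma finite_occupied: "finite {y. A n y < \<infinity> \<or> B n y < \<infinity>}"
proof (induction n)
  case 0
  then show ?case by (auto simp: history_0 intro: finite_subset[of _ "{orig}"])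
next
  case (Suc n)
  let ?O = "{y. A n y < \<infinity> \<or> B n y < \<infinity>}"
  have "{y. A (Suc n) y < \<infinity> \<or> B (Suc n) y < \<infinity>} \<subseteq> ?O \<union> (\<Union>x\<in>?O. {y. adj x y})"
  proof safe
    fix y assume "A (Suc n) y < \<infinity>" and B: "\<not> B n y < \<infinity>" and new: "y \<notin> (\<Union>x\<in>?O. {y. adj x y})"
    from new have "{x. adj x y \<and> A n x < \<infinity> \<and> B n x = \<infinity>} = {}" by auto
    then have "D1 n y = \<infinity>" by (simp only: D1_eq) simp
    with \<open>A (Suc n) y < \<infinity>\<close> show "A n y < \<infinity>" by (auto simp: A_Suc split: if_splits)
  next
    fix y assume "B (Suc n) y < \<infinity>" and B: "\<not> B n y < \<infinity>" and new: "y \<notin> (\<Union>x\<in>?O. {y. adj x y})"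
    from new have "{x. adj x y \<and> B n x < \<infinity>} = {}" by auto
    then have "D2 n y = (if B n y = \<infinity> then A n y + ennreal (w (Convert y)) else \<infinity>)"
      by (simp only: D2_eq) simp
    moreover have "s n < \<infinity>" "D2 n y = s n"
      using \<open>B (Suc n) y < \<infinity>\<close> B by (auto simp: B_Suc split: if_splits)
    moreover have "B n y = \<infinity>" using B by (simp add: not_less_top_iff)
    ultimately have "A n y + ennreal (w (Convert y)) < \<infinity>" by simp
    then show "A n y < \<infinity>" by (rule le_less_trans[rotated]) simp
  qed
  moreover have "finite (?O \<union> (\<Union>x\<in>?O. {y. adj x y}))" using Suc finite_out by blast
  ultimately show ?case by (rule finite_subset)
qed

text \<open>Only the finitely many occupied sites and their out-neighbours can have pending events,
  so the infimum is a minimum. Hence every step at a finite time makes progress.\<close>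

lemma s_attained:
  assumes "s n < \<infinity>"
  shows "\<exists>y. A (Suc n) y \<noteq> A n y \<or> B (Suc n) y \<noteq> B n y"
proof -
  let ?O = "{y. A n y < \<infinity> \<or> B n y < \<infinity>}"
  let ?N = "?O \<union> (\<Union>x\<in>?O. {y. adj x y})"
  define f where "f y = min (D1 n y) (D2 n y)" for y
  have "f y = \<infinity>" if "y \<notin> ?N" for y
  proof -
    from that have "{x. adj x y \<and> A n x < \<infinity> \<and> B n x = \<infinity>} = {}" by auto
    then have "D1 n y = \<infinity>" by (simp only: D1_eq) simp
    moreover from that have "{x. adj x y \<and> B n x < \<infinity>} = {}" by auto
    then have "D2 n y = (if B n y = \<infinity> then A n y + ennreal (w (Convert y)) else \<infinity>)"
      by (simp only: D2_eq) simp
    moreover have "A n y = \<infinity>" using that by (auto simp: less_top not_less_top_iff)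
    ultimately show ?thesis by (simp add: f_def)
  qed
  note outside = this
  have "s n = (INF y\<in>?N. f y)"
    unfolding s_eq f_def[symmetric]
  proof (rule antisym)
    show "(INF y\<in>?N. f y) \<le> (INF y. f y)"
    proof (rule INF_greatest)
      fix y show "(INF y\<in>?N. f y) \<le> f y"
        using outside by (cases "y \<in> ?N") (blast intro: INF_lower, simp)
    qed
  qed (intro INF_superset_mono, auto)
  moreover have "finite ?N" using finite_occupied finite_out by blast
  ultimately obtain y where "f y = s n"
    using INF_attained_finite[of ?N f] assms by auto
  then have "D1 n y = s n \<or> D2 n y = s n" by (auto simp: f_def min_def split: if_splits)
  then have "(A n y = \<infinity> \<and> A (Suc n) y = s n) \<or> (B n y = \<infinity> \<and> B (Suc n) y = s n)"
    using assms by (auto simp: A_Suc B_Suc D1_eq D2_eq split: if_splits)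
  then show ?thesis using assms by (auto intro!: exI[of _ y])
qed

lemma a_eq: "A n y < \<infinity> \<Longrightarrow> a y = A n y"
  unfolding time1_def A_def[symmetric]
proof (rule antisym)
  assume n: "A n y < \<infinity>"
  show "A n y \<le> (INF m. A m y)"
  proof (rule INF_greatest)
    fix m show "A n y \<le> A m y"
    proof (cases "A m y < \<infinity>")
      case True
      then show ?thesis
        using A_stays[OF n, of m] A_stays[of m y n] by (metis nat_le_linear order_refl)
    qed (simp add: not_less top_unique)
  qed
qed (auto intro: INF_lower)

lemma b_eq: "B n y < \<infinity> \<Longrightarrow> b y = B n y"
  unfolding time2_def B_def[symmetric]
proof (rule antisym)
  assume n: "B n y < \<infinity>"
  show "B n y \<le> (INF m. B m y)"
  proof (rule INF_greatest)
    fix m show "B n y \<le> B m y"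
    proof (cases "B m y < \<infinity>")
      case True
      then show ?thesis
        using B_stays[OF n, of m] B_stays[of m y n] by (metis nat_le_linear order_refl)
    qed (simp add: not_less top_unique)
  qed
qed (auto intro: INF_lower)

lemma a_finite: "a y < \<infinity> \<longleftrightarrow> (\<exists>n. A n y < \<infinity>)"
  unfolding time1_def A_def[symmetric] by (simp add: INF_less_iff)

lemma b_finite: "b y < \<infinity> \<longleftrightarrow> (\<exists>n. B n y < \<infinity>)"
  unfolding time2_def B_def[symmetric] by (simp add: INF_less_iff)

lemma a_orig: "a orig = 0"
  using a_eq[of 0 orig] by (simp add: history_0)

lemma a_birth:
  assumes "A m y < \<infinity>"
  obtains "y = orig"
  | n where "n < m" "A n y = \<infinity>" "B n y = \<infinity>" "a y = s n" "s n < \<infinity>" "D1 n y = s n" "A (Suc n) y < \<infinity>"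
proof (cases "A 0 y = \<infinity>")
  case False
  then show ?thesis using that(1) by (auto simp: history_0 split: if_splits)
next
  case True
  have "\<exists>n<m. A n y = \<infinity> \<and> A (Suc n) y < \<infinity>"
    using assms True by (induction m) (force simp: less_Suc_eq not_less_top_iff)+
  then obtain n where n: "n < m" "A n y = \<infinity>" "A (Suc n) y < \<infinity>" by blast
  show ?thesis
    by (rule A_Suc_cases[of n y]) (use n that(2) a_eq[OF n(3)] in auto)
qed

lemma b_birth:
  assumes "B m y < \<infinity>"
  obtains n where "n < m" "B n y = \<infinity>" "b y = s n" "s n < \<infinity>" "D2 n y = s n" "B (Suc n) y < \<infinity>"
proof -
  have "\<exists>n<m. B n y = \<infinity> \<and> B (Suc n) y < \<infinity>"
    using assms by (induction m) (force simp: less_Suc_eq not_less_top_iff history_0)+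
  then obtain n where n: "n < m" "B n y = \<infinity>" "B (Suc n) y < \<infinity>" by blast
  show ?thesis
    by (rule B_Suc_cases[of n y]) (use n that b_eq[OF n(3)] in auto)
qed

lemma a_later: "s n \<le> a y" if n: "A n y = \<infinity>"
proof (cases "a y < \<infinity>")
  case True
  then obtain m where m: "A m y < \<infinity>" using a_finite by blast
  show ?thesis
  proof (rule a_birth[OF m])
    assume "y = orig"
    then show ?thesis using n A_stays[of 0 orig n] by (simp add: history_0)
  next
    fix k assume k: "a y = s k" "A (Suc k) y < \<infinity>"
    have "n \<le> k"
    proof (rule ccontr)
      assume "\<not> n \<le> k"
      then show False using A_stays[OF k(2), of n] k(2) n by simp
    qed
    then show ?thesis using k(1) s_mono by simp
  qed
qed (simp add: not_less top_unique)

lemma b_later: "s n \<le> b y" if n: "B n y = \<infinity>"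
proof (cases "b y < \<infinity>")
  case True
  then obtain m where m: "B m y < \<infinity>" using b_finite by blast
  show ?thesis
  proof (rule b_birth[OF m])
    fix k assume k: "b y = s k" "B (Suc k) y < \<infinity>"
    have "n \<le> k"
    proof (rule ccontr)
      assume "\<not> n \<le> k"
      then show False using B_stays[OF k(2), of n] k(2) n by simp
    qed
    then show ?thesis using k(1) s_mono by simp
  qed
qed (simp add: not_less top_unique)

text \<open>With finitely many in-neighbours, some parent attains the due time. When the child is
  born the parent is still of type 1 and its own conversion is due no earlier; this gives the last
  two inequalities. The smaller step number \<open>n\<close> makes arguments about ancestors
  well-founded.\<close>

lemma a_cause:
  assumes "A m y < \<infinity>" "y \<noteq> orig"
  obtains n x where "n < m" "adj x y" "A n x < \<infinity>" "a y = a x + ennreal (w (Spread1 x y))"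
    "a y \<le> b x" "a y \<le> a x + ennreal (w (Convert x))"
proof (rule a_birth[OF assms(1)])
  fix n assume n: "n < m" "A n y = \<infinity>" "B n y = \<infinity>" "a y = s n" "s n < \<infinity>" "D1 n y = s n"
  let ?S = "{x. adj x y \<and> A n x < \<infinity> \<and> B n x = \<infinity>}"
  have "finite ?S" using finite_in by (rule rev_finite_subset) auto
  moreover have D1: "D1 n y = (INF x\<in>?S. A n x + ennreal (w (Spread1 x y)))"
    using n by (simp add: D1_eq)
  ultimately obtain x where x: "x \<in> ?S" "A n x + ennreal (w (Spread1 x y)) = s n"
    using INF_attained_finite[of ?S "\<lambda>x. A n x + ennreal (w (Spread1 x y))"] n by auto
  have "a x = A n x" using x by (auto intro: a_eq)
  moreover have "s n \<le> b x" using x b_later by auto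
  moreover have "s n \<le> A n x + ennreal (w (Convert x))"
    using s_le(2)[of n x] D2_le_convert[of n x] x by auto
  ultimately show ?thesis using that[of n x] n x by auto
qed (use assms(2) in auto)

lemma b_cause:
  assumes "B m y < \<infinity>"
  obtains "a y < \<infinity>" "b y = a y + ennreal (w (Convert y))" "A m y < \<infinity>"
  | n x where "n < m" "B n y = \<infinity>" "adj x y" "B n x < \<infinity>" "b y = b x + ennreal (w (Spread2 x y))"
proof (rule b_birth[OF assms(1)])
  fix n assume n: "n < m" "B n y = \<infinity>" "b y = s n" "s n < \<infinity>" "D2 n y = s n"
  let ?S = "{x. adj x y \<and> B n x < \<infinity>}"
  let ?I = "INF x\<in>?S. B n x + ennreal (w (Spread2 x y))"
  have D2: "s n = min (A n y + ennreal (w (Convert y))) ?I"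
    using n by (simp add: D2_eq)
  show ?thesis
  proof (cases "s n = A n y + ennreal (w (Convert y))")
    case True
    then have "A n y < \<infinity>" using n(4) by (cases "A n y = \<infinity>") (auto simp: less_top not_less_top_iff)
    moreover have "A m y = A n y" using A_stays[OF calculation, of m] n(1) by simp
    ultimately show ?thesis using that(1) n(3) True a_eq[of n y] by simp
  next
    case False
    then have I: "s n = ?I" using D2 by (auto simp: min_def split: if_splits)
    have "finite ?S" using finite_in by (rule rev_finite_subset) auto
    then obtain x where x: "x \<in> ?S" "B n x + ennreal (w (Spread2 x y)) = s n"
      using INF_attained_finite[of ?S "\<lambda>x. B n x + ennreal (w (Spread2 x y))"] n(4) I by auto
    have "b x = B n x" using x by (auto intro: b_eq)
    then show ?thesis using that(2)[of n x] n x by auto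
  qed
qed

text \<open>Induction runs over step numbers, not over times: delays may be 0, so a child need not
  be strictly later than its parent.\<close>

lemma time_induct [consumes 0, case_names orig spread1 convert spread2]:
  assumes "Pa orig"
    and spread1: "\<And>x y. adj x y \<Longrightarrow> a x < \<infinity> \<Longrightarrow> Pa x \<Longrightarrow> a y = a x + ennreal (w (Spread1 x y)) \<Longrightarrow>
      a y < \<infinity> \<Longrightarrow> a y \<le> b x \<Longrightarrow> a y \<le> a x + ennreal (w (Convert x)) \<Longrightarrow> Pa y"
    and convert: "\<And>x. Pa x \<Longrightarrow> b x = a x + ennreal (w (Convert x)) \<Longrightarrow> b x < \<infinity> \<Longrightarrow> Pb x"
    and spread2: "\<And>x y. adj x y \<Longrightarrow> Pb x \<Longrightarrow> b y = b x + ennreal (w (Spread2 x y)) \<Longrightarrow> b y < \<infinity> \<Longrightarrow> Pb y"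
  shows "a y < \<infinity> \<Longrightarrow> Pa y" "b y < \<infinity> \<Longrightarrow> Pb y"
proof -
  have Pa: "A m y < \<infinity> \<Longrightarrow> Pa y" for m y
  proof (induction m arbitrary: y rule: less_induct)
    case (less m)
    show ?case
    proof (cases "y = orig")
      case False
      then obtain n x where x: "n < m" "adj x y" "A n x < \<infinity>" "a y = a x + ennreal (w (Spread1 x y))"
        "a y \<le> b x" "a y \<le> a x + ennreal (w (Convert x))" using a_cause[OF less.prems] by metis
      moreover have "a x < \<infinity>" "a y < \<infinity>" using x(3) less.prems a_finite by blast+
      ultimately show ?thesis using spread1 less.IH[OF x(1,3)] by blast
    qed (use assms(1) in simp)
  qed
  then show "a y < \<infinity> \<Longrightarrow> Pa y" for y using a_finite by blast
  have "B m y < \<infinity> \<Longrightarrow> Pb y" for m y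
  proof (induction m arbitrary: y rule: less_induct)
    case (less m)
    have y: "b y < \<infinity>" using less.prems b_finite by blast
    show ?case
    proof (rule b_cause[OF less.prems])
      assume "b y = a y + ennreal (w (Convert y))" "A m y < \<infinity>"
      then show ?thesis using convert Pa y by blast
    next
      fix n x assume "n < m" "adj x y" "B n x < \<infinity>" "b y = b x + ennreal (w (Spread2 x y))"
      then show ?thesis using spread2 less.IH[of n x] y by blast
    qed
  qed
  then show "b y < \<infinity> \<Longrightarrow> Pb y" using b_finite by blast
qed

text \<open>For bounds that do not distinguish the types: conversion only delays, which
  \<open>mono\<close> covers, so spreading is all that has to be checked.\<close>

lemma time_propagate:
  assumes orig: "\<Phi> orig 0"
    and mono: "\<And>x t t'. \<Phi> x t \<Longrightarrow> t \<le> t' \<Longrightarrow> \<Phi> x t'"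
    and spread: "\<And>x y t r. adj x y \<Longrightarrow> \<Phi> x t \<Longrightarrow> min (a x) (b x) \<le> t \<Longrightarrow>
      r = w (Spread1 x y) \<or> r = w (Spread2 x y) \<Longrightarrow> \<Phi> y (t + ennreal r)"
  shows "a y < \<infinity> \<Longrightarrow> \<Phi> y (a y)" "b y < \<infinity> \<Longrightarrow> \<Phi> y (b y)"
proof -
  have s1: "\<Phi> y (a y)"
    if "adj x y" "a x < \<infinity>" "\<Phi> x (a x)" "a y = a x + ennreal (w (Spread1 x y))"
      "a y < \<infinity>" "a y \<le> b x" "a y \<le> a x + ennreal (w (Convert x))" for x y
    using spread[OF that(1,3)] that(4) by simp
  have c: "\<Phi> x (b x)" if "\<Phi> x (a x)" "b x = a x + ennreal (w (Convert x))" "b x < \<infinity>" for x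
    using mono[OF that(1)] that(2) by simp
  have s2: "\<Phi> y (b y)"
    if "adj x y" "\<Phi> x (b x)" "b y = b x + ennreal (w (Spread2 x y))" "b y < \<infinity>" for x y
    using spread[OF that(1,2)] that(3) by simp
  have o: "\<Phi> orig (a orig)" using orig by (simp add: a_orig)
  note induct = time_induct[where Pa = "\<lambda>y. \<Phi> y (a y)" and Pb = "\<lambda>y. \<Phi> y (b y)", OF o]
  show "a y < \<infinity> \<Longrightarrow> \<Phi> y (a y)"
    by (rule induct(1)) (erule (6) s1, erule (2) c, erule (3) s2)
  show "b y < \<infinity> \<Longrightarrow> \<Phi> y (b y)"
    by (rule induct(2)) (erule (6) s1, erule (2) c, erule (3) s2)
qed

text \<open>Besides the parent, which may be simultaneous, the hypothesis covers every site that
  turns type 2 strictly earlier. Going around an island involves such sites outside the ancestry of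
  \<open>y\<close>.\<close>

lemma time2_induct [consumes 1, case_names step]:
  assumes "b y < \<infinity>"
  assumes step: "\<And>y. b y < \<infinity> \<Longrightarrow> (\<And>x. b x < b y \<Longrightarrow> P x) \<Longrightarrow>
     a y < \<infinity> \<and> b y = a y + ennreal (w (Convert y)) \<or>
     (\<exists>x. adj x y \<and> b x < \<infinity> \<and> P x \<and> b y = b x + ennreal (w (Spread2 x y))) \<Longrightarrow> P y"
  shows "P y"
proof -
  have "B m y < \<infinity> \<Longrightarrow> P y" for m y
  proof (induction m arbitrary: y rule: less_induct)
    case (less m)
    have y: "b y < \<infinity>" using less.prems b_finite by blast
    have earlier: "P x" if "b x < b y" for x
    proof (rule b_birth[OF less.prems])
      fix n assume n: "n < m" "b y = s n"
      have "B n x < \<infinity>" using b_later[of n x] n(2) that by (cases "B n x = \<infinity>") (auto simp: less_top not_less_top_iff)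
      then show "P x" using less.IH[OF n(1)] by blast
    qed
    show ?case
    proof (rule b_cause[OF less.prems])
      assume "a y < \<infinity>" "b y = a y + ennreal (w (Convert y))"
      then show ?thesis using step[OF y earlier] by blast
    next
      fix n x assume "n < m" "adj x y" "B n x < \<infinity>" "b y = b x + ennreal (w (Spread2 x y))"
      then show ?thesis using step[OF y earlier] less.IH[of n x] b_finite by blast
    qed
  qed
  then show ?thesis using assms(1) b_finite by blast
qed

definition no_explosion :: bool where "no_explosion \<longleftrightarrow> (\<forall>T<\<infinity>. \<exists>n. T < s n)"

text \<open>The history just before the first event later than \<open>T\<close> records exactly what
  has happened up to time \<open>T\<close>.\<close>

lemma stage:
  assumes "no_explosion" "T < \<infinity>"
  obtains n where "T < s n" "\<And>y. A n y < \<infinity> \<longleftrightarrow> a y \<le> T" "\<And>y. B n y < \<infinity> \<longleftrightarrow> b y \<le> T"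
proof -
  define n where "n = (LEAST n. T < s n)"
  have n: "T < s n" unfolding n_def by (rule LeastI_ex) (use assms in \<open>auto simp: no_explosion_def\<close>)
  have before: "s k \<le> T" if "k < n" for k
    using not_less_Least[of k "\<lambda>n. T < s n"] that by (auto simp: n_def not_less)
  have "a y \<le> T" if "A n y < \<infinity>" for y
    by (rule a_birth[OF that]) (use before a_orig in auto)
  moreover have "A n y < \<infinity>" if "a y \<le> T" for y
    using a_later[of n y] that n by (cases "A n y = \<infinity>") (auto simp: less_top not_less_top_iff)
  moreover have "b y \<le> T" if "B n y < \<infinity>" for y
    by (rule b_birth[OF that]) (use before in auto)
  moreover have "B n y < \<infinity>" if "b y \<le> T" for y
    using b_later[of n y] that n by (cases "B n y = \<infinity>") (auto simp: less_top not_less_top_iff)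
  ultimately show ?thesis using that n by blast
qed

lemma finite_occupied_by:
  assumes "no_explosion" "T < \<infinity>"
  shows "finite {y. a y \<le> T \<or> b y \<le> T}"
proof (rule stage[OF assms])
  fix n assume "\<And>y. A n y < \<infinity> \<longleftrightarrow> a y \<le> T" "\<And>y. B n y < \<infinity> \<longleftrightarrow> b y \<le> T"
  then show ?thesis using finite_occupied[of n] by simp
qed

text \<open>At the stage for the time of the attempt, a conversion still pending would be due before
  the next event. \<open>no_explosion\<close> ensures that this stage exists; the same argument
  gives the two bounds that follow.\<close>

lemma convert_le:
  assumes "no_explosion" "a y < \<infinity>"
  shows "b y \<le> a y + ennreal (w (Convert y))"
proof (rule ccontr)
  let ?T = "a y + ennreal (w (Convert y))"
  assume less: "\<not> b y \<le> ?T"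
  have "?T < \<infinity>" using assms(2) by (rule add_less_infinity)
  from stage[OF assms(1) this] obtain n where n: "?T < s n" "\<And>y. A n y < \<infinity> \<longleftrightarrow> a y \<le> ?T"
    "\<And>y. B n y < \<infinity> \<longleftrightarrow> b y \<le> ?T" by metis
  have "A n y < \<infinity>" using n(2) by simp
  then have "A n y = a y" by (simp add: a_eq)
  moreover have "B n y = \<infinity>" using n(3)[of y] less by (simp add: less_top not_less_top_iff)
  ultimately have "D2 n y \<le> ?T" using D2_le_convert by metis
  then show False using n(1) s_le(2)[of n y] by simp
qed

lemma spread2_le:
  assumes "no_explosion" "b x < \<infinity>" "adj x y"
  shows "b y \<le> b x + ennreal (w (Spread2 x y))"
proof (rule ccontr)
  let ?T = "b x + ennreal (w (Spread2 x y))"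
  assume less: "\<not> b y \<le> ?T"
  have "?T < \<infinity>" using assms(2) by (rule add_less_infinity)
  from stage[OF assms(1) this] obtain n where n: "?T < s n" "\<And>y. A n y < \<infinity> \<longleftrightarrow> a y \<le> ?T"
    "\<And>y. B n y < \<infinity> \<longleftrightarrow> b y \<le> ?T" by metis
  have x: "B n x < \<infinity>" using n(3) by simp
  then have "B n x = b x" by (simp add: b_eq)
  moreover have "B n y = \<infinity>" using n(3)[of y] less by (simp add: less_top not_less_top_iff)
  ultimately have "D2 n y \<le> ?T" using D2_le_spread[OF _ assms(3) x] by metis
  then show False using n(1) s_le(2)[of n y] by simp
qed

lemma spread1_le:
  assumes "no_explosion" "a x + ennreal (w (Spread1 x y)) < b x" "adj x y"
  shows "min (a y) (b y) \<le> a x + ennreal (w (Spread1 x y))"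
proof (rule ccontr)
  let ?T = "a x + ennreal (w (Spread1 x y))"
  assume less: "\<not> min (a y) (b y) \<le> ?T"
  have "?T < \<infinity>" using assms(2) by (rule less_le_trans) simp
  from stage[OF assms(1) this] obtain n where n: "?T < s n" "\<And>y. A n y < \<infinity> \<longleftrightarrow> a y \<le> ?T"
    "\<And>y. B n y < \<infinity> \<longleftrightarrow> b y \<le> ?T" by metis
  have x: "A n x < \<infinity>" using n(2) by simp
  moreover have "A n x = a x" using x by (simp add: a_eq)
  moreover have "B n x = \<infinity>" using n(3)[of x] assms(2) by (metis infinity_ennreal_def not_le not_less_top_iff)
  moreover have "A n y = \<infinity>" "B n y = \<infinity>"
    using n(2,3)[of y] less by (auto simp: not_less_top_iff[symmetric] min_le_iff_disj)
  ultimately have "D1 n y \<le> ?T" using D1_le[of n y x] assms(3) by simp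
  then show False using n(1) s_le(1)[of n y] by simp
qed

text \<open>Each step up to time \<open>T\<close> records a new pair of site and type, and finitely
  many sites offer finitely many pairs.\<close>

lemma no_explosionI:
  assumes "\<And>T. T < \<infinity> \<Longrightarrow> finite {y. a y \<le> T \<or> b y \<le> T}"
  shows "no_explosion"
  unfolding no_explosion_def
proof (rule ccontr)
  assume "\<not> (\<forall>T<\<infinity>. \<exists>n. T < s n)"
  then obtain T where T: "T < \<infinity>" "\<And>n. s n \<le> T" by (auto simp: not_less)
  define F where "F = {y. a y \<le> T \<or> b y \<le> T} \<times> (UNIV :: bool set)"
  define X where "X n = {(y, c). if c then A n y < \<infinity> else B n y < \<infinity>}" for n
  have "finite F" using assms[OF T(1)] by (simp add: F_def)
  have "a y \<le> T" if "A n y < \<infinity>" for n y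
    using a_eq[OF that] A_le_s[OF that] T(2)[of n] by simp
  moreover have "b y \<le> T" if "B n y < \<infinity>" for n y
    by (rule b_birth[OF that]) (use T(2) in simp)
  ultimately have XF: "X n \<subseteq> F" for n
    by (auto simp: X_def F_def split: if_splits)
  have "X n \<subset> X (Suc n)" for n
  proof -
    have "X n \<subseteq> X (Suc n)"
      using A_stays[of n _ "Suc n"] B_stays[of n _ "Suc n"] by (auto simp: X_def split: if_splits)
    moreover have "s n < \<infinity>" using T by (meson le_less_trans)
    then obtain y where "A (Suc n) y \<noteq> A n y \<or> B (Suc n) y \<noteq> B n y" using s_attained by blast
    then have "(A n y = \<infinity> \<and> A (Suc n) y < \<infinity>) \<or> (B n y = \<infinity> \<and> B (Suc n) y < \<infinity>)"
      using A_Suc_cases[of n y] B_Suc_cases[of n y] by metis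
    then have "(y, True) \<in> X (Suc n) - X n \<or> (y, False) \<in> X (Suc n) - X n"
      by (auto simp: X_def)
    ultimately show ?thesis by blast
  qed
  then have "n \<le> card (X n)" for n
  proof (induction n)
    case (Suc n)
    have "card (X n) < card (X (Suc n))"
      using Suc.prems XF \<open>finite F\<close> by (intro psubset_card_mono) (meson finite_subset)
    then show ?case using Suc by simp
  qed simp
  moreover have "card (X n) \<le> card F" for n using XF \<open>finite F\<close> by (intro card_mono)
  ultimately have "Suc (card F) \<le> card F" by (metis order_trans)
  then show False by simp
qed

lemma type1_iff: "state_at adj orig w t x = Type1 \<longleftrightarrow> a x \<le> ennreal t \<and> ennreal t < b x"
  by (auto simp: state_at_def)

text \<open>A site of type 1 has a line of ancestors, each of type 1 until the birth of the next.\<close>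

lemma alive_before:
  assumes "a y < \<infinity>"
  shows "\<forall>t<a y. \<exists>x. a x \<le> t \<and> t < b x"
proof (rule time_induct(1)[where Pb = "\<lambda>_. True" and Pa = "\<lambda>y. \<forall>t<a y. \<exists>x. a x \<le> t \<and> t < b x"])
  fix x y assume IH: "\<forall>t<a x. \<exists>x. a x \<le> t \<and> t < b x" and le: "a y \<le> b x"
  show "\<forall>t<a y. \<exists>x. a x \<le> t \<and> t < b x"
  proof (intro allI impI)
    fix t assume t: "t < a y"
    show "\<exists>x. a x \<le> t \<and> t < b x"
    proof (cases "t < a x")
      case False
      then show ?thesis using t le by (intro exI[of _ x]) auto
    qed (use IH in blast)
  qed
qed (use assms in \<open>auto simp: a_orig\<close>)

text \<open>By \<open>alive_before\<close>, type 1 being present at an integer time after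
  \<open>t\<close> means that it was present at \<open>t\<close>. With countably many times the
  event becomes measurable.\<close>

lemma survives_iff:
  "type1_survives adj orig w \<longleftrightarrow> (\<forall>n::nat. \<exists>x. a x \<le> ennreal (real n) \<and> ennreal (real n) < b x)"
proof
  assume *: "\<forall>n::nat. \<exists>x. a x \<le> ennreal (real n) \<and> ennreal (real n) < b x"
  show "type1_survives adj orig w"
    unfolding type1_survives_def
  proof (intro allI impI)
    fix t :: real assume "0 \<le> t"
    obtain n :: nat where n: "t \<le> n" using real_arch_simple by blast
    obtain y where y: "a y \<le> ennreal n" "ennreal n < b y" using * by blast
    have "\<exists>x. a x \<le> ennreal t \<and> ennreal t < b x"
    proof (cases "a y \<le> ennreal t")
      case True
      then show ?thesis using y n by (intro exI[of _ y]) (auto intro: le_less_trans ennreal_leI)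
    next
      case False
      have "a y < \<infinity>" using y(1) by (rule le_less_trans) simp
      then show ?thesis using alive_before False by (auto simp: not_le)
    qed
    then show "{x. state_at adj orig w t x = Type1} \<noteq> {}" by (auto simp: type1_iff)
  qed
next
  assume "type1_survives adj orig w"
  then show "\<forall>n::nat. \<exists>x. a x \<le> ennreal (real n) \<and> ennreal (real n) < b x"
    unfolding type1_survives_def type1_iff by (metis (mono_tags, lifting) Collect_empty_eq of_nat_0_le_iff)
qed

text \<open>Only finitely many sites are occupied by time \<open>n\<close>, so some site turns type
  1 later, and a member of its ancestral line is of type 1 at time \<open>n\<close>.\<close>

lemma survives_if_infinite:
  assumes "no_explosion" "infinite {y. a y < \<infinity>}"
  shows "type1_survives adj orig w"
  unfolding survives_iff
proof
  fix n :: nat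
  have "finite {y. a y \<le> ennreal n}"
    using finite_occupied_by[OF assms(1), of "ennreal n"] by (auto elim: rev_finite_subset)
  then have "{y. a y < \<infinity>} - {y. a y \<le> ennreal n} \<noteq> {}" using assms(2) by (metis finite.emptyI finite_Diff2)
  then obtain y where "a y < \<infinity>" "ennreal n < a y" by (auto simp: not_le) (meson not_le)
  then show "\<exists>x. a x \<le> ennreal n \<and> ennreal n < b x" using alive_before by blast
qed

lemma dies_if_finite:
  assumes "no_explosion" "finite {y. a y < \<infinity>}"
  shows "\<not> type1_survives adj orig w"
proof -
  \<comment> \<open>The sum merely serves as a common upper bound for the finitely many times of
    turning type 2.\<close>
  define t where "t = (\<Sum>y | a y < \<infinity>. enn2real (b y))"
  have "b y \<le> ennreal t" if "a y < \<infinity>" for y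
  proof -
    have "b y < \<infinity>" using convert_le[OF assms(1) that] add_less_infinity[OF that] by (rule le_less_trans)
    moreover have "enn2real (b y) \<le> t"
      unfolding t_def using assms(2) that by (intro member_le_sum) auto
    ultimately show ?thesis by (metis ennreal_enn2real ennreal_leI infinity_ennreal_def)
  qed
  moreover have "a y < \<infinity>" if "a y \<le> ennreal t" for y using that by (rule le_less_trans) simp
  ultimately have "{x. state_at adj orig w t x = Type1} = {}"
    by (auto simp: type1_iff not_less)
  moreover have "0 \<le> t" by (simp add: t_def sum_nonneg)
  ultimately show ?thesis by (auto simp: type1_survives_def)
qed

end

subsection \<open>Islands of a set of bad sites\<close>

definition isolated :: "int \<Rightarrow> int \<Rightarrow> (int ^ 'd::finite) set \<Rightarrow> (int ^ 'd) set" where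
  "isolated r R S = {p \<in> S. \<forall>q\<in>S. dinf p q \<le> R \<longrightarrow> dinf p q \<le> r}"

primrec core :: "(nat \<Rightarrow> int) \<Rightarrow> (nat \<Rightarrow> int) \<Rightarrow> (int ^ 'd::finite) set \<Rightarrow> nat \<Rightarrow> (int ^ 'd) set" where
  "core al be S 0 = S"
| "core al be S (Suc k) =
     core al be S k - {x. \<exists>p\<in>isolated (al k) (be k) (core al be S k). dinf p x \<le> al k}"

text \<open>One representative per cluster: if \<open>2 * al k \<le> be k\<close>, being within
  \<open>al k\<close> is an equivalence relation on the isolated points, and the choice depends on
  \<open>p\<close> only through its class.\<close>

definition centres :: "(nat \<Rightarrow> int) \<Rightarrow> (nat \<Rightarrow> int) \<Rightarrow> (int ^ 'd::finite) set \<Rightarrow> nat \<Rightarrow> (int ^ 'd) set" where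
  "centres al be S k = (let I = isolated (al k) (be k) (core al be S k)
     in (\<lambda>p. SOME q. q \<in> I \<and> dinf p q \<le> al k) ` I)"

lemma centres_isolated:
  assumes "0 \<le> al k" "p \<in> isolated (al k) (be k) (core al be S k)"
  shows "\<exists>q\<in>centres al be S k. dinf p q \<le> al k \<and> q \<in> isolated (al k) (be k) (core al be S k)"
proof -
  let ?I = "isolated (al k) (be k) (core al be S k)"
  define q where "q = (SOME q. q \<in> ?I \<and> dinf p q \<le> al k)"
  have "q \<in> ?I \<and> dinf p q \<le> al k"
    unfolding q_def by (rule someI[of _ p]) (use assms in simp)
  moreover have "q \<in> centres al be S k" using assms(2) by (auto simp: centres_def Let_def q_def)
  ultimately show ?thesis by blast
qed

lemma centres_subset:
  assumes "0 \<le> al k"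
  shows "centres al be S k \<subseteq> isolated (al k) (be k) (core al be S k)"
proof
  let ?I = "isolated (al k) (be k) (core al be S k)"
  fix q assume "q \<in> centres al be S k"
  then obtain p where p: "p \<in> ?I" "q = (SOME q. q \<in> ?I \<and> dinf p q \<le> al k)"
    by (auto simp: centres_def Let_def)
  have "q \<in> ?I \<and> dinf p q \<le> al k" unfolding p(2) by (rule someI[of _ p]) (use p assms in simp)
  then show "q \<in> ?I" ..
qed

lemma centres_separated:
  assumes al: "0 \<le> al k" "2 * al k \<le> be k"
    and "p \<in> centres al be S k" "q \<in> centres al be S k" "p \<noteq> q"
  shows "be k < dinf p q"
proof (rule ccontr)
  assume near: "\<not> be k < dinf p q"
  let ?I = "isolated (al k) (be k) (core al be S k)"
  obtain p' where p': "p' \<in> ?I" "p = (SOME r. r \<in> ?I \<and> dinf p' r \<le> al k)"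
    using assms(3) by (auto simp: centres_def Let_def)
  obtain q' where q': "q' \<in> ?I" "q = (SOME r. r \<in> ?I \<and> dinf q' r \<le> al k)"
    using assms(4) by (auto simp: centres_def Let_def)
  have p: "p \<in> ?I \<and> dinf p' p \<le> al k" unfolding p'(2) by (rule someI[of _ p']) (use p' al in simp)
  have q: "q \<in> ?I \<and> dinf q' q \<le> al k" unfolding q'(2) by (rule someI[of _ q']) (use q' al in simp)
  have close: "dinf x y \<le> al k" if "x \<in> ?I" "y \<in> ?I" "dinf x y \<le> be k" for x y
    using that by (auto simp: isolated_def)
  have pq: "dinf p q \<le> al k" using near p q by (intro close) auto
  have "dinf p' q \<le> al k"
    using dinf_triangle[of p' q p] p pq al q p' by (intro close) auto
  then have "dinf p' q' \<le> al k"
    using dinf_triangle[of p' q' q] q al q' p' by (intro close) (auto simp: dinf_commute)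
  have "dinf p' r \<le> al k \<longleftrightarrow> dinf q' r \<le> al k" if "r \<in> ?I" for r
  proof
    assume "dinf p' r \<le> al k"
    then show "dinf q' r \<le> al k"
      using dinf_triangle[of q' r p'] \<open>dinf p' q' \<le> al k\<close> al that q' by (intro close) (auto simp: dinf_commute)
  next
    assume "dinf q' r \<le> al k"
    then show "dinf p' r \<le> al k"
      using dinf_triangle[of p' r q'] \<open>dinf p' q' \<le> al k\<close> al that p' by (intro close) auto
  qed
  then have "(\<lambda>r. r \<in> ?I \<and> dinf p' r \<le> al k) = (\<lambda>r. r \<in> ?I \<and> dinf q' r \<le> al k)" by auto
  then show False using assms(5) p'(2) q'(2) by simp
qed

lemma core_Suc_cover:
  assumes "0 \<le> al k" "2 * al k \<le> be k" "x \<in> core al be S k" "x \<notin> core al be S (Suc k)"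
  shows "\<exists>p\<in>centres al be S k. dinf p x \<le> al k"
proof -
  obtain q where q: "q \<in> isolated (al k) (be k) (core al be S k)" "dinf q x \<le> al k"
    using assms by auto
  obtain p where p: "p \<in> centres al be S k" "dinf q p \<le> al k"
      "p \<in> isolated (al k) (be k) (core al be S k)"
    using centres_isolated[OF assms(1) q(1)] by blast
  have "dinf p x \<le> be k" using dinf_triangle[of p x q] p(2) q(2) assms(2) by (simp add: dinf_commute)
  then have "dinf p x \<le> al k" using p(3) assms(3) by (auto simp: isolated_def)
  then show ?thesis using p(1) by blast
qed

lemma core_cover:
  assumes "\<And>k. 0 \<le> al k" "\<And>k. 2 * al k \<le> be k" "x \<in> S" "x \<notin> core al be S k"
  shows "\<exists>j<k. \<exists>p\<in>centres al be S j. dinf p x \<le> al j"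
  using assms(4)
proof (induction k)
  case (Suc k)
  show ?case
  proof (cases "x \<in> core al be S k")
    case True
    then show ?thesis using core_Suc_cover[OF assms(1,2) True Suc.prems] by blast
  next
    case False
    then show ?thesis using Suc.IH less_SucI by blast
  qed
qed (use assms(3) in simp)

text \<open>Either \<open>x\<close> is still in the core at round \<open>k\<close>, where isolation
  of \<open>p\<close> brings it within \<open>al k\<close>, or it was removed with an island of
  smaller rank.\<close>

lemma near_centre:
  assumes "\<And>k. 0 \<le> al k" "\<And>k. 2 * al k \<le> be k"
    and "p \<in> centres al be S k" "x \<in> S" "dinf p x \<le> be k"
  shows "dinf p x \<le> al k \<or> (\<exists>j<k. \<exists>q\<in>centres al be S j. dinf q x \<le> al j)"
proof (cases "x \<in> core al be S k")
  case True
  have "p \<in> isolated (al k) (be k) (core al be S k)" using centres_subset assms by blast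
  then show ?thesis using True assms(5) by (auto simp: isolated_def)
next
  case False
  then show ?thesis using core_cover[of al be, OF assms(1,2,4)] by blast
qed

text \<open>A site that survives \<open>k\<close> rounds of removing isolated clusters sees \<open>2 ^ k\<close> bad sites in a
  configuration from a fixed finite list.\<close>

primrec witness :: "(nat \<Rightarrow> int) \<Rightarrow> (nat \<Rightarrow> int) \<Rightarrow> nat \<Rightarrow> int ^ 'd::finite \<Rightarrow> (int ^ 'd) set set" where
  "witness al be 0 p = {{p}}"
| "witness al be (Suc k) p = (\<Union>q\<in>{q. al k < dinf p q \<and> dinf p q \<le> be k}.
     (\<lambda>(S, T). S \<union> T) ` (witness al be k p \<times> witness al be k q))"

text \<open>A point left after the next round is not isolated, so a second point of the core lies
  between \<open>al k\<close> and \<open>be k\<close> away. Both have witnesses of rank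
  \<open>k\<close>, and these are joined.\<close>

lemma core_witness:
  assumes "\<And>k. 0 \<le> al k" "p \<in> core al be S k"
  shows "\<exists>T\<in>witness al be k p. T \<subseteq> S"
  using assms(2)
proof (induction k arbitrary: p)
  case (Suc k)
  have p: "p \<in> core al be S k" using Suc.prems by simp
  have "p \<notin> isolated (al k) (be k) (core al be S k)" using Suc.prems assms(1)[of k] by force
  then obtain q where q: "q \<in> core al be S k" "al k < dinf p q" "dinf p q \<le> be k"
    using p by (auto simp: isolated_def not_le)
  obtain T where T: "T \<in> witness al be k p" "T \<subseteq> S" using Suc.IH[OF p] by blast
  obtain T' where T': "T' \<in> witness al be k q" "T' \<subseteq> S" using Suc.IH[OF q(1)] by blast
  have "(T, T') \<in> witness al be k p \<times> witness al be k q" using T T' by simp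
  then have "T \<union> T' \<in> (\<lambda>(S, T). S \<union> T) ` (witness al be k p \<times> witness al be k q)"
    by (rule rev_image_eqI) simp
  then have "T \<union> T' \<in> witness al be (Suc k) p" using q by auto
  then show ?case using T T' by blast
qed simp

subsection \<open>The competition in a sparse environment\<close>

context sparse
begin

lemma fat_le_be: "(rf + r2) * al k \<le> be k"
  by (rule le_be) (use Q' nd in \<open>simp add: rf_def r2_def\<close>)

text \<open>Up to the first exit from the ball of radius \<open>R\<close> only sites of
  \<open>U k\<close> give free steps, so \<open>reach_dist_half\<close> applies to the exit
  site.\<close>

lemma reach_leaves_ball:
  assumes "reach S ori m x" and S: "\<And>y. y \<in> S \<Longrightarrow> dinf ori y < R \<Longrightarrow> y \<in> U k" and "0 < R"
  shows "dinf ori x < R \<or> R \<le> 2 * int m + al k"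
proof -
  have "(dinf ori x < R \<and> reach (U k) ori m x) \<or> R \<le> 2 * int m + al k"
    using assms(1)
  proof (induction rule: reach.induct)
    case reach_refl
    then show ?case using assms(3) by (auto intro: reach.reach_refl)
  next
    case (reach_free m x y)
    then show ?case
    proof (elim disjE conjE)
      assume x: "dinf ori x < R" "reach (U k) ori m x"
      then have "reach (U k) ori m y" using S reach_free.hyps(2,3) by (blast intro: reach.reach_free)
      then show ?thesis using reach_dist_half[of k ori m y] by force
    qed simp
  next
    case (reach_paid m x y)
    then show ?case
    proof (elim disjE conjE)
      assume x: "dinf ori x < R" "reach (U k) ori m x"
      have "reach (U k) ori (Suc m) y" by (rule reach.reach_paid[OF x(2) reach_paid.hyps(2)])
      then show ?thesis using reach_dist_half[of k ori "Suc m" y] by force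
    qed simp
  qed
  then show ?thesis by blast
qed

text \<open>Steps paid on the way out of the island, with the balls of smaller rank free. The
  initial radius is \<open>al k + 1\<close> because a bad site may pass type 2 to a neighbour at
  once.\<close>

definition creach :: "nat \<Rightarrow> int ^ 'd \<Rightarrow> int ^ 'd \<Rightarrow> nat \<Rightarrow> bool" where
  "creach k p x n \<longleftrightarrow> (\<exists>y. dinf p y \<le> al k + 1 \<and> reach (U k) y n x)"

definition cost :: "nat \<Rightarrow> int ^ 'd \<Rightarrow> int ^ 'd \<Rightarrow> nat" where
  "cost k p x = (LEAST n. creach k p x n)"

lemma creach_p: "\<exists>n. creach k p x n \<and> int n \<le> d1 p x"
  using reach_d1[of "U k" p x] scales_pos(1)[of k] by (auto simp: creach_def intro!: exI[of _ p])

lemma creach_cost: "creach k p x (cost k p x)"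
  unfolding cost_def using creach_p by (metis LeastI)

lemma cost_le: "creach k p x n \<Longrightarrow> cost k p x \<le> n"
  unfolding cost_def by (rule Least_le)

lemma cost_le_dinf: "int (cost k p x) \<le> nd * dinf p x"
  using creach_p[of k p x] cost_le[of k p x] d1_le[of p x] by force

lemma dinf_le_cost: "dinf p x \<le> 2 * int (cost k p x) + 2 * al k + 1"
proof -
  obtain y where y: "dinf p y \<le> al k + 1" "reach (U k) y (cost k p x) x"
    using creach_cost[of k p x] by (auto simp: creach_def)
  then show ?thesis using reach_dist_half[OF y(2)] dinf_triangle[of p x y] by simp
qed

lemma cost_near: "dinf p x \<le> al k + 1 \<Longrightarrow> cost k p x = 0"
  using cost_le[of k p x 0] by (auto simp: creach_def intro: reach_refl)

lemma cost_free:
  assumes "lattice_adj x y" "x \<in> U k"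
  shows "cost k p y \<le> cost k p x"
proof -
  obtain u where u: "dinf p u \<le> al k + 1" "reach (U k) u (cost k p x) x"
    using creach_cost[of k p x] by (auto simp: creach_def)
  have "reach (U k) u (cost k p x) y" by (rule reach_free[OF u(2) assms])
  then show ?thesis using u(1) by (auto simp: creach_def intro!: cost_le)
qed

lemma cost_step:
  assumes "lattice_adj x y"
  shows "cost k p y \<le> Suc (cost k p x)"
proof -
  obtain u where u: "dinf p u \<le> al k + 1" "reach (U k) u (cost k p x) x"
    using creach_cost[of k p x] by (auto simp: creach_def)
  have "reach (U k) u (Suc (cost k p x)) y" by (rule reach_paid[OF u(2) assms])
  then show ?thesis using u(1) by (auto simp: creach_def intro!: cost_le)
qed

text \<open>All moves within a ball of smaller rank are free. So a territory contains such a ball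
  entirely or misses it, and a cone reaches all its points at the same time.\<close>

lemma cost_ball:
  assumes "q \<in> P j" "j < k" "dinf q x \<le> fat j" "dinf q y \<le> fat j"
  shows "cost k p x = cost k p y"
proof -
  have le: "cost k p y \<le> cost k p x" if "dinf q x \<le> fat j" "dinf q y \<le> fat j" for x y
  proof -
    obtain u where u: "dinf p u \<le> al k + 1" "reach (U k) u (cost k p x) x"
      using creach_cost[of k p x] by (auto simp: creach_def)
    have "reach (U k) u (cost k p x) y"
      by (rule reach_in_ball[OF that ball_subset_U[OF assms(1,2)] u(2)])
    then show ?thesis using u(1) by (auto simp: creach_def intro!: cost_le)
  qed
  show ?thesis using le assms(3,4) by (intro antisym) auto
qed

text \<open>As the cost is at most \<open>nd\<close> times the distance, the factor
  \<open>10 * nd\<close> puts outside sites at distance at least \<open>10 * al k\<close>.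
  Conversely the radius is at most \<open>r2 * al k\<close>, since contraction loses little more
  than a factor 2.\<close>

definition territory :: "nat \<Rightarrow> int ^ 'd \<Rightarrow> int ^ 'd \<Rightarrow> bool" where
  "territory k p x \<longleftrightarrow> int (cost k p x) < 10 * nd * al k"

lemma territory_near: "cost k p x = 0 \<Longrightarrow> territory k p x"
  using scales_pos(1)[of k] nd by (simp add: territory_def)

lemma territory_dinf:
  assumes "territory k p x"
  shows "dinf p x \<le> r2 * al k"
proof -
  have "dinf p x \<le> 2 * int (cost k p x) + 2 * al k + 1" by (rule dinf_le_cost)
  also have "\<dots> \<le> 20 * (nd * al k) + 2 * al k" using assms by (simp add: territory_def)
  also have "\<dots> \<le> r2 * al k" using scales_pos(1)[of k] by (simp add: r2_def algebra_simps)
  finally show ?thesis .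
qed

lemma not_territory_dinf:
  assumes "\<not> territory k p x"
  shows "10 * al k \<le> dinf p x"
proof -
  have "nd * (10 * al k) \<le> nd * dinf p x"
    using assms cost_le_dinf[of k p x] by (simp add: territory_def)
  then show ?thesis using nd by simp
qed

text \<open>About \<open>2 * al N\<close> away from \<open>ori\<close> there is a site clear of all
  ranks below \<open>N\<close>; territories of rank \<open>N\<close> and above are too far from
  \<open>ori\<close> to contain it. \<open>N\<close> is arbitrary.\<close>

lemma infinite_outside:
  assumes far: "\<And>k p. p \<in> P k \<Longrightarrow> (rf + 4) * al k < dinf p ori"
  shows "infinite {x. \<forall>k. \<forall>p\<in>P k. \<not> territory k p x}"
proof
  let ?X = "{x. \<forall>k. \<forall>p\<in>P k. \<not> territory k p x}"
  assume fin: "finite ?X"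
  have ex: "\<exists>x\<in>?X. int N \<le> dinf ori x" for N
  proof -
    define c where "c = (\<chi> i. ori $ i + 2 * al N)"
    have al: "0 < al N" by (rule scales_pos)
    have c: "dinf ori c = 2 * al N"
      using al by (intro antisym) (auto simp: c_def dinf_le_iff dinf_ge_iff)
    obtain x where x: "dinf c x \<le> ke * prev N" "clear N x" using clear_near by blast
    have "ke * prev N \<le> al N" using ke_prev_le[of N] le_al[of 1 N] Q_pos by simp
    then have ox: "al N \<le> dinf ori x" "dinf ori x \<le> 3 * al N"
      using x(1) c dinf_triangle[of ori x c] dinf_triangle[of ori c x] by (auto simp: dinf_commute)
    have "\<not> territory k p x" if p: "p \<in> P k" for k p
    proof
      assume "territory k p x"
      then have le: "dinf p x \<le> r2 * al k" by (rule territory_dinf)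
      have alk: "0 < al k" by (rule scales_pos)
      show False
      proof (cases "k < N")
        case True
        then have "fat k \<le> dinf p x" using x(2) p by (auto simp: clear_def)
        then have "rf * al k \<le> r2 * al k" using le by (simp add: fat_def)
        then show False using alk by (simp add: rf_def r2_def)
      next
        case False
        then have "al N \<le> al k" by (intro al_mono) simp
        then have "(rf + 4) * al k < r2 * al k + 3 * al k"
          using far[OF p] le ox dinf_triangle[of p ori x] by (simp add: dinf_commute)
        then show False using alk by (simp add: rf_def r2_def algebra_simps)
      qed
    qed
    then show ?thesis using ox(1) ge_Suc_al[of N] by (intro bexI[of _ x]) auto
  qed
  define m where "m = Max (dinf ori ` ?X)"
  obtain x where x: "x \<in> ?X" "int (nat m + 1) \<le> dinf ori x" using ex by blast
  have "dinf ori x \<le> m" unfolding m_def using fin x(1) by (intro Max_ge) auto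
  then show False using x(2) by linarith
qed

end

lemma finite_summand: "x + y \<le> z \<Longrightarrow> z < \<infinity> \<Longrightarrow> x < (\<infinity> :: ennreal)"
  by (rule le_less_trans[OF order_trans[of x "x + y"]]) auto

lemma add_ennreal_less: "x < \<infinity> \<Longrightarrow> r < m \<Longrightarrow> 0 < m \<Longrightarrow> x + ennreal r < x + ennreal m"
  by (auto simp: ennreal_add_left_cancel_less less_top ennreal_lessI)

text \<open>\<open>M * (lap + 1) \<le> K\<close> decides the race: type 1, at most \<open>M\<close>
  per step, completes \<open>lap * al k\<close> steps and one more period \<open>M\<close> before
  type 2, at least \<open>K\<close> per paid step, advances by \<open>al k\<close>. By
  \<open>far\<close> the origin is outside the ring of every island, so no island is entered except
  through its ring.\<close>

locale sparse_evolution = sparse al be Q P + evolution lattice_adj ori w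
  for al be Q and P :: "nat \<Rightarrow> (int ^ 'd::finite) set"
    and ori :: "int ^ 'd" and w :: "(int ^ 'd) clock \<Rightarrow> real" +
  fixes M K :: real and bad :: "(int ^ 'd) set"
  assumes M: "0 < M" and K: "M * (lap + 1) \<le> K"
    and spread1: "x \<notin> bad \<Longrightarrow> lattice_adj x y \<Longrightarrow> w (Spread1 x y) < M"
    and spread2: "x \<notin> bad \<Longrightarrow> lattice_adj x y \<Longrightarrow> K < w (Spread2 x y)"
    and convert: "x \<notin> bad \<Longrightarrow> K < w (Convert x)"
    and bad_near: "p \<in> P k \<Longrightarrow> x \<in> bad \<Longrightarrow> dinf p x \<le> be k \<Longrightarrow>
      dinf p x \<le> al k \<or> (\<exists>j<k. \<exists>q\<in>P j. dinf q x \<le> al j)"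
    and bad_cover: "x \<in> bad \<Longrightarrow> \<exists>k. \<exists>p\<in>P k. dinf p x \<le> al k"
    and far: "p \<in> P k \<Longrightarrow> (rf + 4) * al k < dinf p ori"
    and no_explosion: no_explosion
begin

definition tau :: "int ^ 'd \<Rightarrow> ennreal" where "tau x = min (a x) (b x)"

definition start :: "nat \<Rightarrow> int ^ 'd \<Rightarrow> ennreal" where
  "start k p = (INF y\<in>{y. dinf p y \<le> al k}. tau y)"

text \<open>A site that is never of type 1 has \<open>a x = \<infinity>\<close>, so it is tainted as
  soon as \<open>b x\<close> is finite.\<close>

definition tainted :: "int ^ 'd \<Rightarrow> bool" where "tainted x \<longleftrightarrow> b x < a x + ennreal M"

definition swept :: "nat \<Rightarrow> int ^ 'd \<Rightarrow> int ^ 'd \<Rightarrow> bool" where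
  "swept k p x \<longleftrightarrow> p \<in> P k \<and> territory k p x \<and> start k p + ennreal (K * cost k p x) \<le> b x"

lemma lap: "1 \<le> lap"
  using nd by (simp add: lap_def r2_def)

lemma M_le_K: "M \<le> K"
proof -
  have "M * 1 \<le> M * (lap + 1)" using M lap by (intro mult_left_mono) auto
  then show ?thesis using K by simp
qed

lemma start_le: "dinf p y \<le> al k \<Longrightarrow> start k p \<le> tau y"
  unfolding start_def by (auto intro: INF_lower)

lemma sweptI0:
  assumes "p \<in> P k" "dinf p y \<le> al k" "tau y \<le> b x" "cost k p x = 0"
  shows "swept k p x"
  using assms start_le[OF assms(2)] territory_near[OF assms(4)] by (auto simp: swept_def)

text \<open>Follow the ancestors of the first occupied site of the island outwards: the last of them
  that is not hidden in a ball around a smaller island lies in the ring.\<close>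

lemma ancestor_in_ring:
  assumes p: "p \<in> P k" and fin: "start k p < \<infinity>"
  shows "\<exists>z. clear k z \<and> 10 * al k \<le> dinf p z \<and> dinf p z \<le> (r2 + 4) * al k \<and> tau z \<le> start k p"
proof -
  define R where "R = (r2 + 4) * al k"
  have al: "0 < al k" by (rule scales_pos)
  have R: "40 * al k \<le> R" using al nd by (auto simp: R_def r2_def intro!: mult_right_mono)
  \<comment> \<open>Either an early site \<open>z\<close> in the ring has been found, or
    \<open>y\<close> is linked by free steps to a site at distance at least \<open>R\<close>: the
    line is still outside, or hidden in smaller balls.\<close>
  define Anc where "Anc y T \<longleftrightarrow> (\<exists>z. clear k z \<and> 10 * al k \<le> dinf p z \<and> dinf p z \<le> R \<and> tau z \<le> T) \<or>
     (\<exists>u. R \<le> dinf p u \<and> reach (U k) u 0 y)" for y T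
  have mono: "Anc y T'" if "Anc y T" "T \<le> T'" for y T T'
    using that unfolding Anc_def by (auto intro: order_trans)
  have step: "Anc y T'" if x: "Anc x T" "lattice_adj x y" "tau x \<le> T" "T \<le> T'" for x y T T'
  proof (rule mono[OF _ x(4)])
    from x(1) consider "\<exists>z. clear k z \<and> 10 * al k \<le> dinf p z \<and> dinf p z \<le> R \<and> tau z \<le> T"
      | u where "R \<le> dinf p u" "reach (U k) u 0 x" by (auto simp: Anc_def)
    then show "Anc y T"
    proof cases
      case 2
      show ?thesis
      proof (cases "x \<in> U k")
        case True
        then have "reach (U k) u 0 y" by (rule reach_free[OF 2(2) x(2)])
        then show ?thesis using 2(1) by (auto simp: Anc_def)
      next
        case False
        show ?thesis
        proof (cases "dinf p x \<le> R")
          case True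
          have "R - al k \<le> dinf p x"
            using 2(1) reach_dist_half[OF 2(2)] dinf_triangle[of p u x] by (simp add: dinf_commute)
          then have "10 * al k \<le> dinf p x" using R al by linarith
          then show ?thesis using True x(3) clear_if_notin_U[OF False] by (auto simp: Anc_def)
        next
          case False
          then have "R \<le> dinf p y"
            using dinf_triangle[of p x y] lattice_adj_dinf[OF x(2)] by (simp add: dinf_commute)
          then show ?thesis by (auto simp: Anc_def intro: reach_refl)
        qed
      qed
    qed (simp add: Anc_def)
  qed
  have orig: "Anc ori 0"
  proof -
    have "R \<le> dinf p ori" using far[OF p] al by (simp add: R_def rf_def r2_def algebra_simps)
    then show ?thesis by (auto simp: Anc_def intro: reach_refl)
  qed
  have spread: "Anc y (t + ennreal r)"
    if "lattice_adj x y" "Anc x t" "min (a x) (b x) \<le> t" for x y t r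
    using step[OF that(2,1)] that(3) by (simp add: tau_def)
  have all: "a y < \<infinity> \<Longrightarrow> Anc y (a y)" "b y < \<infinity> \<Longrightarrow> Anc y (b y)" for y
    by (erule time_propagate[of Anc, OF orig, rotated -1]; (erule (1) mono | erule (2) spread))+
  obtain y where y: "dinf p y \<le> al k" "tau y = start k p"
    using INF_attained_finite[OF card_dinf_ball(1)[of "al k" p], of tau] fin al
    by (auto simp: start_def)
  have "Anc y (tau y)"
    using all[of y] fin y(2) by (auto simp: tau_def min_def split: if_splits)
  moreover have False if "R \<le> dinf p u" "reach (U k) u 0 y" for u
    using that(1) reach_dist_half[OF that(2)] dinf_triangle[of p u y] y(1) R al
    by (simp add: dinf_commute)
  ultimately show ?thesis unfolding Anc_def y(2) R_def by blast
qed

text \<open>When the type 2 cone of an island reaches the rim of its territory, a path around the island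
  has already brought type 1 there.\<close>

lemma exit_territory:
  assumes p: "p \<in> P k" and z: "territory k p z" "z \<notin> U k" "lattice_adj z x"
    and bx: "start k p + ennreal (K * cost k p z) \<le> b x" "b x < \<infinity>"
    and x: "\<not> territory k p x" "tainted x"
    and IH: "\<And>v. b v < b x \<Longrightarrow> tainted v \<Longrightarrow> \<exists>k p. swept k p v"
  shows "\<exists>k p. swept k p x"
proof (rule ccontr)
  assume not_swept: "\<not> ?thesis"
  define t where "t = start k p"
  define L where "L = real_of_int (lap * al k)"
  have al: "0 < al k" by (rule scales_pos)
  have L: "0 \<le> L" using al lap by (simp add: L_def)
  have t: "t < \<infinity>" unfolding t_def
    using bx by (rule finite_summand)
  have M_K: "M * (L + 1) \<le> K * al k"
  proof -
    have "real_of_int (lap * al k + 1) \<le> real_of_int ((lap + 1) * al k)"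
      unfolding of_int_le_iff using al by (simp add: algebra_simps)
    then have "M * (L + 1) \<le> M * real_of_int ((lap + 1) * al k)"
      using M by (intro mult_left_mono) (auto simp: L_def)
    also have "\<dots> = M * (lap + 1) * al k" by simp
    also have "\<dots> \<le> K * al k" using K al by (intro mult_right_mono) auto
    finally show ?thesis .
  qed
  \<comment> \<open>The race: once the cone has been charged for \<open>al k\<close> paid steps,
    type 1 has had time for \<open>L\<close> steps and a further period \<open>M\<close>.\<close>
  have late: "t + ennreal (M * (L + 1)) \<le> t + ennreal (K * c)" if "al k \<le> int c" for c
  proof -
    have "K * real_of_int (al k) \<le> K * real_of_int (int c)"
      using that M M_le_K by (intro mult_left_mono) (auto simp: of_int_le_iff)
    then have "M * (L + 1) \<le> K * real c" using M_K by simp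
    then show ?thesis by (intro add_left_mono ennreal_leI)
  qed
  have "10 * nd * al k \<le> int (cost k p x)" using x(1) by (simp add: territory_def)
  moreover have "2 * al k \<le> nd * al k" using nd al by (intro mult_right_mono) auto
  ultimately have "al k \<le> int (cost k p z)" using cost_step[OF z(3), of k p] al by linarith
  then have bxL: "t + ennreal (M * (L + 1)) \<le> b x"
    using order_trans[OF late bx(1)[folded t_def]] by blast
  have fat: "fat k + r2 * al k \<le> be k" using fat_le_be[of k] by (simp add: fat_def algebra_simps)
  have r2: "0 < r2 * al k" using al nd by (simp add: r2_def)
  have clear_x: "clear k x"
    unfolding clear_def
  proof (intro allI impI ballI)
    fix j q assume q: "j < k" "q \<in> P j"
    show "fat j \<le> dinf q x"
    proof (rule ccontr)
      assume "\<not> fat j \<le> dinf q x"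
      then have "dinf q z \<le> fat j"
        using dinf_triangle[of q z x] lattice_adj_dinf[OF z(3)] by (simp add: dinf_commute)
      then show False using ball_subset_U[OF q(2,1)] z(2) by blast
    qed
  qed
  have x10: "10 * al k \<le> dinf p x" by (rule not_territory_dinf[OF x(1)])
  have xR: "dinf p x \<le> (r2 + 4) * al k"
    using territory_dinf[OF z(1)] dinf_triangle[of p x z] lattice_adj_dinf[OF z(3)] al
    by (simp add: algebra_simps)
  have x_fat: "dinf p x \<le> fat k" using xR al by (simp add: fat_def rf_def r2_def algebra_simps)
  obtain z0 where z0: "clear k z0" "10 * al k \<le> dinf p z0" "dinf p z0 \<le> (r2 + 4) * al k"
    "tau z0 \<le> t" using ancestor_in_ring[OF p] t by (auto simp: t_def)
  define S where "S = - V k \<inter> {v. 6 * al k < dinf p v \<and> dinf p v \<le> fat k}"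
  have path: "conn S z0 L x"
    unfolding S_def L_def using z0 clear_x x10 xR by (intro conn_around_island) auto
  have good: "v \<notin> bad" if v: "v \<in> S" for v
  proof
    assume "v \<in> bad"
    then have "dinf p v \<le> al k \<or> (\<exists>j<k. \<exists>q\<in>P j. dinf q v \<le> al j)"
      using v fat r2 by (intro bad_near[OF p]) (auto simp: S_def)
    then obtain j q where q: "j < k" "q \<in> P j" "dinf q v \<le> al j"
      using v al by (auto simp: S_def)
    moreover have "al j \<le> r2 * al j" using scales_pos(1)[of j] nd by (simp add: r2_def)
    ultimately have "v \<in> V k" unfolding V_def by force
    then show False using v by (simp add: S_def)
  qed
  \<comment> \<open>A tainted \<open>v\<close> would lie in some cone. Smaller islands are excluded
    by \<open>V k\<close>, the island itself by the race, others of rank \<open>k\<close> by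
    separation. A larger island gives all of the ball of radius \<open>fat k\<close> around
    \<open>p\<close> the same cost, so it would sweep \<open>x\<close> too, against
    \<open>not_swept\<close>.\<close>
  have safe: "\<not> tainted v" if v: "v \<in> S" "b v < t + ennreal (M * (L + 1))" for v
  proof
    assume "tainted v"
    moreover have bvx: "b v < b x" using v(2) bxL by (rule less_le_trans)
    ultimately obtain k' p' where s: "swept k' p' v" using IH by blast
    then have p': "p' \<in> P k'" "territory k' p' v"
      "start k' p' + ennreal (K * cost k' p' v) \<le> b v" by (auto simp: swept_def)
    have near: "dinf p' v \<le> r2 * al k'" by (rule territory_dinf[OF p'(2)])
    consider "k' < k" | "k' = k" "p' = p" | "k' = k" "p' \<noteq> p" | "k < k'" by linarith
    then show False
    proof cases
      case 1
      then have "v \<in> V k" using near p'(1) by (auto simp: V_def)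
      then show False using v(1) by (simp add: S_def)
    next
      case 2
      have "al k \<le> int (cost k p v)" using dinf_le_cost[of p v k] v(1) al by (simp add: S_def)
      from order_trans[OF late[OF this]] have "t + ennreal (M * (L + 1)) \<le> b v"
        using p'(3) 2 by (simp add: t_def)
      then show False using v(2) by simp
    next
      case 3
      then have "be k < dinf p p'" using sep p p'(1) by blast
      then show False using near 3 v(1) fat dinf_triangle[of p p' v] by (simp add: S_def dinf_commute)
    next
      case 4
      have "cost k' p' v = cost k' p' x"
        using v(1) x_fat by (intro cost_ball[OF p 4]) (auto simp: S_def)
      then have "swept k' p' x" using p' bvx by (auto simp: swept_def territory_def)
      then show False using not_swept by blast
    qed
  qed
  \<comment> \<open>Type 1 advances along the path at \<open>M\<close> per step: an untainted site
    holds type 1 for \<open>M\<close>, longer than its clock. If \<open>b v\<close> lies beyond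
    \<open>t + ennreal (M * (L + 1))\<close>, that alone leaves enough time.\<close>
  have "r \<le> L \<longrightarrow> tau v \<le> t + ennreal (M * r)" if "conn S z0 r v" for r v
    using that
  proof (induction rule: conn.induct)
    case conn_refl
    then show ?case using z0(4) by simp
  next
    case (conn_weaken r v r')
    have "t + ennreal (M * r) \<le> t + ennreal (M * r')"
      using M conn_weaken.hyps(2) by (intro add_left_mono ennreal_leI) simp
    then show ?case using conn_weaken.IH conn_weaken.hyps(2)
      by (metis order_trans)
  next
    case (conn_step r v u)
    show ?case
    proof
      assume r: "r + 1 \<le> L"
      have r0: "0 \<le> r" using conn_step.hyps(1) by (rule conn_nonneg)
      have v: "v \<in> S" using conn_step.hyps(1) by (rule conn_end)
      define T where "T = t + ennreal (M * r)"
      have tau: "tau v \<le> T" using conn_step.IH r by (simp add: T_def)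
      have Mr: "M * r + M \<le> M * (L + 1)"
        using r M mult_left_mono[of "r + 1" "L + 1" M] by (simp add: distrib_left)
      have TM: "T + ennreal M = t + ennreal (M * r + M)"
        using M r0 by (simp add: T_def add.assoc)
      also have "\<dots> \<le> t + ennreal (M * (L + 1))" using Mr by (intro add_left_mono ennreal_leI)
      finally have TL: "T + ennreal M \<le> t + ennreal (M * (L + 1))" .
      have "T < T + ennreal M"
        using add_ennreal_less[of T 0 M] add_less_infinity[OF t] M by (simp add: T_def)
      then have less: "T < t + ennreal (M * (L + 1))" using TL by (rule less_le_trans)
      have av: "a v \<le> T"
      proof (cases "a v \<le> b v")
        case False
        then have "b v \<le> T" using tau by (simp add: tau_def min_def)
        then have "\<not> tainted v" by (intro safe[OF v] le_less_trans[OF _ less])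
        then have "a v \<le> b v" unfolding tainted_def not_less by (rule order_trans[rotated]) simp
        then show ?thesis using False by simp
      qed (use tau in \<open>simp add: tau_def min_def\<close>)
      have avM: "a v + ennreal M \<le> b v"
      proof (cases "b v < t + ennreal (M * (L + 1))")
        case True
        then show ?thesis using safe[OF v] by (simp add: tainted_def not_less)
      next
        case False
        have "a v + ennreal M \<le> T + ennreal M" using av by (rule add_right_mono)
        also note TL
        also have "t + ennreal (M * (L + 1)) \<le> b v" using False by (simp add: not_less)
        finally show ?thesis .
      qed
      have w: "w (Spread1 v u) < M" using spread1 good[OF v] conn_step.hyps(2) by blast
      have a_fin: "a v < \<infinity>" using av add_less_infinity[OF t] unfolding T_def by (rule le_less_trans)
      have "a v + ennreal (w (Spread1 v u)) < a v + ennreal M"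
        using a_fin w M by (rule add_ennreal_less)
      then have "tau u \<le> a v + ennreal (w (Spread1 v u))"
        unfolding tau_def by (intro spread1_le[OF no_explosion _ conn_step.hyps(2)] less_le_trans[OF _ avM])
      also have "\<dots> \<le> T + ennreal M" using av w by (intro add_mono ennreal_leI) auto
      finally show "tau u \<le> t + ennreal (M * (r + 1))" unfolding TM by (simp add: distrib_left)
    qed
  qed
  from this[OF path] have tau: "tau x \<le> t + ennreal (M * L)" by simp
  have TM: "t + ennreal (M * L) + ennreal M = t + ennreal (M * (L + 1))"
    using M L by (simp add: distrib_left add.assoc)
  have "t + ennreal (M * L) < t + ennreal (M * L) + ennreal M"
    using add_ennreal_less[of "t + ennreal (M * L)" 0 M] add_less_infinity[OF t] M by simp
  then have "t + ennreal (M * L) < b x" unfolding TM using bxL by (rule less_le_trans)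
  then have "a x \<le> t + ennreal (M * L)" using tau by (auto simp: tau_def min_def split: if_splits)
  then have "a x + ennreal M \<le> t + ennreal (M * (L + 1))" unfolding TM[symmetric] by (rule add_right_mono)
  also note bxL
  finally show False using x(2) by (simp add: tainted_def not_less[symmetric])
qed

text \<open>Conversion of a good site comes too late to taint it, so a tainted good site
  \<open>x\<close> got type 2 from some \<open>z\<close>. If \<open>z\<close> is bad,
  \<open>x\<close> has cost 0. If \<open>z\<close> is good and untainted, \<open>x\<close> was of
  type 1 before \<open>z\<close> turned type 2, at least \<open>K\<close> before \<open>b x\<close>.
  If \<open>z\<close> is good and tainted, its cone is carried on, free inside \<open>U k\<close>
  and delayed by \<open>K\<close> elsewhere.\<close>

lemma tainted_swept:
  assumes "b x < \<infinity>" "tainted x"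
  shows "\<exists>k p. swept k p x"
proof -
  have "tainted x \<longrightarrow> (\<exists>k p. swept k p x)"
    using assms(1)
  proof (induction x rule: time2_induct)
    case (step x)
    note fin = step(1) and IH = step(2) and cause = step(3)
    show ?case
    proof
      assume taint: "tainted x"
      show "\<exists>k p. swept k p x"
      proof (cases "x \<in> bad")
        case True
        then obtain k p where p: "p \<in> P k" "dinf p x \<le> al k" using bad_cover by blast
        have "cost k p x = 0" using p by (intro cost_near) simp
        then have "swept k p x" by (intro sweptI0[OF p]) (auto simp: tau_def)
        then show ?thesis by blast
      next
        case good: False
        from cause show ?thesis
        proof (elim disjE conjE exE)
          assume "b x = a x + ennreal (w (Convert x))"
          moreover have "ennreal M \<le> ennreal (w (Convert x))"
            using convert[OF good] M_le_K by (intro ennreal_leI) simp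
          ultimately have "a x + ennreal M \<le> b x" by (simp add: add_left_mono)
          then show ?thesis using taint by (simp add: tainted_def not_less[symmetric])
        next
          fix z assume z: "lattice_adj z x" "b z < \<infinity>" "tainted z \<longrightarrow> (\<exists>k p. swept k p z)"
            "b x = b z + ennreal (w (Spread2 z x))"
          have bzx: "b z \<le> b x" using z(4) by simp
          have z_bad: ?thesis if p: "p \<in> P k" "dinf p z \<le> al k" for k p
          proof -
            have "dinf p x \<le> al k + 1"
              using p(2) dinf_triangle[of p x z] lattice_adj_dinf[OF z(1)] by simp
            then have "swept k p x"
              using bzx by (intro sweptI0[OF p] cost_near) (auto simp: tau_def min_le_iff_disj)
            then show ?thesis by blast
          qed
          have z_good: "b z + ennreal K \<le> b x" if "z \<notin> bad"
            unfolding z(4) using spread2[OF that z(1)] by (intro add_left_mono ennreal_leI) simp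
          show ?thesis
          proof (cases "z \<in> bad")
            case True
            then show ?thesis using bad_cover z_bad by blast
          next
            case zg: False
            show ?thesis
            proof (cases "tainted z")
              case False
              then have az: "a z + ennreal M \<le> b z" by (simp add: tainted_def not_less)
              have "a z < \<infinity>" using az z(2) by (rule finite_summand)
              moreover have S1: "w (Spread1 z x) < M" using spread1 zg z(1) by blast
              ultimately have lt: "a z + ennreal (w (Spread1 z x)) < a z + ennreal M"
                using M by (intro add_ennreal_less)
              then have lt': "a z + ennreal (w (Spread1 z x)) < b z" using az by (rule less_le_trans)
              have "min (a x) (b x) \<le> a z + ennreal (w (Spread1 z x))"
                by (rule spread1_le[OF no_explosion lt' z(1)])
              then have "a x \<le> a z + ennreal (w (Spread1 z x))"
                using lt' bzx by (auto simp: min_def not_le split: if_splits)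
              also have "\<dots> \<le> b z" using lt' by simp
              finally have "a x + ennreal M \<le> b z + ennreal K"
                using M_le_K by (intro add_mono ennreal_leI)
              then have "a x + ennreal M \<le> b x" using z_good[OF zg] by (rule order_trans)
              then show ?thesis using taint by (simp add: tainted_def not_less[symmetric])
            next
              case True
              then obtain k p where s: "swept k p z" using z(3) by blast
              then have p: "p \<in> P k" "territory k p z"
                "start k p + ennreal (K * cost k p z) \<le> b z" by (auto simp: swept_def)
              have K0: "0 \<le> K" using M M_le_K by simp
              show ?thesis
              proof (cases "z \<in> U k")
                case True
                have c: "cost k p x \<le> cost k p z" by (rule cost_free[OF z(1) True])
                then have "K * real (cost k p x) \<le> K * real (cost k p z)"
                  using K0 by (intro mult_left_mono) auto
                then have "start k p + ennreal (K * cost k p x) \<le> start k p + ennreal (K * cost k p z)"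
                  by (intro add_left_mono ennreal_leI)
                also have "\<dots> \<le> b x" using p(3) bzx by (rule order_trans)
                finally have "swept k p x"
                  using p(1,2) c by (simp add: swept_def territory_def)
                then show ?thesis by blast
              next
                case zU: False
                show ?thesis
                proof (cases "territory k p x")
                  case True
                  have "K * real (cost k p x) \<le> K * real (Suc (cost k p z))"
                    using K0 cost_step[OF z(1), of k p] by (intro mult_left_mono) auto
                  then have "start k p + ennreal (K * cost k p x) \<le>
                      start k p + ennreal (K * cost k p z + K)"
                    by (intro add_left_mono ennreal_leI) (simp add: algebra_simps)
                  also have "\<dots> = start k p + ennreal (K * cost k p z) + ennreal K"
                    using K0 by (simp add: add.assoc)
                  also have "\<dots> \<le> b z + ennreal K" using p(3) by (rule add_right_mono)
                  also have "\<dots> \<le> b x" by (rule z_good[OF zg])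
                  finally have "swept k p x" using p(1) True by (simp add: swept_def)
                  then show ?thesis by blast
                next
                  case False
                  show ?thesis
                  \<comment> \<open>Free steps do not raise the cost, so a territory can be left
                    only from a site outside \<open>U k\<close>; there the race around the island
                    decides.\<close>
                  proof (rule exit_territory[OF p(1,2) zU z(1) _ fin False taint])
                    show "start k p + ennreal (K * cost k p z) \<le> b x"
                      using p(3) bzx by (rule order_trans)
                  qed (use IH in blast)
                qed
              qed
            qed
          qed
        qed
      qed
    qed
  qed
  then show ?thesis using assms(2) by blast
qed

text \<open>The origin converts and type 2 then follows a path to \<open>x\<close>. As
  \<open>b x\<close> is finite everywhere, an untainted site must have been of type 1.\<close>

lemma all_converted: "b x < \<infinity>"
proof -
  have "conn UNIV ori (d1 ori x) x" by (rule conn_hull) simp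
  then show ?thesis
  proof (induction rule: conn.induct)
    case conn_refl
    have "b ori \<le> a ori + ennreal (w (Convert ori))"
      by (rule convert_le[OF no_explosion]) (simp add: a_orig)
    then show ?case by (rule le_less_trans) (simp add: a_orig)
  next
    case (conn_step r y z)
    show ?case
      by (rule le_less_trans[OF spread2_le[OF no_explosion conn_step.IH conn_step.hyps(2)]])
        (rule add_less_infinity[OF conn_step.IH])
  qed
qed

lemma survives: "type1_survives lattice_adj ori w"
proof (rule survives_if_infinite[OF no_explosion])
  have "{x. \<forall>k. \<forall>p\<in>P k. \<not> territory k p x} \<subseteq> {x. a x < \<infinity>}"
  proof safe
    fix x assume "\<forall>k. \<forall>p\<in>P k. \<not> territory k p x"
    then have "\<not> (\<exists>k p. swept k p x)" by (auto simp: swept_def)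
    then have "\<not> tainted x" using tainted_swept[OF all_converted] by blast
    then have "a x + ennreal M \<le> b x" by (simp add: tainted_def not_less)
    then show "a x < \<infinity>" using all_converted[of x] by (rule finite_summand)
  qed
  then show "infinite {x. a x < \<infinity>}" using infinite_outside[OF far] infinite_super by blast
qed

end

subsection \<open>Probability of bad configurations\<close>

definition clock_law :: "real \<Rightarrow> real \<Rightarrow> 'v clock \<Rightarrow> real measure" where
  "clock_law lam rho c = density lborel (\<lambda>t. ennreal (exponential_density (clock_rate lam rho c) t))"

lemma clock_measure_eq: "clock_measure lam rho = (\<Pi>\<^sub>M c\<in>UNIV. clock_law lam rho c)"
  by (simp add: clock_measure_def clock_law_def)

lemma sets_clock_law [measurable_cong, simp]: "sets (clock_law lam rho c) = sets borel"
  by (simp add: clock_law_def)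

lemma space_clock_law [simp]: "space (clock_law lam rho c) = UNIV"
  by (simp add: clock_law_def)

lemma space_clock_measure [simp]: "space (clock_measure lam rho) = UNIV"
  by (simp add: clock_measure_eq space_PiM)

lemma measurable_clock [measurable]: "(\<lambda>w. w c) \<in> borel_measurable (clock_measure lam rho)"
proof -
  have "(\<lambda>w. w c) \<in> measurable (clock_measure lam rho) (clock_law lam rho c)"
    unfolding clock_measure_eq by (rule measurable_component_singleton) simp
  then show ?thesis by (simp cong: measurable_cong_sets)
qed

lemma clock_rate_pos: "0 < lam \<Longrightarrow> 0 < rho \<Longrightarrow> 0 < clock_rate lam rho c"
  by (cases c) auto

lemma clock_law:
  assumes "0 < lam" "0 < rho"
  shows "prob_space (clock_law lam rho c)"
    and "0 \<le> t \<Longrightarrow> measure (clock_law lam rho c) {..t} \<le> clock_rate lam rho c * t"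
    and "0 \<le> t \<Longrightarrow> measure (clock_law lam rho c) {t<..} = exp (- t * clock_rate lam rho c)"
proof -
  let ?M = "clock_law lam rho c" and ?l = "clock_rate lam rho c"
  have l: "0 < ?l" using assms by (rule clock_rate_pos)
  show P: "prob_space ?M"
    unfolding clock_law_def using l by (rule prob_space_exponential_density)
  interpret prob_space ?M by (rule P)
  have D: "distributed ?M lborel (\<lambda>x. x) (exponential_density ?l)"
    unfolding distributed_def
  proof (intro conjI)
    have "distr ?M lborel (\<lambda>x. x) = distr ?M ?M (\<lambda>x. x)" by (rule distr_cong) auto
    then show "distr ?M lborel (\<lambda>x. x) = density lborel (\<lambda>x. ennreal (exponential_density ?l x))"
      by (simp add: distr_id2 clock_law_def)
  qed (auto intro: measurable_ident_sets)
  assume t: "0 \<le> t"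
  have "measure ?M {..t} = 1 - exp (- t * ?l)"
    using exponential_distributedD_le[OF D t l] by (simp add: atMost_def)
  also have "\<dots> \<le> ?l * t" using exp_ge_add_one_self[of "- t * ?l"] by (simp add: mult.commute)
  finally show "measure ?M {..t} \<le> ?l * t" .
  show "measure ?M {t<..} = exp (- t * ?l)"
    using exponential_distributedD_gt[OF D t l] by (simp add: greaterThan_def)
qed

text \<open>Spreading clocks are attached to the site that they start from. The clock sets of
  different sites are then disjoint, which makes their badness independent.\<close>

definition clocks_at :: "int ^ 'd::finite \<Rightarrow> (int ^ 'd) clock set" where
  "clocks_at x = insert (Convert x) (Spread1 x ` {y. lattice_adj x y} \<union> Spread2 x ` {y. lattice_adj x y})"

definition bad_sites :: "((int ^ 'd::finite) clock \<Rightarrow> real set) \<Rightarrow> ((int ^ 'd) clock \<Rightarrow> real) \<Rightarrow> (int ^ 'd) set" where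
  "bad_sites X w = {x. \<exists>c\<in>clocks_at x. w c \<in> X c}"

lemma finite_out_neighbours: "finite {y :: int ^ 'd::finite. lattice_adj x y}"
  using finite_neighbours[of x] by (simp add: lattice_adj_commute)

lemma card_out_neighbours: "card {y :: int ^ 'd::finite. lattice_adj x y} \<le> 3 ^ CARD('d)"
proof -
  have "card {y. lattice_adj x y} \<le> card {y. dinf x y \<le> 1}"
    by (rule card_mono) (auto simp: card_dinf_ball dest: lattice_adj_dinf)
  then show ?thesis by (simp add: card_dinf_ball)
qed

lemma finite_clocks_at [simp]: "finite (clocks_at x)"
  using finite_out_neighbours[of x] by (simp add: clocks_at_def)

lemma clocks_at_disjoint: "c \<in> clocks_at x \<Longrightarrow> c \<in> clocks_at y \<Longrightarrow> x = y"
  by (auto simp: clocks_at_def)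

lemma sum_clocks_at_le:
  fixes g :: "(int ^ 'd::finite) clock \<Rightarrow> real"
  assumes "\<And>y. g (Spread1 x y) \<le> p1" "\<And>y. g (Spread2 x y) \<le> p2" "g (Convert x) \<le> p3"
    and nn: "\<And>c. 0 \<le> g c"
  shows "(\<Sum>c\<in>clocks_at x. g c) \<le> 3 ^ CARD('d) * p1 + 3 ^ CARD('d) * p2 + p3"
proof -
  let ?N = "{y. lattice_adj x y}"
  have fin: "finite ?N" by (rule finite_out_neighbours)
  have p: "0 \<le> p1" "0 \<le> p2" using assms(1,2) nn order_trans by blast+
  have *: "(\<Sum>c\<in>f ` ?N. g c) \<le> 3 ^ CARD('d) * p" if "\<And>y. g (f y) \<le> p" "0 \<le> p" for f p
  proof -
    have "(\<Sum>c\<in>f ` ?N. g c) \<le> (\<Sum>y\<in>?N. g (f y))"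
      using sum_image_le[of ?N g f] fin nn by (simp add: comp_def)
    also have "\<dots> \<le> real (card ?N) * p" by (rule sum_bounded_above) (rule that(1))
    also have "\<dots> \<le> 3 ^ CARD('d) * p"
      using card_out_neighbours[of x] that(2)
      by (intro mult_right_mono) (metis of_nat_le_iff of_nat_numeral of_nat_power)
    finally show ?thesis .
  qed
  have "(\<Sum>c\<in>clocks_at x. g c) \<le> g (Convert x) + (\<Sum>c\<in>Spread1 x ` ?N \<union> Spread2 x ` ?N. g c)"
    unfolding clocks_at_def using fin by (subst sum.insert) auto
  also have "(\<Sum>c\<in>Spread1 x ` ?N \<union> Spread2 x ` ?N. g c) \<le>
      (\<Sum>c\<in>Spread1 x ` ?N. g c) + (\<Sum>c\<in>Spread2 x ` ?N. g c)"
    using fin by (subst sum.union_disjoint) auto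
  finally show ?thesis
    using *[of "Spread1 x" p1] *[of "Spread2 x" p2] assms p by fastforce
qed

lemma bad_sites_event:
  assumes X: "\<And>c. X c \<in> sets borel" and "finite S"
  shows "{w. S \<subseteq> bad_sites X w} \<in> sets (clock_measure lam rho)"
proof -
  have "{w. S \<subseteq> bad_sites X w} = {w \<in> space (clock_measure lam rho). \<forall>x\<in>S. \<exists>c\<in>clocks_at x. w c \<in> X c}"
    by (auto simp: bad_sites_def)
  also have "\<dots> \<in> sets (clock_measure lam rho)"
    using assms by measurable
  finally show ?thesis .
qed

text \<open>A union bound over the clock that makes each site of \<open>S\<close> bad.\<close>

lemma prob_bad_sites:
  fixes X :: "(int ^ 'd::finite) clock \<Rightarrow> real set"
  assumes pos: "0 < lam" "0 < rho" and X: "\<And>c. X c \<in> sets borel" and S: "finite S"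
    and p: "\<And>x. (\<Sum>c\<in>clocks_at x. measure (clock_law lam rho c) (X c)) \<le> p"
  shows "measure (clock_measure lam rho) {w. S \<subseteq> bad_sites X w} \<le> p ^ card S"
proof -
  let ?M = "clock_measure lam rho :: ((int ^ 'd) clock \<Rightarrow> real) measure"
  let ?mu = "\<lambda>c. measure (clock_law lam rho c) (X c)"
  interpret law: prob_space "clock_law lam rho c" for c :: "(int ^ 'd) clock"
    by (rule clock_law[OF pos])
  interpret product_prob_space "clock_law lam rho" "UNIV :: (int ^ 'd) clock set" ..
  interpret prob_space ?M by (rule prob_space_clock_measure[OF pos])
  \<comment> \<open>Each \<open>f\<close> selects one clock per site; since the clock sets are
    disjoint, the selected clocks are distinct and hence independent.\<close>
  define F where "F = PiE S clocks_at"
  define ev where "ev f = {w. \<forall>x\<in>S. w (f x) \<in> X (f x)}" for f :: "int ^ 'd \<Rightarrow> (int ^ 'd) clock"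
  have fin: "finite F" unfolding F_def using S by (intro finite_PiE) auto
  have ev_eq: "ev f = {w \<in> space ?M. \<forall>c\<in>f ` S. w c \<in> X c}" for f by (auto simp: ev_def)
  have ev_sets: "ev f \<in> events" for f
    unfolding ev_eq using X S by measurable
  have ev_prob: "prob (ev f) = (\<Prod>x\<in>S. ?mu (f x))" if f: "f \<in> F" for f
  proof -
    have inj: "inj_on f S"
    proof (rule inj_onI)
      fix x y assume "x \<in> S" "y \<in> S" "f x = f y"
      then show "x = y" using f clocks_at_disjoint[of "f x" x y] by (auto simp: F_def PiE_iff)
    qed
    have "emeasure ?M (ev f) = (\<Prod>c\<in>f ` S. emeasure (clock_law lam rho c) (X c))"
      unfolding ev_eq unfolding clock_measure_eq using X S by (intro emeasure_PiM_Collect) auto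
    also have "\<dots> = (\<Prod>x\<in>S. ennreal (?mu (f x)))"
      using inj by (simp add: prod.reindex law.emeasure_eq_measure)
    also have "\<dots> = ennreal (\<Prod>x\<in>S. ?mu (f x))" by (rule prod_ennreal) simp
    finally show ?thesis by (simp add: measure_def prod_nonneg)
  qed
  have "{w. S \<subseteq> bad_sites X w} \<subseteq> (\<Union>f\<in>F. ev f)"
  proof
    fix w assume "w \<in> {w. S \<subseteq> bad_sites X w}"
    then have "\<forall>x\<in>S. \<exists>c. c \<in> clocks_at x \<and> w c \<in> X c" by (auto simp: bad_sites_def)
    then obtain f where f: "\<forall>x\<in>S. f x \<in> clocks_at x \<and> w (f x) \<in> X (f x)" by metis
    then have "restrict f S \<in> F" "w \<in> ev (restrict f S)" by (auto simp: F_def ev_def)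
    then show "w \<in> (\<Union>f\<in>F. ev f)" by blast
  qed
  then have "prob {w. S \<subseteq> bad_sites X w} \<le> prob (\<Union>f\<in>F. ev f)"
    using fin ev_sets by (intro finite_measure_mono) auto
  also have "\<dots> \<le> (\<Sum>f\<in>F. prob (ev f))"
    using fin ev_sets by (intro finite_measure_subadditive_finite) auto
  also have "\<dots> = (\<Sum>f\<in>F. \<Prod>x\<in>S. ?mu (f x))" using ev_prob by (intro sum.cong) auto
  also have "\<dots> = (\<Prod>x\<in>S. \<Sum>c\<in>clocks_at x. ?mu c)"
    unfolding F_def using S by (subst prod_sum_PiE) auto
  also have "\<dots> \<le> (\<Prod>x\<in>S. p)" by (intro prod_mono) (auto simp: p intro: sum_nonneg)
  also have "\<dots> = p ^ card S" by simp
  finally show ?thesis .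
qed

subsection \<open>The scales\<close>

definition scale_base :: "nat \<Rightarrow> int" where "scale_base n = 20000 * (int n * int n)"
text \<open>Quadratic exponents: the ratio of successive scales is at least
  \<open>scale_base n ^ (k + 1)\<close>, ample for the factor \<open>2 ^ k\<close>, while logarithms
  grow slowly against the \<open>2 ^ k\<close> sites of a witness.\<close>

definition small_scale :: "nat \<Rightarrow> nat \<Rightarrow> int" where
  "small_scale n k = scale_base n ^ ((k + 1) ^ 2)"
definition large_scale :: "nat \<Rightarrow> nat \<Rightarrow> int" where
  "large_scale n k = scale_base n ^ ((k + 1) ^ 2 + (k + 1))"

lemma scale_base_ge: "2 \<le> n \<Longrightarrow> 80000 \<le> scale_base n"
  using mult_mono[of 2 "int n" 2 "int n"] by (simp add: scale_base_def)

lemma large_scale_eq: "large_scale n k = scale_base n ^ (k + 1) * small_scale n k"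
  by (simp add: large_scale_def small_scale_def power_add)

lemma small_scale_Suc: "small_scale n (Suc k) = scale_base n ^ (k + 2) * large_scale n k"
proof -
  have "(Suc k + 1) ^ 2 = (k + 2) + ((k + 1) ^ 2 + (k + 1))" by (simp add: power2_eq_square)
  then show ?thesis by (simp only: small_scale_def large_scale_def power_add)
qed

lemma pow_base_ge: "2 \<le> n \<Longrightarrow> scale_base n * 2 ^ k \<le> scale_base n ^ Suc k"
  using scale_base_ge[of n] power_mono[of 2 "scale_base n" k] by simp

lemma small_scale_pos: "2 \<le> n \<Longrightarrow> 0 < small_scale n k"
  using scale_base_ge[of n] by (simp add: small_scale_def)

lemma large_scale_pos: "2 \<le> n \<Longrightarrow> 0 < large_scale n k"
  using scale_base_ge[of n] by (simp add: large_scale_def)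

lemma large_scale_ge: "2 \<le> n \<Longrightarrow> scale_base n * 2 ^ k * small_scale n k \<le> large_scale n k"
  unfolding large_scale_eq using pow_base_ge[of n k] small_scale_pos[of n k]
  by (intro mult_right_mono) auto

lemma small_scale_Suc_ge: "2 \<le> n \<Longrightarrow> scale_base n * 2 ^ k * large_scale n k \<le> small_scale n (Suc k)"
proof -
  assume n: "2 \<le> n"
  have "scale_base n * 2 ^ k \<le> scale_base n * 2 ^ Suc k" using scale_base_ge[OF n] by simp
  also have "\<dots> \<le> scale_base n ^ Suc (Suc k)" by (rule pow_base_ge[OF n])
  finally show ?thesis
    unfolding small_scale_Suc using large_scale_pos[OF n, of k] by (intro mult_right_mono) auto
qed

lemma double_small_scale: "2 \<le> n \<Longrightarrow> 2 * small_scale n k \<le> large_scale n k"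
proof -
  assume n: "2 \<le> n"
  have "2 * 1 \<le> scale_base n * 2 ^ k" using scale_base_ge[OF n] by (intro mult_mono) auto
  then have "2 * small_scale n k \<le> scale_base n * 2 ^ k * small_scale n k"
    using small_scale_pos[OF n, of k] by (intro mult_right_mono) auto
  then show ?thesis using large_scale_ge[OF n, of k] by linarith
qed

abbreviation site_centres :: "(int ^ 'd::finite) set \<Rightarrow> nat \<Rightarrow> (int ^ 'd) set" where
  "site_centres S \<equiv> centres (small_scale CARD('d)) (large_scale CARD('d)) S"
abbreviation site_core :: "(int ^ 'd::finite) set \<Rightarrow> nat \<Rightarrow> (int ^ 'd) set" where
  "site_core S \<equiv> core (small_scale CARD('d)) (large_scale CARD('d)) S"
abbreviation site_witness :: "nat \<Rightarrow> int ^ 'd::finite \<Rightarrow> (int ^ 'd) set set" where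
  "site_witness \<equiv> witness (small_scale CARD('d)) (large_scale CARD('d))"

lemma sparse_centres:
  assumes "2 \<le> CARD('d::finite)"
  shows "sparse (small_scale CARD('d)) (large_scale CARD('d)) (scale_base CARD('d))
    (site_centres (S :: (int ^ 'd) set))"
proof
  show "scale_base CARD('d) \<le> small_scale CARD('d) 0" by (simp add: small_scale_def)
  show "large_scale CARD('d) k < dinf p q"
    if "p \<in> site_centres S k" "q \<in> site_centres S k" "p \<noteq> q" for p q :: "int ^ 'd" and k
    using that small_scale_pos[OF assms, of k] double_small_scale[OF assms, of k]
    by (intro centres_separated) auto
qed (use assms large_scale_ge small_scale_Suc_ge in \<open>auto simp: scale_base_def\<close>)

subsection \<open>Counting witnesses\<close>

primrec witness_radius :: "nat \<Rightarrow> nat \<Rightarrow> int" where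
  "witness_radius n 0 = 0"
| "witness_radius n (Suc k) = witness_radius n k + large_scale n k"

primrec witness_count :: "nat \<Rightarrow> nat \<Rightarrow> nat" where
  "witness_count n 0 = 1"
| "witness_count n (Suc k) = nat (2 * large_scale n k + 1) ^ n * (witness_count n k)^2"

text \<open>Makes witnesses of points more than \<open>small_scale n k\<close> apart disjoint, so
  that a witness of rank \<open>k\<close> has exactly \<open>2 ^ k\<close> sites.\<close>

lemma witness_radius_le: "2 \<le> n \<Longrightarrow> 2 * witness_radius n k \<le> small_scale n k"
proof (induction k)
  case (Suc k)
  have "3 * 1 \<le> scale_base n * 2 ^ k" using scale_base_ge[OF Suc.prems] by (intro mult_mono) auto
  then have "3 * large_scale n k \<le> scale_base n * 2 ^ k * large_scale n k"
    using large_scale_pos[OF Suc.prems, of k] by (intro mult_right_mono) auto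
  then have "3 * large_scale n k \<le> small_scale n (Suc k)"
    using small_scale_Suc_ge[OF Suc.prems, of k] by linarith
  moreover have "2 * witness_radius n k \<le> large_scale n k"
    using Suc double_small_scale[of n k] small_scale_pos[of n k] by simp
  ultimately show ?case by simp
qed (simp add: small_scale_pos less_imp_le)

lemma witness_props:
  fixes p :: "int ^ 'd::finite"
  assumes n: "2 \<le> CARD('d)"
  shows "finite (site_witness k p)" "card (site_witness k p) \<le> witness_count CARD('d) k"
    "T \<in> site_witness k p \<Longrightarrow> finite T \<and> card T = 2 ^ k \<and> (\<forall>x\<in>T. dinf p x \<le> witness_radius CARD('d) k)"
proof (induction k arbitrary: p T)
  case 0
  { case 1 show ?case by simp }
  { case 2 show ?case by simp }
  { case 3 then show ?case by simp }
next
  case (Suc k)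
  let ?al = "small_scale CARD('d) k" and ?be = "large_scale CARD('d) k"
  define Q where "Q p = {q :: int ^ 'd. ?al < dinf p q \<and> dinf p q \<le> ?be}" for p
  have Qsub: "Q p \<subseteq> {q. dinf p q \<le> ?be}" for p by (auto simp: Q_def)
  have be: "0 \<le> ?be" using large_scale_pos[OF n, of k] by simp
  have finQ: "finite (Q p)" for p by (rule finite_subset[OF Qsub card_dinf_ball(1)[OF be]])
  have cardQ: "card (Q p) \<le> nat (2 * ?be + 1) ^ CARD('d)" for p
    using card_mono[OF card_dinf_ball(1)[OF be] Qsub] by (simp add: card_dinf_ball(2)[OF be])
  have W: "site_witness (Suc k) p = (\<Union>q\<in>Q p. (\<lambda>(S, T). S \<union> T) ` (site_witness k p \<times> site_witness k q))" for p
    by (simp add: Q_def)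
  { case 1 show ?case unfolding W using finQ Suc.IH(1) by blast }
  { case 2
    have "card (site_witness (Suc k) p) \<le> (\<Sum>q\<in>Q p. card ((\<lambda>(S, T). S \<union> T) ` (site_witness k p \<times> site_witness k q)))"
      unfolding W by (rule card_UN_le[OF finQ])
    also have "\<dots> \<le> (\<Sum>q\<in>Q p. witness_count CARD('d) k ^ 2)"
    proof (rule sum_mono)
      fix q
      have "card ((\<lambda>(S, T). S \<union> T) ` (site_witness k p \<times> site_witness k q)) \<le>
          card (site_witness k p \<times> site_witness k q)"
        using Suc.IH(1) by (intro card_image_le) blast
      also have "\<dots> = card (site_witness k p) * card (site_witness k q)" by (rule card_cartesian_product)
      also have "\<dots> \<le> witness_count CARD('d) k * witness_count CARD('d) k"
        using Suc.IH(2) by (intro mult_mono) auto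
      finally show "card ((\<lambda>(S, T). S \<union> T) ` (site_witness k p \<times> site_witness k q)) \<le> witness_count CARD('d) k ^ 2"
        by (simp add: power2_eq_square)
    qed
    also have "\<dots> = card (Q p) * witness_count CARD('d) k ^ 2" by simp
    also have "\<dots> \<le> witness_count CARD('d) (Suc k)" using cardQ by simp
    finally show ?case . }
  { case 3
    then obtain q S S' where q: "q \<in> Q p" and S: "S \<in> site_witness k p" "S' \<in> site_witness k q"
      and T: "T = S \<union> S'" unfolding W by auto
    note S1 = Suc.IH(3)[OF S(1)] and S2 = Suc.IH(3)[OF S(2)]
    have "S \<inter> S' = {}"
    proof (rule ccontr)
      assume "S \<inter> S' \<noteq> {}"
      then obtain x where "x \<in> S" "x \<in> S'" by blast
      then have "dinf p q \<le> 2 * witness_radius CARD('d) k"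
        using S1 S2 dinf_triangle[of p q x] by (fastforce simp: dinf_commute)
      then show False using q witness_radius_le[OF n, of k] by (simp add: Q_def)
    qed
    then have "card T = 2 ^ Suc k" unfolding T using S1 S2 by (subst card_Un_disjoint) auto
    moreover have "dinf p x \<le> witness_radius CARD('d) (Suc k)" if x: "x \<in> T" for x
    proof (cases "x \<in> S")
      case True
      then show ?thesis using S1 be by fastforce
    next
      case False
      then have "dinf q x \<le> witness_radius CARD('d) k" using x S2 T by blast
      then show ?thesis using q dinf_triangle[of p x q] by (simp add: Q_def)
    qed
    ultimately show ?case using S1 S2 T by blast }
qed

definition small_prob :: "nat \<Rightarrow> real" where
  "small_prob n = 1 / of_int (scale_base n) ^ (16 * (n + 1))"

lemma small_prob_pos: "2 \<le> n \<Longrightarrow> 0 < small_prob n"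
  using scale_base_ge[of n] by (simp add: small_prob_def)

text \<open>With \<open>q\<close> the scale base, each round squares count and probability and adds
  a factor of at most \<open>q ^ (n * (k + 2)^2)\<close>. Squaring the reserve
  \<open>q ^ ((n + 1) * (k + 4)^2)\<close> absorbs it, as
  \<open>(k + 2)^2 + (k + 5)^2 \<le> 2 * (k + 4)^2\<close>. The exponent 16 in
  \<open>small_prob\<close> is the case \<open>k = 0\<close>.\<close>

lemma witness_count_small:
  assumes n: "2 \<le> n"
  shows "witness_count n k * small_prob n ^ (2 ^ k) * of_int (scale_base n) ^ ((n + 1) * (k + 4)^2) \<le> 1"
proof (induction k)
  case 0
  show ?case using scale_base_ge[OF n] by (simp add: small_prob_def mult.commute)
next
  case (Suc k)
  define q where "q = real_of_int (scale_base n)"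
  define x where "x = witness_count n k * small_prob n ^ (2 ^ k)"
  have q: "80000 \<le> q" using scale_base_ge[OF n] by (simp add: q_def)
  have x0: "0 \<le> x" using small_prob_pos[OF n] by (simp add: x_def)
  have IH: "x * q ^ ((n + 1) * (k + 4)^2) \<le> 1" using Suc.IH by (simp add: x_def q_def)
  have "2 * large_scale n k + 1 \<le> scale_base n * large_scale n k"
    using scale_base_ge[OF n] large_scale_pos[OF n, of k]
      mult_right_mono[of 3 "scale_base n" "large_scale n k"] by linarith
  also have "\<dots> = scale_base n ^ (1 + ((k + 1)^2 + (k + 1)))" by (simp add: large_scale_def)
  also have "\<dots> \<le> scale_base n ^ ((k + 2)^2)"
    using scale_base_ge[OF n] by (intro power_increasing) (auto simp: power2_eq_square)
  finally have "real_of_int (2 * large_scale n k + 1) \<le> real_of_int (scale_base n ^ ((k + 2)^2))"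
    by (simp only: of_int_le_iff)
  then have b: "real (nat (2 * large_scale n k + 1)) \<le> q ^ ((k + 2)^2)"
    using large_scale_pos[OF n, of k] by (simp add: q_def)
  have "witness_count n (Suc k) * small_prob n ^ (2 ^ Suc k) =
      real (nat (2 * large_scale n k + 1)) ^ n * x^2"
    by (simp add: x_def power_mult_distrib power_mult[symmetric] mult_ac)
  also have "\<dots> \<le> (q ^ ((k + 2)^2)) ^ n * x^2"
    using b by (intro mult_right_mono power_mono) auto
  finally have "witness_count n (Suc k) * small_prob n ^ (2 ^ Suc k) * q ^ ((n + 1) * (k + 5)^2) \<le>
      (q ^ ((k + 2)^2)) ^ n * x^2 * q ^ ((n + 1) * (k + 5)^2)"
    using q by (intro mult_right_mono) auto
  also have "\<dots> = x^2 * q ^ ((k + 2)^2 * n + (n + 1) * (k + 5)^2)"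
    by (simp add: power_mult power_add)
  also have "\<dots> \<le> x^2 * q ^ ((n + 1) * (k + 4)^2 * 2)"
  proof (intro mult_left_mono power_increasing)
    have "(k + 2)^2 * n + (n + 1) * (k + 5)^2 \<le> (n + 1) * ((k + 2)^2 + (k + 5)^2)"
      by (simp add: distrib_left distrib_right)
    also have "(k + 2)^2 + (k + 5)^2 \<le> (k + 4)^2 * 2" by (simp add: power2_eq_square algebra_simps)
    then have "(n + 1) * ((k + 2)^2 + (k + 5)^2) \<le> (n + 1) * ((k + 4)^2 * 2)" by (intro mult_left_mono) auto
    finally show "(k + 2)^2 * n + (n + 1) * (k + 5)^2 \<le> (n + 1) * (k + 4)^2 * 2" by (simp only: mult.assoc)
  qed (use q in auto)
  also have "\<dots> = (x * q ^ ((n + 1) * (k + 4)^2))^2" by (simp only: power_mult power_mult_distrib)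
  also have "\<dots> \<le> 1" using IH x0 q by (simp add: power_le_one)
  finally show ?case by (simp add: q_def add.commute)
qed

lemma clock_law_le:
  assumes "0 < lam" "0 < rho" "0 \<le> t"
  shows "measure (clock_law lam rho (Spread1 x y)) {..t} \<le> t"
    and "measure (clock_law lam rho (Spread2 x y)) {..t} \<le> lam * t"
    and "measure (clock_law lam rho (Convert x)) {..t} \<le> rho * t"
    and "measure (clock_law lam rho (Spread1 x y)) {t<..} \<le> exp (- t)"
    and "measure (clock_law lam rho (Convert x)) {t<..} \<le> exp (- (t * rho))"
  using clock_law(2,3)[OF assms(1,2,3), of "Spread1 x y"]
    clock_law(2)[OF assms(1,2,3), of "Spread2 x y"]
    clock_law(2,3)[OF assms(1,2,3), of "Convert x"] by simp_all

text \<open>Equal to \<open>rf + 4\<close>, so that a quiet environment provides the assumption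
  \<open>far\<close> for the origin.\<close>

definition reach_factor :: "nat \<Rightarrow> int" where "reach_factor n = 20 * int n + 18"

definition quiet :: "((int ^ 'd::finite) clock \<Rightarrow> real set) \<Rightarrow> nat \<Rightarrow> ((int ^ 'd) clock \<Rightarrow> real) set" where
  "quiet X k = {w. \<forall>p. dinf 0 p \<le> reach_factor CARD('d) * small_scale CARD('d) k \<longrightarrow>
     (\<forall>T\<in>site_witness k p. \<not> T \<subseteq> bad_sites X w)}"

lemma quiet_core:
  fixes p :: "int ^ 'd::finite"
  assumes "2 \<le> CARD('d)" "w \<in> quiet X k" "p \<in> site_core (bad_sites X w) k"
  shows "reach_factor CARD('d) * small_scale CARD('d) k < dinf 0 p"
proof -
  obtain T where "T \<in> site_witness k p" "T \<subseteq> bad_sites X w"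
    using core_witness[OF _ assms(3)] small_scale_pos[OF assms(1)] less_imp_le by metis
  then show ?thesis using assms(2) by (force simp: quiet_def)
qed

text \<open>Union bound over the points of the ball and their witnesses; the bounds
  \<open>(1 / 2) ^ (k + 2)\<close> sum to \<open>1 / 2\<close>.\<close>

lemma quiet_event:
  fixes X :: "(int ^ 'd::finite) clock \<Rightarrow> real set"
  assumes n: "2 \<le> CARD('d)" and X: "\<And>c. X c \<in> sets borel"
  shows "- quiet X k \<in> sets (clock_measure lam rho)" "quiet X k \<in> sets (clock_measure lam rho)"
    and "0 < lam \<Longrightarrow> 0 < rho \<Longrightarrow>
      (\<And>x. (\<Sum>c\<in>clocks_at x. measure (clock_law lam rho c) (X c)) \<le> small_prob CARD('d)) \<Longrightarrow>
      measure (clock_measure lam rho) (- quiet X k) \<le> (1 / 2) ^ (k + 2)"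
proof -
  let ?M = "clock_measure lam rho :: ((int ^ 'd) clock \<Rightarrow> real) measure"
  let ?n = "CARD('d)"
  define r where "r = reach_factor ?n * small_scale ?n k"
  have r0: "0 \<le> r" using small_scale_pos[OF n, of k] by (simp add: r_def reach_factor_def)
  define I where "I = (SIGMA p:{p :: int ^ 'd. dinf 0 p \<le> r}. site_witness k p)"
  have fin: "finite I"
    unfolding I_def using card_dinf_ball(1)[OF r0] witness_props(1)[OF n] by (intro finite_SigmaI) auto
  define ev where "ev i = {w. snd i \<subseteq> bad_sites X w}" for i :: "(int ^ 'd) \<times> (int ^ 'd) set"
  have ev: "ev i \<in> sets ?M" if "i \<in> I" for i
    unfolding ev_def using that witness_props(3)[OF n] by (intro bad_sites_event X) (auto simp: I_def)
  have compl: "- quiet X k = (\<Union>i\<in>I. ev i)"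
    by (auto simp: quiet_def I_def ev_def r_def)
  show 1: "- quiet X k \<in> sets ?M" unfolding compl using fin ev by (intro sets.finite_UN) auto
  have "space ?M - (- quiet X k) \<in> sets ?M" using 1 by (rule sets.compl_sets)
  then show "quiet X k \<in> sets ?M" by (simp add: Compl_eq_Diff_UNIV[symmetric])
  assume pos: "0 < lam" "0 < rho"
    and small: "\<And>x. (\<Sum>c\<in>clocks_at x. measure (clock_law lam rho c) (X c)) \<le> small_prob CARD('d)"
  interpret prob_space ?M by (rule prob_space_clock_measure[OF pos])
  define q where "q = real_of_int (scale_base ?n)"
  define x where "x = witness_count ?n k * small_prob ?n ^ (2 ^ k)"
  have q: "80000 \<le> q" using scale_base_ge[OF n] by (simp add: q_def)
  have x0: "0 \<le> x" using small_prob_pos[OF n] by (simp add: x_def)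
  have "prob (- quiet X k) \<le> (\<Sum>i\<in>I. prob (ev i))"
    unfolding compl using fin ev by (intro finite_measure_subadditive_finite) auto
  also have "\<dots> \<le> (\<Sum>i\<in>I. small_prob ?n ^ (2 ^ k))"
  proof (rule sum_mono)
    fix i assume i: "i \<in> I"
    then have T: "finite (snd i)" "card (snd i) = 2 ^ k"
      using witness_props(3)[OF n, of "snd i" k "fst i"] by (auto simp: I_def)
    have "prob (ev i) \<le> small_prob ?n ^ card (snd i)"
      unfolding ev_def by (rule prob_bad_sites[OF pos X T(1) small])
    then show "prob (ev i) \<le> small_prob ?n ^ (2 ^ k)" by (simp only: T(2))
  qed
  also have "\<dots> = card I * small_prob ?n ^ (2 ^ k)" by simp
  also have "\<dots> \<le> (nat (2 * r + 1) ^ ?n * witness_count ?n k) * small_prob ?n ^ (2 ^ k)"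
  proof (rule mult_right_mono)
    have "card I = (\<Sum>p\<in>{p :: int ^ 'd. dinf 0 p \<le> r}. card (site_witness k p))"
      unfolding I_def using card_dinf_ball(1)[OF r0] witness_props(1)[OF n] by (subst card_SigmaI) auto
    also have "\<dots> \<le> card {p :: int ^ 'd. dinf 0 p \<le> r} * witness_count ?n k"
      using sum_bounded_above[OF witness_props(2)[OF n]] by simp
    finally have "card I \<le> nat (2 * r + 1) ^ ?n * witness_count ?n k"
      by (simp add: card_dinf_ball(2)[OF r0])
    then show "real (card I) \<le> real (nat (2 * r + 1) ^ ?n * witness_count ?n k)" by (simp only: of_nat_le_iff)
  qed (use small_prob_pos[OF n] in simp)
  also have "\<dots> = real (nat (2 * r + 1)) ^ ?n * x" by (simp add: x_def)
  also have "\<dots> \<le> (q ^ ((k + 2)^2)) ^ ?n * x"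
  proof (intro mult_right_mono power_mono)
    have "2 * reach_factor ?n + 1 \<le> scale_base ?n"
    proof -
      have "2 * int ?n \<le> int ?n * int ?n" "2 * 2 \<le> int ?n * int ?n"
        using n by (intro mult_mono; simp)+
      moreover have "2 * (20 * m + 18) + 1 \<le> 20000 * x" if "2 * m \<le> x" "2 * 2 \<le> x" for m x :: int
        using that by simp
      ultimately show ?thesis unfolding reach_factor_def scale_base_def by blast
    qed
    then have "(2 * reach_factor ?n + 1) * small_scale ?n k \<le> scale_base ?n * small_scale ?n k"
      using small_scale_pos[OF n, of k] by (intro mult_right_mono) auto
    then have "2 * r + 1 \<le> scale_base ?n * small_scale ?n k"
      using small_scale_pos[OF n, of k] by (simp add: r_def algebra_simps)
    also have "\<dots> = scale_base ?n ^ (1 + (k + 1)^2)" by (simp add: small_scale_def)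
    also have "\<dots> \<le> scale_base ?n ^ ((k + 2)^2)"
      using scale_base_ge[OF n] by (intro power_increasing) (auto simp: power2_eq_square)
    finally have "real_of_int (2 * r + 1) \<le> real_of_int (scale_base ?n ^ ((k + 2)^2))"
      by (simp only: of_int_le_iff)
    then show "real (nat (2 * r + 1)) \<le> q ^ ((k + 2)^2)" using r0 by (simp add: q_def)
  qed (use x0 in auto)
  also have "\<dots> \<le> (1 / 2) ^ (k + 2)"
  proof -
    have "(q ^ ((k + 2)^2)) ^ ?n * x * 2 ^ (k + 2) \<le> (q ^ ((k + 2)^2)) ^ ?n * x * q ^ (k + 2)"
      using q x0 by (intro mult_left_mono power_mono) auto
    also have "\<dots> = x * q ^ ((k + 2)^2 * ?n + (k + 2))" by (simp add: power_mult power_add)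
    also have "\<dots> \<le> x * q ^ ((?n + 1) * (k + 4)^2)"
    proof (intro mult_left_mono power_increasing)
      have "(k + 2)^2 \<le> (k + 4)^2" "k + 2 \<le> (k + 4)^2" by (simp_all add: power2_eq_square algebra_simps)
      then have "(k + 2)^2 * ?n + (k + 2) \<le> (k + 4)^2 * ?n + (k + 4)^2"
        by (intro add_mono mult_right_mono) auto
      then show "(k + 2)^2 * ?n + (k + 2) \<le> (?n + 1) * (k + 4)^2" by (simp add: algebra_simps)
    qed (use q x0 in auto)
    also have "\<dots> \<le> 1" using witness_count_small[OF n, of k] by (simp add: x_def q_def)
    finally show ?thesis by (simp add: power_one_over divide_simps)
  qed
  finally show "prob (- quiet X k) \<le> (1 / 2) ^ (k + 2)" .
qed

text \<open>Borel-Cantelli. The almost sure statements look only at large \<open>k\<close>, so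
  finitely many noisy ranks do no harm.\<close>

lemma AE_quiet:
  fixes X :: "(int ^ 'd::finite) clock \<Rightarrow> real set"
  assumes n: "2 \<le> CARD('d)" and X: "\<And>c. X c \<in> sets borel" and pos: "0 < lam" "0 < rho"
    and small: "\<And>x. (\<Sum>c\<in>clocks_at x. measure (clock_law lam rho c) (X c)) \<le> small_prob CARD('d)"
  shows "AE w in clock_measure lam rho. \<forall>\<^sub>F k in sequentially. w \<in> quiet X k"
proof -
  let ?M = "clock_measure lam rho :: ((int ^ 'd) clock \<Rightarrow> real) measure"
  interpret prob_space ?M by (rule prob_space_clock_measure[OF pos])
  have "summable (\<lambda>k. prob (- quiet X k))"
  proof (rule summable_comparison_test)
    show "\<exists>N. \<forall>k\<ge>N. norm (prob (- quiet X k)) \<le> (1 / 2) ^ (k + 2)"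
      using quiet_event(3)[OF n X pos small] by auto
    show "summable (\<lambda>k. (1 / 2 :: real) ^ (k + 2))"
      by (subst summable_iff_shift) (rule summable_geometric, simp)
  qed
  then have "AE w in ?M. \<forall>\<^sub>F k in sequentially. w \<in> space ?M - - quiet X k"
    using quiet_event(1)[OF n X] by (intro borel_cantelli_AE1) (auto simp: emeasure_eq_measure)
  then show ?thesis by simp
qed

text \<open>Survival requires the origin to be far from islands of every rank; the failures at the
  single ranks have probabilities summing to at most \<open>1 / 2\<close>.\<close>

lemma prob_all_quiet:
  fixes X :: "(int ^ 'd::finite) clock \<Rightarrow> real set"
  assumes n: "2 \<le> CARD('d)" and X: "\<And>c. X c \<in> sets borel" and pos: "0 < lam" "0 < rho"
    and small: "\<And>x. (\<Sum>c\<in>clocks_at x. measure (clock_law lam rho c) (X c)) \<le> small_prob CARD('d)"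
  shows "(\<Inter>k. quiet X k) \<in> sets (clock_measure lam rho)"
    and "1 / 2 \<le> measure (clock_measure lam rho) (\<Inter>k. quiet X k)"
proof -
  let ?M = "clock_measure lam rho :: ((int ^ 'd) clock \<Rightarrow> real) measure"
  interpret prob_space ?M by (rule prob_space_clock_measure[OF pos])
  have ev: "range (\<lambda>k. - quiet X k) \<subseteq> events" using quiet_event(1)[OF n X] by auto
  show Q: "(\<Inter>k. quiet X k) \<in> events" using quiet_event(2)[OF n X] by auto
  have sums: "(\<lambda>k. (1 / 2 :: real) ^ (k + 2)) sums (1 / 2)"
    using sums_mult[OF geometric_sums[of "1 / 2 :: real"], of "1 / 4"] by (simp add: power_add)
  have summ: "summable (\<lambda>k. prob (- quiet X k))"
    using quiet_event(3)[OF n X pos small]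
    by (intro summable_comparison_test[OF _ sums_summable[OF sums]]) auto
  have "prob (\<Union>k. - quiet X k) \<le> (\<Sum>k. prob (- quiet X k))"
    using ev summ by (rule finite_measure_subadditive_countably)
  also have "\<dots> \<le> (\<Sum>k. (1 / 2 :: real) ^ (k + 2))"
    using quiet_event(3)[OF n X pos small] summ sums_summable[OF sums] by (intro suminf_le) auto
  also have "\<dots> = 1 / 2" using sums by (rule sums_unique[symmetric])
  finally have "prob (space ?M - (\<Inter>k. quiet X k)) \<le> 1 / 2"
    by (simp add: Compl_eq_Diff_UNIV[symmetric] Compl_INT)
  then show "1 / 2 \<le> prob (\<Inter>k. quiet X k)" using prob_compl[OF Q] by simp
qed

subsection \<open>The three environments\<close>

lemma evolution_lattice: "evolution (lattice_adj :: int ^ 'd::finite \<Rightarrow> int ^ 'd \<Rightarrow> bool)"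
  by unfold_locales (rule finite_neighbours, rule finite_out_neighbours)

text \<open>In the quiet ball all bad sites belong to islands of rank below \<open>k\<close>.
  Leaving radius \<open>3 * small_scale CARD('d) k\<close> then forces \<open>2 * m\<close> to
  exceed twice the scale.\<close>

lemma quiet_leaves_ball:
  fixes x :: "int ^ 'd::finite"
  assumes n: "2 \<le> CARD('d)" and w: "w \<in> quiet X k" and reach: "reach (bad_sites X w) 0 m x"
  shows "dinf 0 x \<le> 3 * small_scale CARD('d) k \<or> small_scale CARD('d) k \<le> int m"
proof -
  let ?al = "small_scale CARD('d)" and ?S = "bad_sites X w"
  interpret sparse ?al "large_scale CARD('d)" "scale_base CARD('d)" "site_centres ?S"
    by (rule sparse_centres[OF n])
  have al: "0 < ?al j" for j by (rule scales_pos)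
  have inside: "y \<in> U k" if y: "y \<in> ?S" "dinf 0 y < 3 * ?al k + 1" for y
  proof -
    have "3 * ?al k \<le> reach_factor CARD('d) * ?al k"
      using al[of k] by (intro mult_right_mono) (auto simp: reach_factor_def)
    then have "y \<notin> site_core ?S k" using quiet_core[OF n w, of y] y(2) by linarith
    then obtain j p where "j < k" "p \<in> site_centres ?S j" "dinf p y \<le> ?al j"
      using core_cover[of ?al "large_scale CARD('d)", OF _ double_small_scale[OF n] y(1)] al less_imp_le
      by metis
    moreover have "?al j \<le> fat j" using al[of j] nd by (simp add: fat_def rf_def)
    ultimately show ?thesis using ball_subset_U by force
  qed
  have "0 < 3 * ?al k + 1" using al[of k] by linarith
  from reach_leaves_ball[OF reach inside this] show ?thesis using al[of k] by linarith
qed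

text \<open>A site that costs \<open>m\<close> paid steps is not occupied before time
  \<open>\<delta> * m\<close>, and few paid steps do not lead far.\<close>

lemma AE_no_explosion:
  assumes n: "2 \<le> CARD('d::finite)" and pos: "0 < lam" "0 < rho"
  shows "AE w in clock_measure lam rho.
    evolution.no_explosion lattice_adj (0 :: int ^ 'd) w"
proof -
  \<comment> \<open>At most \<open>3 ^ CARD('d)\<close> clocks of each spreading type, of rates 1
    and \<open>lam\<close>, may be shorter than \<open>\<delta>\<close>. Conversion occupies no new
    site, so it does not count as bad here.\<close>
  define \<delta> where "\<delta> = small_prob CARD('d) / (3 ^ CARD('d) * (1 + lam))"
  have \<delta>: "0 < \<delta>" using small_prob_pos[OF n] pos by (simp add: \<delta>_def)
  define X :: "(int ^ 'd) clock \<Rightarrow> real set" where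
    "X c = (case c of Convert x \<Rightarrow> {} | _ \<Rightarrow> {..\<delta>})" for c
  have X: "X c \<in> sets borel" for c by (cases c) (auto simp: X_def)
  have small: "(\<Sum>c\<in>clocks_at x. measure (clock_law lam rho c) (X c)) \<le> small_prob CARD('d)" for x
  proof -
    have "(\<Sum>c\<in>clocks_at x. measure (clock_law lam rho c) (X c)) \<le>
        3 ^ CARD('d) * \<delta> + 3 ^ CARD('d) * (lam * \<delta>) + 0"
      using clock_law_le(1,2)[OF pos less_imp_le[OF \<delta>]]
      by (intro sum_clocks_at_le) (auto simp: X_def)
    also have "\<dots> = 3 ^ CARD('d) * (1 + lam) * \<delta>" by (simp add: algebra_simps)
    also have "\<dots> = small_prob CARD('d)" using pos by (simp add: \<delta>_def)
    finally show ?thesis .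
  qed
  have calm: "evolution.no_explosion lattice_adj (0 :: int ^ 'd) w"
    if ev: "\<forall>\<^sub>F k in sequentially. w \<in> quiet X k" for w
  proof -
    interpret evolution lattice_adj "0 :: int ^ 'd" w by (rule evolution_lattice)
    let ?S = "bad_sites X w"
    have slow: "\<delta> < w (Spread1 x y)" "\<delta> < w (Spread2 x y)" if "x \<notin> ?S" "lattice_adj x y" for x y
      using that by (force simp: bad_sites_def clocks_at_def X_def)+
    define late where "late x t \<longleftrightarrow> (\<exists>m. reach ?S 0 m x \<and> ennreal (\<delta> * real m) \<le> t)" for x t
    have late_mono: "late x t'" if "late x t" "t \<le> t'" for x t t'
      using that unfolding late_def by (auto intro: order_trans)
    have late_step: "late y (t + ennreal r)"
      if xt: "late x t" and xy: "lattice_adj x y" "x \<notin> ?S \<Longrightarrow> \<delta> < r" for x y t r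
    proof -
      obtain m where m: "reach ?S 0 m x" "ennreal (\<delta> * real m) \<le> t" using xt by (auto simp: late_def)
      show ?thesis
      proof (cases "x \<in> ?S")
        case True
        have "reach ?S 0 m y" by (rule reach_free[OF m(1) xy(1) True])
        moreover have "ennreal (\<delta> * real m) \<le> t + ennreal r" using m(2) by (rule order_trans) simp
        ultimately show ?thesis by (auto simp: late_def)
      next
        case False
        have "reach ?S 0 (Suc m) y" by (rule reach_paid[OF m(1) xy(1)])
        moreover have "ennreal (\<delta> * real (Suc m)) = ennreal (\<delta> * real m) + ennreal \<delta>"
          using \<delta> by (simp add: distrib_left add.commute)
        then have "ennreal (\<delta> * real (Suc m)) \<le> t + ennreal r"
          using m(2) xy(2)[OF False] by (auto intro!: add_mono ennreal_leI)
        ultimately show ?thesis unfolding late_def by blast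
      qed
    qed
    have orig: "late 0 0" by (auto simp: late_def intro!: exI[of _ 0] reach_refl)
    have late_spread: "late y (t + ennreal r)"
      if "lattice_adj x y" "late x t" "min (a x) (b x) \<le> t" "r = w (Spread1 x y) \<or> r = w (Spread2 x y)" for x y t r
      using late_step[OF that(2,1), of r] slow[of x y] that(1,4) by auto
    have late: "a y < \<infinity> \<Longrightarrow> late y (a y)" "b y < \<infinity> \<Longrightarrow> late y (b y)" for y
      by (erule time_propagate[of late, OF orig, rotated -1]; (erule (1) late_mono | erule (3) late_spread))+
    show no_explosion
    proof (rule no_explosionI)
      fix T :: ennreal assume T: "T < \<infinity>"
      obtain N :: nat where N: "enn2real T / \<delta> < N" using reals_Archimedean2 by blast
      obtain k where k: "N \<le> k" "w \<in> quiet X k"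
        using ev by (auto simp: eventually_sequentially) (meson nat_le_linear order_refl)
      interpret sparse "small_scale CARD('d)" "large_scale CARD('d)" "scale_base CARD('d)"
        "site_centres ?S" by (rule sparse_centres[OF n])
      have "{y. a y \<le> T \<or> b y \<le> T} \<subseteq> {y. dinf 0 y \<le> 3 * small_scale CARD('d) k}"
      proof
        fix y assume "y \<in> {y. a y \<le> T \<or> b y \<le> T}"
        then have "a y \<le> T \<or> b y \<le> T" by simp
        moreover have "a y < \<infinity>" if "a y \<le> T" using that T by (rule le_less_trans)
        moreover have "b y < \<infinity>" if "b y \<le> T" using that T by (rule le_less_trans)
        ultimately have "late y T" using late late_mono by blast
        then obtain m where m: "reach ?S 0 m y" "ennreal (\<delta> * real m) \<le> T" by (auto simp: late_def)
        have "\<delta> * real m \<le> enn2real T"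
          using enn2real_mono[OF m(2)] T \<delta> by simp
        then have "real m \<le> enn2real T / \<delta>" using \<delta> by (simp add: field_simps)
        then have "int m < small_scale CARD('d) k" using N k(1) ge_Suc_al[of k] by linarith
        then show "y \<in> {y. dinf 0 y \<le> 3 * small_scale CARD('d) k}"
          using quiet_leaves_ball[OF n k(2) m(1)] by simp
      qed
      moreover have "0 \<le> 3 * small_scale CARD('d) k" using scales_pos(1)[of k] by simp
      ultimately show "finite {y. a y \<le> T \<or> b y \<le> T}"
        using card_dinf_ball(1) finite_subset by blast
    qed
  qed
  from AE_quiet[OF n X pos small] show ?thesis by eventually_elim (rule calm)
qed

text \<open>A good site converts within \<open>e\<close>, before any of its type 1 clocks rings, so
  it has no type 1 children. Sites of type 1 are therefore reached from the origin by free steps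
  alone and stay in a quiet ball. Badness reads only type 1 spreading and conversion, which makes
  \<open>rho_u\<close> independent of \<open>lam\<close>.\<close>

lemma dies_out:
  assumes n: "2 \<le> CARD('d::finite)"
  shows "\<exists>rho_u. \<forall>rho. 0 < rho \<and> rho_u < rho \<longrightarrow>
     (\<forall>lam>0. AE w in clock_measure lam rho. type1_dies_out lattice_adj (0 :: int ^ 'd) w)"
proof -
  \<comment> \<open>Half of the allowed probability goes to fast spreading, which fixes
    \<open>e\<close>; the other half goes to slow conversion, which fixes
    \<open>rho_u\<close>.\<close>
  define e where "e = small_prob CARD('d) / (2 * 3 ^ CARD('d))"
  define rho_u where "rho_u = ln (2 / small_prob CARD('d)) / e"
  have sp: "0 < small_prob CARD('d)" by (rule small_prob_pos[OF n])
  have e: "0 < e" using sp by (simp add: e_def)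
  have "AE w in clock_measure lam rho. type1_dies_out lattice_adj (0 :: int ^ 'd) w"
    if pos: "0 < lam" "0 < rho" and rho: "rho_u < rho" for lam rho
  proof -
    define X :: "(int ^ 'd) clock \<Rightarrow> real set" where
      "X c = (case c of Convert x \<Rightarrow> {e<..} | Spread1 x y \<Rightarrow> {..e} | Spread2 x y \<Rightarrow> {})" for c
    have X: "X c \<in> sets borel" for c by (cases c) (auto simp: X_def)
    have "ln (2 / small_prob CARD('d)) < e * rho"
      using rho e by (simp add: rho_u_def field_simps)
    then have "exp (- (e * rho)) \<le> exp (- ln (2 / small_prob CARD('d)))" by simp
    also have "\<dots> = small_prob CARD('d) / 2" using sp by (simp add: exp_minus)
    finally have conv: "exp (- (e * rho)) \<le> small_prob CARD('d) / 2" .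
    have small: "(\<Sum>c\<in>clocks_at x. measure (clock_law lam rho c) (X c)) \<le> small_prob CARD('d)" for x
    proof -
      have "(\<Sum>c\<in>clocks_at x. measure (clock_law lam rho c) (X c)) \<le>
          3 ^ CARD('d) * e + 3 ^ CARD('d) * 0 + small_prob CARD('d) / 2"
        using clock_law_le(1)[OF pos less_imp_le[OF e]]
          order_trans[OF clock_law_le(5)[OF pos less_imp_le[OF e]] conv]
        by (intro sum_clocks_at_le) (auto simp: X_def)
      also have "\<dots> = small_prob CARD('d)" by (simp add: e_def)
      finally show ?thesis .
    qed
    have die: "type1_dies_out lattice_adj (0 :: int ^ 'd) w"
      if ev: "\<forall>\<^sub>F k in sequentially. w \<in> quiet X k"
        and ne: "evolution.no_explosion lattice_adj (0 :: int ^ 'd) w" for w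
    proof -
      interpret evolution lattice_adj "0 :: int ^ 'd" w by (rule evolution_lattice)
      let ?S = "bad_sites X w"
      have quick: "w (Convert x) \<le> e" "e < w (Spread1 x y)" if "x \<notin> ?S" "lattice_adj x y" for x y
        using that by (force simp: bad_sites_def clocks_at_def X_def)+
      have orig: "reach ?S 0 0 0" by (rule reach_refl)
      have cluster_spread1: "reach ?S 0 0 y"
        if "lattice_adj x y" "a x < \<infinity>" "reach ?S 0 0 x" "a y = a x + ennreal (w (Spread1 x y))"
          "a y < \<infinity>" "a y \<le> b x" "a y \<le> a x + ennreal (w (Convert x))" for x y
      proof -
        have "x \<in> ?S"
        proof (rule ccontr)
          assume x: "x \<notin> ?S"
          have "w (Convert x) < w (Spread1 x y)" "0 < w (Spread1 x y)"
            using quick[OF x that(1)] e by linarith+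
          then have "a x + ennreal (w (Convert x)) < a x + ennreal (w (Spread1 x y))"
            using that(2) by (intro add_ennreal_less)
          then have "\<not> a y \<le> a x + ennreal (w (Convert x))" by (simp only: that(4) not_le)
          then show False using that(7) by blast
        qed
        then show ?thesis by (rule reach_free[OF that(3,1)])
      qed
      have cluster: "reach ?S 0 0 y" if "a y < \<infinity>" for y
        by (rule time_induct(1)[where Pa = "\<lambda>y. reach ?S 0 0 y" and Pb = "\<lambda>_. True", OF orig _ _ _ that])
          (erule (6) cluster_spread1, simp_all)
      obtain k where k: "w \<in> quiet X k"
        using ev by (auto simp: eventually_sequentially)
      have al: "0 < small_scale CARD('d) k" by (rule small_scale_pos[OF n])
      have "{y. a y < \<infinity>} \<subseteq> {y. dinf 0 y \<le> 3 * small_scale CARD('d) k}"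
        using quiet_leaves_ball[OF n k cluster] al by fastforce
      moreover have "finite {y :: int ^ 'd. dinf 0 y \<le> 3 * small_scale CARD('d) k}"
        using al by (intro card_dinf_ball(1)) simp
      ultimately have "finite {y. a y < \<infinity>}" by (rule finite_subset)
      then show ?thesis by (rule dies_if_finite[OF ne])
    qed
    from AE_quiet[OF n X pos small] AE_no_explosion[OF n pos]
    show ?thesis by eventually_elim (rule die)
  qed
  then show ?thesis by (intro exI[of _ rho_u]) blast
qed

subsection \<open>Survival\<close>

text \<open>The index sets in \<open>due1\<close> and \<open>due2\<close> depend on the clocks; as
  an infimum over a fixed countable type the value is seen to be measurable.\<close>

lemma INF_Collect_if:
  fixes f :: "'a \<Rightarrow> 'b::complete_lattice"
  shows "(INF x\<in>{x. P x}. f x) = (INF x. if P x then f x else top)"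
proof (rule antisym)
  show "(INF x. if P x then f x else top) \<le> (INF x\<in>{x. P x}. f x)"
    by (intro INF_greatest INF_lower2) auto
  show "(INF x\<in>{x. P x}. f x) \<le> (INF x. if P x then f x else top)"
    by (rule INF_greatest) (auto intro: INF_lower)
qed

lemma measurable_history:
  fixes adj :: "'v::countable \<Rightarrow> 'v \<Rightarrow> bool"
  shows "(\<lambda>w. fst (history adj orig w n) y) \<in> borel_measurable (clock_measure lam rho) \<and>
     (\<lambda>w. snd (history adj orig w n) y) \<in> borel_measurable (clock_measure lam rho)"
proof (induction n arbitrary: y)
  case 0
  then show ?case by (simp add: history_def)
next
  case (Suc n)
  let ?M = "clock_measure lam rho :: ('v clock \<Rightarrow> real) measure"
  let ?A = "\<lambda>w. fst (history adj orig w n)" and ?B = "\<lambda>w. snd (history adj orig w n)"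
  have [measurable]: "(\<lambda>w. ?A w y) \<in> borel_measurable ?M" "(\<lambda>w. ?B w y) \<in> borel_measurable ?M" for y
    using Suc by auto
  have "(\<lambda>w. due1 adj w (history adj orig w n) y) = (\<lambda>w. if ?A w y = \<infinity> \<and> ?B w y = \<infinity>
     then (INF x. if adj x y \<and> ?A w x < \<infinity> \<and> ?B w x = \<infinity> then ?A w x + ennreal (w (Spread1 x y)) else top)
     else \<infinity>)" for y
    by (simp add: due1_def case_prod_beta INF_Collect_if fun_eq_iff)
  then have D1 [measurable]: "(\<lambda>w. due1 adj w (history adj orig w n) y) \<in> borel_measurable ?M" for y
    by simp
  have "(\<lambda>w. due2 adj w (history adj orig w n) y) = (\<lambda>w. if ?B w y = \<infinity>
     then min (?A w y + ennreal (w (Convert y)))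
       (INF x. if adj x y \<and> ?B w x < \<infinity> then ?B w x + ennreal (w (Spread2 x y)) else top)
     else \<infinity>)" for y
    by (simp add: due2_def case_prod_beta INF_Collect_if fun_eq_iff)
  then have D2 [measurable]: "(\<lambda>w. due2 adj w (history adj orig w n) y) \<in> borel_measurable ?M" for y
    by simp
  define s where "s = (\<lambda>w. next_time adj w (history adj orig w n))"
  define d1 where "d1 = (\<lambda>w. due1 adj w (history adj orig w n) y)"
  define d2 where "d2 = (\<lambda>w. due2 adj w (history adj orig w n) y)"
  have [measurable]: "s \<in> borel_measurable ?M"
    unfolding s_def next_time_def by measurable
  have [measurable]: "d1 \<in> borel_measurable ?M" "d2 \<in> borel_measurable ?M"
    unfolding d1_def d2_def by measurable
  have [measurable]: "Measurable.pred ?M (\<lambda>w. d1 w = s w)" "Measurable.pred ?M (\<lambda>w. d2 w = s w)"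
    unfolding pred_def by (rule borel_measurable_eq; measurable)+
  have "history adj orig w (Suc n) = step adj w (history adj orig w n)" for w
    by (simp add: history_def)
  then have "(\<lambda>w. fst (history adj orig w (Suc n)) y) =
      (\<lambda>w. if s w < \<infinity> \<and> d1 w = s w \<and> d2 w \<noteq> s w then s w else ?A w y)"
    "(\<lambda>w. snd (history adj orig w (Suc n)) y) = (\<lambda>w. if s w < \<infinity> \<and> d2 w = s w then s w else ?B w y)"
    by (simp_all add: step_def Let_def s_def d1_def d2_def fun_eq_iff)
  then show ?case by simp
qed

lemma measurable_times [measurable]:
  fixes adj :: "'v::countable \<Rightarrow> 'v \<Rightarrow> bool"
  shows "(\<lambda>w. time1 adj orig w y) \<in> borel_measurable (clock_measure lam rho)"
    and "(\<lambda>w. time2 adj orig w y) \<in> borel_measurable (clock_measure lam rho)"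
  unfolding time1_def time2_def
  by (intro borel_measurable_INF conjunct1[OF measurable_history] conjunct2[OF measurable_history],
      simp)+

lemma survival_event:
  "{w. type1_survives lattice_adj (0 :: int ^ 'd::finite) w} \<in> sets (clock_measure lam rho)"
proof -
  have "{w. type1_survives lattice_adj (0 :: int ^ 'd) w} = {w \<in> space (clock_measure lam rho).
    \<forall>n::nat. \<exists>x. time1 lattice_adj 0 w x \<le> ennreal (real n) \<and> ennreal (real n) < time2 lattice_adj 0 w x}"
    by (simp add: evolution.survives_iff[OF evolution_lattice])
  also have "\<dots> \<in> sets (clock_measure lam rho)" by measurable
  finally show ?thesis .
qed

lemma survives_in_quiet_environment:
  fixes w :: "(int ^ 'd::finite) clock \<Rightarrow> real" and M K :: real
  assumes n: "2 \<le> CARD('d)" and w: "\<And>k. w \<in> quiet X k"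
    and ne: "evolution.no_explosion lattice_adj (0 :: int ^ 'd) w"
    and MK: "0 < M" "M * (sparse.lap TYPE('d) + 1) \<le> K"
    and X: "\<And>x y. - X (Spread1 x y) \<subseteq> {..<M}" "\<And>x y. - X (Spread2 x y) \<subseteq> {K<..}"
      "\<And>x. - X (Convert x) \<subseteq> {K<..}"
  shows "type1_survives lattice_adj (0 :: int ^ 'd) w"
proof -
  let ?al = "small_scale CARD('d)" and ?be = "large_scale CARD('d)" and ?S = "bad_sites X w"
  let ?P = "site_centres ?S"
  interpret sp: sparse ?al ?be "scale_base CARD('d)" ?P by (rule sparse_centres[OF n])
  interpret evolution lattice_adj "0 :: int ^ 'd" w by (rule evolution_lattice)
  have al: "0 \<le> ?al k" for k using sp.scales_pos(1)[of k] by simp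
  have be: "2 * ?al k \<le> ?be k" for k by (rule double_small_scale[OF n])
  interpret sparse_evolution ?al ?be "scale_base CARD('d)" ?P 0 w M K ?S
  proof
    show "w (Spread1 x y) < M" "K < w (Spread2 x y)" if "x \<notin> ?S" "lattice_adj x y" for x y
      using that X(1,2)[of x y] by (auto simp: bad_sites_def clocks_at_def)
    show "K < w (Convert x)" if "x \<notin> ?S" for x
      using that X(3)[of x] by (auto simp: bad_sites_def clocks_at_def)
    show "dinf p x \<le> ?al k \<or> (\<exists>j<k. \<exists>q\<in>?P j. dinf q x \<le> ?al j)"
      if "p \<in> ?P k" "x \<in> ?S" "dinf p x \<le> ?be k" for p k x
      by (rule near_centre[OF al be that])
    show "\<exists>k. \<exists>p\<in>?P k. dinf p x \<le> ?al k" if "x \<in> ?S" for x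
    proof -
      \<comment> \<open>Large enough for \<open>x\<close> to lie in the quiet ball of rank
        \<open>k\<close>, so \<open>x\<close> is removed in some earlier round.\<close>
      define k where "k = nat (dinf 0 x)"
      have "dinf 0 x \<le> ?al k" using sp.ge_Suc_al[of k] by (simp add: k_def)
      also have "\<dots> \<le> reach_factor CARD('d) * ?al k"
        using mult_right_mono[OF _ al, of 1 "reach_factor CARD('d)" k] by (simp add: reach_factor_def)
      finally have "x \<notin> site_core ?S k" using quiet_core[OF n w, of x k] by auto
      then show ?thesis using core_cover[of ?al ?be, OF al be that] by blast
    qed
    show "(sparse.rf TYPE('d) + 4) * ?al k < dinf p 0" if "p \<in> ?P k" for p k
    proof -
      have "p \<in> site_core ?S k" using centres_subset[of ?al k, OF al] that by (force simp: isolated_def)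
      moreover have "sparse.rf TYPE('d) + 4 = reach_factor CARD('d)"
        by (simp add: sp.rf_def sp.nd_def reach_factor_def)
      ultimately show ?thesis using quiet_core[OF n w, of p k] dinf_commute[of p 0] by simp
    qed
  qed (use MK ne in auto)
  show ?thesis by (rule survives)
qed

lemma survives_positive:
  assumes n: "2 \<le> CARD('d::finite)"
  shows "\<exists>rho_l>0. \<forall>rho. 0 < rho \<and> rho < rho_l \<longrightarrow>
     (\<exists>lam_l>0. \<forall>lam. 0 < lam \<and> lam < lam_l \<longrightarrow>
        \<P>(w in clock_measure lam rho. type1_survives lattice_adj (0 :: int ^ 'd) w) > 0)"
proof -
  define p0 where "p0 = small_prob CARD('d)"
  define D :: real where "D = 3 ^ CARD('d)"
  \<comment> \<open>Slow type 1 spreading, fast type 2 spreading and fast conversion get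
    \<open>p0 / 3\<close> each. \<open>m\<close> depends on the first alone and \<open>K\<close> on
    \<open>M\<close>; only then are \<open>rho\<close> and \<open>lam\<close> taken small against
    \<open>K\<close>, so there is no circularity.\<close>
  define m where "m = max 0 (ln (3 * D / p0))"
  define M where "M = m + 1"
  define K where "K = max 1 (M * (sparse.lap TYPE('d) + 1))"
  have p0: "0 < p0" unfolding p0_def by (rule small_prob_pos[OF n])
  have D: "0 < D" by (simp add: D_def)
  have M: "0 < M" "0 \<le> m" by (auto simp: M_def m_def)
  have K: "0 < K" "M * (sparse.lap TYPE('d) + 1) \<le> K" by (auto simp: K_def)
  have exp_m: "D * exp (- m) \<le> p0 / 3"
  proof -
    have "exp (- m) \<le> exp (- ln (3 * D / p0))" by (simp add: m_def)
    also have "\<dots> = p0 / (3 * D)" using p0 D by (simp add: exp_minus)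
    finally show ?thesis using D by (simp add: field_simps)
  qed
  have "\<P>(w in clock_measure lam rho. type1_survives lattice_adj (0 :: int ^ 'd) w) > 0"
    if pos: "0 < lam" "0 < rho" and small: "rho < p0 / (3 * K)" "lam < p0 / (3 * D * K)" for lam rho
  proof -
    let ?M = "clock_measure lam rho :: ((int ^ 'd) clock \<Rightarrow> real) measure"
    interpret prob_space ?M by (rule prob_space_clock_measure[OF pos])
    define X :: "(int ^ 'd) clock \<Rightarrow> real set" where
      "X c = (case c of Spread1 x y \<Rightarrow> {m<..} | _ \<Rightarrow> {..K})" for c
    have X: "X c \<in> sets borel" for c by (cases c) (auto simp: X_def)
    have sum: "(\<Sum>c\<in>clocks_at x. measure (clock_law lam rho c) (X c)) \<le> small_prob CARD('d)" for x
    proof -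
      have "(\<Sum>c\<in>clocks_at x. measure (clock_law lam rho c) (X c)) \<le>
          3 ^ CARD('d) * exp (- m) + 3 ^ CARD('d) * (lam * K) + rho * K"
        using clock_law_le(2,3)[OF pos less_imp_le[OF K(1)]] clock_law_le(4)[OF pos M(2)]
        by (intro sum_clocks_at_le) (auto simp: X_def)
      also have "\<dots> = D * exp (- m) + D * (lam * K) + rho * K" by (simp add: D_def)
      also have "rho * K \<le> p0 / 3" using small(1) K(1) by (simp add: field_simps)
      also have "D * (lam * K) \<le> p0 / 3" using small(2) K(1) D by (simp add: field_simps)
      finally show ?thesis using exp_m by (simp add: p0_def)
    qed
    have quiet: "(\<Inter>k. quiet X k) \<in> events" "1 / 2 \<le> prob (\<Inter>k. quiet X k)"
      using prob_all_quiet[OF n X pos sum] by auto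
    have "AE w in ?M. w \<in> (\<Inter>k. quiet X k) \<longrightarrow> w \<in> {w. type1_survives lattice_adj (0 :: int ^ 'd) w}"
      using AE_no_explosion[OF n pos]
    proof eventually_elim
      case (elim w)
      have "type1_survives lattice_adj (0 :: int ^ 'd) w" if "\<And>k. w \<in> quiet X k"
        by (rule survives_in_quiet_environment[OF n that elim M(1) K(2)]) (auto simp: X_def M_def)
      then show ?case by auto
    qed
    then have "prob (\<Inter>k. quiet X k) \<le> prob {w. type1_survives lattice_adj (0 :: int ^ 'd) w}"
      by (rule finite_measure_mono_AE) (rule survival_event)
    then show ?thesis using quiet(2) by simp
  qed
  then show ?thesis
    using p0 K(1) D by (intro exI[of _ "p0 / (3 * K)"] conjI allI impI exI[of _ "p0 / (3 * D * K)"]) auto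
qed

theorem theorem1p5:
  assumes "CARD('d::finite) \<ge> 2"
  shows "(\<exists>rho_l>0. \<forall>rho. 0 < rho \<and> rho < rho_l \<longrightarrow>
            (\<exists>lam_l>0. \<forall>lam. 0 < lam \<and> lam < lam_l \<longrightarrow>
               \<P>(w in clock_measure lam rho. type1_survives lattice_adj (0 :: int ^ 'd) w) > 0))
       \<and> (\<exists>rho_u. \<forall>rho. 0 < rho \<and> rho_u < rho \<longrightarrow>
            (\<forall>lam>0. AE w in clock_measure lam rho. type1_dies_out lattice_adj (0 :: int ^ 'd) w))"
  using survives_positive[OF assms] dies_out[OF assms] by (rule conjI)

end
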